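(* Let $d$ be a positive integer. (a) For any $f\in\hat\Lambda_d$, the Taylor expansion $T_1(f)$ has coefficients in $\mathbb Z[1/d]$, i.e. $T_1(f)\in\mathbb Z[1/d][[q-1]]$. (b) The Taylor expansion map $T_1:\hat\Lambda_d\to\mathbb Z[1/d][[q-1]]$ is injective. (c) For a rational homology 3-sphere $M$ with $|H_1(M,\mathbb Z)|=d$, the Taylor expansion $T_1(q^{(1-d)/4}I_M)$ is equal to the Ohtsuki series of $M$.
   Context: All 3-manifolds are closed and oriented; all links are framed, oriented, with ordered components. Rings. For a positive integer $d$ let $\mathbb N_d$ be the set of positive integers co-prime with $d$, $A_d=\mathbb Z[\frac1d][q^{\pm1/d}]$, $\Phi_s$ the $s$-th cyclotomic polynomial, $\Lambda_d=A_d\bigl[\frac1{\Phi_s(q^{1/d})},\ s\notin\mathbb N_d\bigr]\subset\mathbb Q(q^{1/d})$, $(q;q)_n=\prod_{i=1}^n(1-q^i)$, and $\hat\Lambda_d=\varprojlim_n\Lambda_d/((q;q)_n)$. $U_d$ is the set of complex roots of unity whose orders are odd and co-prime with $d$. Taylor expansion. An element of $\Lambda_d$, as a function of $q^{1/d}$, is analytic at $q^{1/d}=1$; its Taylor series in $q^{1/d}-1$ is converted to a power series in $q-1$ by $q^{1/d}-1=\sum_{n\ge1}\binom{1/d}{n}(q-1)^n$. This gives an algebra homomorphism $T_1:\Lambda_d\to\mathbb C[[q-1]]$, which extends to $T_1:\hat\Lambda_d\to\mathbb C[[q-1]]$ (as $(q;q)_n$ is divisible by $(q-1)^n$). Also $T_1(q^{(1-d)/4}I_M)=(1+(q-1))^{(1-d)/4}\,T_1(I_M)$.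 Evaluation. If $\xi$ is a root of unity of order $r$ and $f\in\mathbb Q[q^{\pm1/h}]$ with $h$ co-prime to $r$, let $b$ be the integer (unique mod $r$) with $(\xi^b)^h=\xi$ and put $\mathrm{ev}_\xi(f)=f|_{q^{1/h}=\xi^b}$. For $\xi\in U_d$ this extends to $\mathrm{ev}_\xi:\hat\Lambda_d\to\mathbb C$. Colored Jones polynomial. $\{n\}=q^{n/2}-q^{-n/2}$, $[n]=\{n\}/\{1\}$. For an $m$-component link $L\subset S^3$, $J_L(n_1,\dots,n_m)\in\mathbb Z[q^{\pm1/4}]$ is the quantum $sl_2$-invariant of $L$ with the $i$-th component colored by the irreducible $n_i$-dimensional module $V_{n_i}$. Normalization: for the $0$-framed unknot $J_U(n)=[n]$; increasing the framing of the $i$-th component by $1$ multiplies $J_L$ by $q^{(n_i^2-1)/4}$; when all colors are $2$, $J_L=\tilde J_L$ satisfies $q^{1/4}\tilde J_{L^+}-q^{-1/4}\tilde J_{L^-}=(q^{1/2}-q^{-1/2})\tilde J_{L^0}$ for blackboard-framed diagrams identical except near one crossing (positive, negative, resolved according to orientation), and $\tilde J$ is multiplicative under split union. General colors: multilinearly, $V_1=1$, $V_{n+1}=V_2V_n-V_{n-1}$, and coloring by $V_2^j$ means taking $j$ parallel copies colored by $V_2$. Quantum $SO(3)$-invariant. For $\xi$ of odd order $r$ put $F_L(\xi)=\sum\mathrm{ev}_\xi\bigl(J_L(n_1,\dots,n_m)\prod[n_i]\bigr)$, all $n_i$ running over the odd integers between $0$ and $2r$. If $M$ is obtained by surgery on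 $L\subset S^3$, $\sigma_\pm$ is the number of positive/negative eigenvalues of the linking matrix, and $U^\pm$ is the unknot with framing $\pm1$, then $\tau_M(\xi)=F_L(\xi)/\bigl(F_{U^+}(\xi)^{\sigma_+}F_{U^-}(\xi)^{\sigma_-}\bigr)$. The element $I_M$. For a rational homology 3-sphere $M$ with $|H_1(M,\mathbb Z)|=d$, $I_M\in\hat\Lambda_d$ is the (unique) element with $\tau_M(\xi)=\left(\frac dr\right)\mathrm{ev}_\xi(q^{(1-d)/4})\,\mathrm{ev}_\xi(I_M)$ for all $\xi\in U_d$, $\xi\ne1$, where $r$ is the order of $\xi$ and $\left(\frac dr\right)$ the Jacobi symbol. Ohtsuki series. For such $M$, the Ohtsuki series is the unique series $\sum_{n\ge0}\lambda_n(q-1)^n\in\mathbb Q[[q-1]]$ such that for each $N\geq 0$ and all sufficiently large primes $r$, with $\xi=e^{2\pi i/r}$, one has $\left(\frac dr\right)\tau_M(\xi)\equiv\sum_{n=0}^N\lambda_n(\xi-1)^n \pmod{(\xi-1)^{N+1}}$ in $\mathbb Z_{(r)}[\xi]$, where $\mathbb Z_{(r)}$ is $\mathbb Z$ localized at the prime $r$. *)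

theory Defs
  imports
    "HOL-Homology.Homology"
    "HOL-Complex_Analysis.Complex_Analysis"
    "HOL-Number_Theory.Number_Theory"
    "HOL-Library.Poly_Mapping"
    "HOL-Computational_Algebra.Computational_Algebra"
    "Jordan_Normal_Form.Char_Poly"
begin

no_notation Matrix.vec_index (infixl "$" 100)

section \<open>Coefficient rings\<close>

inductive_set subring_gen :: "'a::ring_1 set \<Rightarrow> 'a set" for S where
  gen: "x \<in> S \<Longrightarrow> x \<in> subring_gen S"
| one: "1 \<in> subring_gen S"
| diff: "x \<in> subring_gen S \<Longrightarrow> y \<in> subring_gen S \<Longrightarrow> x - y \<in> subring_gen S"
| mult: "x \<in> subring_gen S \<Longrightarrow> y \<in> subring_gen S \<Longrightarrow> x * y \<in> subring_gen S"

definition coprime_nats :: "nat \<Rightarrow> nat set" where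
  "coprime_nats d = {s. 0 < s \<and> coprime s d}"

definition primitive_roots_unity :: "nat \<Rightarrow> complex set" where
  "primitive_roots_unity s = {z. z ^ s = 1 \<and> (\<forall>k. 0 < k \<and> k < s \<longrightarrow> z ^ k \<noteq> 1)}"

definition cyclotomic :: "nat \<Rightarrow> rat poly" where
  "cyclotomic s = (THE p. map_poly of_rat p = (\<Prod>z\<in>primitive_roots_unity s. [:- z, 1:]))"

text \<open>The field of rational functions in \<open>q\<^sup>1\<^sup>/\<^sup>d\<close> is \<open>rat poly fract\<close>; its indeterminate
  \<open>qroot\<close> stands for \<open>q\<^sup>1\<^sup>/\<^sup>d\<close>, so that \<open>q\<close> is \<open>qroot ^ d\<close>.\<close>

definition qroot :: "rat poly fract" where
  "qroot = to_fract [:0, 1:]"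

definition A_ring :: "nat \<Rightarrow> rat poly fract set" where
  "A_ring d = subring_gen {inverse (of_nat d), qroot, inverse qroot}"

definition Lambda :: "nat \<Rightarrow> rat poly fract set" where
  "Lambda d = subring_gen (A_ring d \<union>
     {inverse (to_fract (cyclotomic s)) | s. 0 < s \<and> s \<notin> coprime_nats d})"

definition qpoch :: "nat \<Rightarrow> nat \<Rightarrow> rat poly fract" where
  "qpoch d n = (\<Prod>i=1..n. 1 - (qroot ^ d) ^ i)"

definition Lambda_coset :: "nat \<Rightarrow> nat \<Rightarrow> rat poly fract \<Rightarrow> rat poly fract set" where
  "Lambda_coset d n a = {a + qpoch d n * b | b. b \<in> Lambda d}"

text \<open>An element of the inverse limit is a sequence of cosets, the \<open>n\<close>-th one in the quotient of
  \<open>Lambda d\<close> by \<open>(q;q)\<^sub>n\<close>; compatibility under the projections is inclusion of cosets.\<close>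

definition hat_Lambda :: "nat \<Rightarrow> (nat \<Rightarrow> rat poly fract set) set" where
  "hat_Lambda d = {f. \<forall>n. (\<exists>a\<in>Lambda d. f n = Lambda_coset d n a) \<and> f (Suc n) \<subseteq> f n}"

section \<open>Taylor expansion and evaluation\<close>

definition eval_ratfun :: "rat poly fract \<Rightarrow> complex \<Rightarrow> complex" where
  "eval_ratfun f z = (THE y. \<exists>a b. f = Fract a b \<and> poly (map_poly of_rat b) z \<noteq> 0 \<and>
     y = poly (map_poly of_rat a) z / poly (map_poly of_rat b) z)"

text \<open>All series are in \<open>q - 1\<close>; \<open>fps_binomial a\<close> is \<open>(1 + (q - 1))\<close> raised to the power \<open>a\<close>.\<close>

definition taylor1 :: "nat \<Rightarrow> rat poly fract \<Rightarrow> complex fps" where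
  "taylor1 d f = fps_compose (fps_expansion (eval_ratfun f) 1) (fps_binomial (1 / of_nat d) - 1)"

text \<open>Since \<open>(q;q)\<^sub>n\<close> is divisible by the \<open>n\<close>-th power of \<open>q - 1\<close>, the coefficient of index \<open>n\<close> may be
  read off from any representative modulo \<open>(q;q)\<^sub>n\<^sub>+\<^sub>1\<close>.\<close>

definition hat_taylor1 :: "nat \<Rightarrow> (nat \<Rightarrow> rat poly fract set) \<Rightarrow> complex fps" where
  "hat_taylor1 d f = Abs_fps (\<lambda>n. fps_nth (taylor1 d (SOME a. a \<in> f (Suc n))) n)"

definition Z_inv :: "nat \<Rightarrow> complex set" where
  "Z_inv d = subring_gen {inverse (of_nat d)}"

definition root_order :: "complex \<Rightarrow> nat" where
  "root_order \<xi> = (LEAST r. 0 < r \<and> \<xi> ^ r = 1)"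

definition U_set :: "nat \<Rightarrow> complex set" where
  "U_set d = {\<xi>. (\<exists>r>0. \<xi> ^ r = 1) \<and> odd (root_order \<xi>) \<and> coprime (root_order \<xi>) d}"

text \<open>The value of \<open>q\<^sup>1\<^sup>/\<^sup>h\<close> under evaluation at \<open>\<xi>\<close>: the power of \<open>\<xi>\<close> whose \<open>h\<close>-th power is \<open>\<xi>\<close>
  (unique if \<open>h\<close> is coprime to the order of \<open>\<xi>\<close>).\<close>

definition ev_root :: "nat \<Rightarrow> complex \<Rightarrow> complex" where
  "ev_root h \<xi> = \<xi> powi (SOME b. (\<xi> powi b) ^ h = \<xi>)"

text \<open>\<open>(q;q)\<^sub>r\<close> vanishes at roots of unity of order \<open>r\<close>, so any representative modulo \<open>(q;q)\<^sub>r\<close> serves.\<close>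

definition hat_ev :: "nat \<Rightarrow> complex \<Rightarrow> (nat \<Rightarrow> rat poly fract set) \<Rightarrow> complex" where
  "hat_ev d \<xi> f = eval_ratfun (SOME a. a \<in> f (root_order \<xi>)) (ev_root d \<xi>)"

definition Jacobi :: "nat \<Rightarrow> nat \<Rightarrow> int" where
  "Jacobi a n = (\<Prod>p\<in>#prime_factorization n. Legendre (int a) (int p))"

section \<open>Framed links\<close>

text \<open>Links lie in \<open>\<real>\<^sup>3\<close>, inside its one-point compactification \<open>S\<^sup>3\<close>. A component is a smooth closed
  curve of period 1 together with a smooth framing vector field that is nowhere tangent to it.
  A link is the list of its components.\<close>

type_synonym framed_curve = "(real \<Rightarrow> real^3) \<times> (real \<Rightarrow> real^3)"

definition vd :: "(real \<Rightarrow> real^3) \<Rightarrow> real \<Rightarrow> real^3" where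
  "vd c t = vector_derivative c (at t)"

definition smooth_curve :: "(real \<Rightarrow> real^3) \<Rightarrow> bool" where
  "smooth_curve c \<longleftrightarrow> (\<forall>n t. (vd ^^ n) c differentiable at t)"

definition framed_knot :: "framed_curve \<Rightarrow> bool" where
  "framed_knot k \<longleftrightarrow> (case k of (c, v) \<Rightarrow>
     smooth_curve c \<and> smooth_curve v \<and>
     (\<forall>t. c (t + 1) = c t \<and> v (t + 1) = v t) \<and>
     inj_on c {0..<1} \<and>
     (\<forall>t. cross3 (vd c t) (v t) \<noteq> 0))"

definition framed_link :: "framed_curve list \<Rightarrow> bool" where
  "framed_link L \<longleftrightarrow> (\<forall>k\<in>set L. framed_knot k) \<and>
     (\<forall>i<length L. \<forall>j<length L. i \<noteq> j \<longrightarrow> range (fst (L ! i)) \<inter> range (fst (L ! j)) = {})"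

text \<open>Isotopy through framed links, continuous in the \<open>C\<^sup>1\<close> sense.\<close>

definition isotopic :: "framed_curve list \<Rightarrow> framed_curve list \<Rightarrow> bool" where
  "isotopic L L' \<longleftrightarrow> (\<exists>G. G 0 = L \<and> G (1::real) = L' \<and>
     (\<forall>s\<in>{0..1}. framed_link (G s) \<and> length (G s) = length L) \<and>
     (\<forall>i<length L.
        continuous_on ({0..1} \<times> UNIV) (\<lambda>(s, t). fst (G s ! i) t) \<and>
        continuous_on ({0..1} \<times> UNIV) (\<lambda>(s, t). vd (fst (G s ! i)) t) \<and>
        continuous_on ({0..1} \<times> UNIV) (\<lambda>(s, t). snd (G s ! i) t)))"

text \<open>Gauss linking integral; for the two right-handed crossings of a positive Hopf link it gives 1.\<close>

definition linking_number :: "(real \<Rightarrow> real^3) \<Rightarrow> (real \<Rightarrow> real^3) \<Rightarrow> real" where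
  "linking_number c c' = 1 / (4 * pi) * integral (cbox (0, 0) (1, 1))
     (\<lambda>(s, t). inner (c s - c' t) (cross3 (vd c s) (vd c' t)) / norm (c s - c' t) ^ 3)"

definition framing_number :: "framed_curve \<Rightarrow> real" where
  "framing_number k = (case k of (c, v) \<Rightarrow>
     Lim (at_right 0) (\<lambda>\<epsilon>. linking_number c (\<lambda>t. c t + \<epsilon> *\<^sub>R v t)))"

definition linking_matrix :: "framed_curve list \<Rightarrow> real Matrix.mat" where
  "linking_matrix L = Matrix.mat (length L) (length L) (\<lambda>(i, j).
     if i = j then framing_number (L ! i) else linking_number (fst (L ! i)) (fst (L ! j)))"

definition sigma_pos :: "framed_curve list \<Rightarrow> nat" where
  "sigma_pos L = size (filter_mset (\<lambda>x. 0 < x) (proots (char_poly (linking_matrix L))))"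

definition sigma_neg :: "framed_curve list \<Rightarrow> nat" where
  "sigma_neg L = size (filter_mset (\<lambda>x. x < 0) (proots (char_poly (linking_matrix L))))"

text \<open>The round unknot with framing \<open>k\<close>. The framing vector rotates \<open>k\<close> times from the outward normal
  towards the negative vertical, which is the right-handed sense around the tangent.\<close>

definition unknot :: "int \<Rightarrow> framed_curve" where
  "unknot k =
    ((\<lambda>t. vector [cos (2 * pi * t), sin (2 * pi * t), 0]),
     (\<lambda>t. vector [cos (2 * pi * k * t) * cos (2 * pi * t),
                  cos (2 * pi * k * t) * sin (2 * pi * t),
                  - sin (2 * pi * k * t)]))"

section \<open>Colored Jones polynomial\<close>

text \<open>A Laurent polynomial in \<open>q\<^sup>1\<^sup>/\<^sup>4\<close>: the coefficient at \<open>k\<close> belongs to \<open>q\<^sup>k\<^sup>/\<^sup>4\<close>.\<close>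

type_synonym laurent4 = "int \<Rightarrow>\<^sub>0 int"

abbreviation v_pow :: "int \<Rightarrow> laurent4" where
  "v_pow k \<equiv> Poly_Mapping.single k 1"

definition q_brace :: "nat \<Rightarrow> laurent4" where
  "q_brace n = v_pow (2 * int n) - v_pow (- 2 * int n)"

text \<open>The quotient of \<open>q_brace n\<close> by \<open>q_brace 1\<close>, expanded as a geometric sum.\<close>

definition q_int :: "nat \<Rightarrow> laurent4" where
  "q_int n = (\<Sum>k<n. v_pow (2 * (int n - 1 - 2 * int k)))"

lemma q_int_mult_brace: "q_int n * q_brace 1 = q_brace n"
proof -
  define f :: "nat \<Rightarrow> laurent4" where "f k = v_pow (2 * int n - 4 * int k)" for k
  have "q_int n * q_brace 1 = (\<Sum>k<n. f k - f (Suc k))"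
    unfolding q_int_def q_brace_def sum_distrib_right f_def
    by (rule sum.cong) (auto simp: right_diff_distrib mult_single algebra_simps)
  also have "\<dots> = f 0 - f n"
    by (rule sum_lessThan_telescope')
  also have "\<dots> = q_brace n"
    by (simp add: f_def q_brace_def)
  finally show ?thesis .
qed

text \<open>The skein relation is imposed inside the cube \<open>[-1, 1]\<^sup>3\<close>, seen from above along the third axis.
  A framed oriented link is compared there as a set of triples (point, unit tangent, framing vector),
  so neither the parametrisation nor the distribution of the arcs over the components matters.
  Inside the cube the link consists of two upward strands (graphs over the second coordinate)
  with vertical framing; for such strands this framing is isotopic to the blackboard framing.\<close>

definition oriented_points :: "framed_curve list \<Rightarrow> ((real^3) \<times> (real^3) \<times> (real^3)) set" where
  "oriented_points L = (\<Union>(c, v)\<in>set L. range (\<lambda>t. (c t, sgn (vd c t), v t)))"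

definition cube :: "(real^3) set" where
  "cube = {p. \<forall>i. \<bar>p $ i\<bar> \<le> 1}"

definition inside :: "framed_curve list \<Rightarrow> ((real^3) \<times> (real^3) \<times> (real^3)) set" where
  "inside L = {x \<in> oriented_points L. fst x \<in> cube}"

definition outside :: "framed_curve list \<Rightarrow> ((real^3) \<times> (real^3) \<times> (real^3)) set" where
  "outside L = {x \<in> oriented_points L. fst x \<notin> cube}"

definition two_strands :: "framed_curve list \<Rightarrow> (real \<Rightarrow> real^3) \<Rightarrow> (real \<Rightarrow> real^3) \<Rightarrow> bool" where
  "two_strands L a b \<longleftrightarrow>
     smooth_curve a \<and> smooth_curve b \<and>
     (\<forall>y. a y $ 2 = y \<and> b y $ 2 = y) \<and>
     (\<forall>y\<in>{-1..1}. a y \<in> cube \<and> b y \<in> cube) \<and>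
     inside L = (\<Union>c\<in>{a, b}. (\<lambda>y. (c y, sgn (vd c y), axis 3 1)) ` {-1..1})"

text \<open>Strand \<open>a\<close> runs from bottom left to top right, strand \<open>b\<close> from bottom right to top left.\<close>

definition strands_cross :: "(real \<Rightarrow> real^3) \<Rightarrow> (real \<Rightarrow> real^3) \<Rightarrow> bool" where
  "strands_cross a b \<longleftrightarrow>
     (\<forall>y\<in>{-1..<0}. a y $ 1 < b y $ 1) \<and> a 0 $ 1 = b 0 $ 1 \<and> (\<forall>y\<in>{0<..1}. b y $ 1 < a y $ 1)"

definition skein_triple ::
  "framed_curve list \<Rightarrow> framed_curve list \<Rightarrow> framed_curve list \<Rightarrow> bool" where
  "skein_triple Lpos Lneg Lzero \<longleftrightarrow>
     framed_link Lpos \<and> framed_link Lneg \<and> framed_link Lzero \<and>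
     outside Lpos = outside Lneg \<and> outside Lneg = outside Lzero \<and>
     (\<exists>a b. two_strands Lpos a b \<and> strands_cross a b \<and> b 0 $ 3 < a 0 $ 3) \<and>
     (\<exists>a b. two_strands Lneg a b \<and> strands_cross a b \<and> a 0 $ 3 < b 0 $ 3) \<and>
     (\<exists>a b. two_strands Lzero a b \<and> (\<forall>y\<in>{-1..1}. a y $ 1 < b y $ 1))"

definition split_link :: "framed_curve list \<Rightarrow> framed_curve list \<Rightarrow> bool" where
  "split_link L L' \<longleftrightarrow> (\<forall>k\<in>set L. \<forall>t. fst k t $ 1 < 0) \<and> (\<forall>k\<in>set L'. \<forall>t. 0 < fst k t $ 1)"

text \<open>\<open>jones_rel L p\<close>: the normalization, isotopy invariance, framing, split union and skein rules
  force the value \<open>p\<close> on \<open>L\<close> with all colors 2. Crossing changes reduce every link to an unlink,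
  so every framed link has exactly one such value.\<close>

inductive jones_rel :: "framed_curve list \<Rightarrow> laurent4 \<Rightarrow> bool" where
  empty: "jones_rel [] 1"
| unknot: "jones_rel [unknot 0] (q_int 2)"
| isotopy: "jones_rel L p \<Longrightarrow> isotopic L L' \<Longrightarrow> jones_rel L' p"
| order: "jones_rel L p \<Longrightarrow> mset L = mset L' \<Longrightarrow> jones_rel L' p"
| split: "jones_rel L p \<Longrightarrow> jones_rel L' p' \<Longrightarrow> split_link L L' \<Longrightarrow> jones_rel (L @ L') (p * p')"
| framing: "jones_rel (L @ (c, v) # L') p \<Longrightarrow> framed_link (L @ (c, v') # L') \<Longrightarrow>
    framing_number (c, v') = framing_number (c, v) + of_int k \<Longrightarrow>
    jones_rel (L @ (c, v') # L') (v_pow (3 * k) * p)"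
| skein_pos: "skein_triple Lpos Lneg Lzero \<Longrightarrow> jones_rel Lneg p_neg \<Longrightarrow> jones_rel Lzero p_zero \<Longrightarrow>
    v_pow 1 * p_pos - v_pow (- 1) * p_neg = (v_pow 2 - v_pow (- 2)) * p_zero \<Longrightarrow>
    jones_rel Lpos p_pos"
| skein_neg: "skein_triple Lpos Lneg Lzero \<Longrightarrow> jones_rel Lpos p_pos \<Longrightarrow> jones_rel Lzero p_zero \<Longrightarrow>
    v_pow 1 * p_pos - v_pow (- 1) * p_neg = (v_pow 2 - v_pow (- 2)) * p_zero \<Longrightarrow>
    jones_rel Lneg p_neg"

text \<open>\<open>n\<close> copies of a framed curve, pushed off along the framing at spacing \<open>\<epsilon>\<close>.\<close>

definition parallels :: "real \<Rightarrow> framed_curve \<Rightarrow> nat \<Rightarrow> framed_curve list" where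
  "parallels \<epsilon> k n = map (\<lambda>i. (\<lambda>t. fst k t + (\<epsilon> * real i) *\<^sub>R snd k t, snd k)) [0..<n]"

definition cable :: "real \<Rightarrow> framed_curve list \<Rightarrow> nat list \<Rightarrow> framed_curve list" where
  "cable \<epsilon> L js = concat (map2 (parallels \<epsilon>) L js)"

definition jones_cable :: "framed_curve list \<Rightarrow> nat list \<Rightarrow> laurent4" where
  "jones_cable L js = (THE p. \<forall>\<^sub>F \<epsilon> in at_right 0. jones_rel (cable \<epsilon> L js) p)"

text \<open>\<open>V\<^sub>n\<close> as a polynomial in \<open>V\<^sub>2\<close>.\<close>

fun V_poly :: "nat \<Rightarrow> int poly" where
  "V_poly 0 = 0"
| "V_poly (Suc 0) = 1"
| "V_poly (Suc (Suc n)) = [:0, 1:] * V_poly (Suc n) - V_poly n"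

definition colored_jones :: "framed_curve list \<Rightarrow> nat list \<Rightarrow> laurent4" where
  "colored_jones L ns =
     (\<Sum>js\<in>{js. length js = length L \<and> (\<forall>i<length L. js ! i \<le> degree (V_poly (ns ! i)))}.
        of_int (\<Prod>i<length L. coeff (V_poly (ns ! i)) (js ! i)) * jones_cable L js)"

section \<open>Quantum SO(3) invariant\<close>

definition ev_laurent4 :: "complex \<Rightarrow> laurent4 \<Rightarrow> complex" where
  "ev_laurent4 \<xi> f =
     (\<Sum>k\<in>Poly_Mapping.keys f. of_int (Poly_Mapping.lookup f k) * ev_root 4 \<xi> powi k)"

definition F_link :: "framed_curve list \<Rightarrow> complex \<Rightarrow> complex" where
  "F_link L \<xi> =
     (\<Sum>ns\<in>{ns. length ns = length L \<and> set ns \<subseteq> {n. odd n \<and> n < 2 * root_order \<xi>}}.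
        ev_laurent4 \<xi> (colored_jones L ns * prod_list (map q_int ns)))"

definition tau_link :: "framed_curve list \<Rightarrow> complex \<Rightarrow> complex" where
  "tau_link L \<xi> = F_link L \<xi> /
     (F_link [unknot 1] \<xi> ^ sigma_pos L * F_link [unknot (- 1)] \<xi> ^ sigma_neg L)"

section \<open>Oriented 3-manifolds and surgery\<close>

text \<open>A closed oriented connected 3-manifold \<open>(X, \<mu>)\<close>: the orientation is a fundamental class, that is, an
  element of the third homology group restricting to a generator of each local homology group.\<close>

definition local_class :: "'a topology \<Rightarrow> 'a chain set \<Rightarrow> 'a \<Rightarrow> 'a chain set" where
  "local_class X \<mu> x = hom_induced 3 X {} X (topspace X - {x}) id \<mu>"

definition closed_oriented_3manifold :: "'a topology \<Rightarrow> 'a chain set \<Rightarrow> bool" where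
  "closed_oriented_3manifold X \<mu> \<longleftrightarrow>
     compact_space X \<and> Hausdorff_space X \<and> connected_space X \<and> topspace X \<noteq> {} \<and>
     (\<forall>x\<in>topspace X. \<exists>U. openin X U \<and> x \<in> U \<and>
        subtopology X U homeomorphic_space (euclidean :: (real^3) topology)) \<and>
     \<mu> \<in> carrier (homology_group 3 X) \<and>
     (\<forall>x\<in>topspace X. carrier (relative_homology_group 3 X (topspace X - {x})) =
        range (\<lambda>k::int. local_class X \<mu> x [^]\<^bsub>relative_homology_group 3 X (topspace X - {x})\<^esub> k))"

definition torsion_homology :: "int \<Rightarrow> 'a topology \<Rightarrow> bool" where
  "torsion_homology p X \<longleftrightarrow> (\<forall>a\<in>carrier (homology_group p X).
     \<exists>n::nat. 0 < n \<and> a [^]\<^bsub>homology_group p X\<^esub> n = \<one>\<^bsub>homology_group p X\<^esub>)"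

text \<open>Rational homology vanishes in a given degree iff integral homology is torsion there. In degrees
  0 and 3 the rational homology of a closed connected oriented 3-manifold is that of the sphere.\<close>

definition rational_homology_3sphere :: "'a topology \<Rightarrow> 'a chain set \<Rightarrow> bool" where
  "rational_homology_3sphere X \<mu> \<longleftrightarrow>
     closed_oriented_3manifold X \<mu> \<and> torsion_homology 1 X \<and> torsion_homology 2 X"

definition H1_order :: "'a topology \<Rightarrow> nat" where
  "H1_order X = card (carrier (homology_group 1 X))"

definition positive_simplex :: "(nat \<Rightarrow> real^3) \<Rightarrow> bool" where
  "positive_simplex v \<longleftrightarrow> 0 < inner (v 1 - v 0) (cross3 (v 2 - v 0) (v 3 - v 0))"

definition affine_simplex :: "(nat \<Rightarrow> real^3) \<Rightarrow> (nat \<Rightarrow> real) \<Rightarrow> real^3" where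
  "affine_simplex v = restrict (\<lambda>x. \<Sum>j\<le>3. x j *\<^sub>R v j) (standard_simplex 3)"

text \<open>An embedding \<open>f\<close> of an open set of \<open>\<real>\<^sup>3\<close> preserves orientation iff it takes the local class of a
  positive affine simplex to the local orientation class given by \<open>\<mu>\<close>.\<close>

definition orientation_preserving ::
  "(real^3) set \<Rightarrow> 'a topology \<Rightarrow> 'a chain set \<Rightarrow> (real^3 \<Rightarrow> 'a) \<Rightarrow> bool" where
  "orientation_preserving U X \<mu> f \<longleftrightarrow>
     (\<forall>v. positive_simplex v \<and> convex hull (v ` {..3}) \<subseteq> U \<longrightarrow>
        (\<forall>p\<in>interior (convex hull (v ` {..3})).
           local_class X \<mu> (f p) =
           homologous_rel_set 3 X (topspace X - {f p})
             (frag_of (simplex_map 3 f (affine_simplex v)))))"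

abbreviation sphere3 :: "(real^3) option topology" where
  "sphere3 \<equiv> Alexandroff_compactification euclidean"

text \<open>For fixed \<open>t\<close>, \<open>tube \<epsilon> k t\<close> maps the disc to the normal disc spanned by the framing vector (real
  axis) and the binormal direction (imaginary axis).\<close>

definition tube :: "real \<Rightarrow> framed_curve \<Rightarrow> real \<Rightarrow> complex \<Rightarrow> real^3" where
  "tube \<epsilon> k t w = (case k of (c, v) \<Rightarrow>
     c t + \<epsilon> *\<^sub>R (Re w *\<^sub>R v t + Im w *\<^sub>R cross3 (vd c t) (v t)))"

text \<open>The tubes are required to embed with radius 2, so that the tubes of radius 1 are tame and have
  disjoint closures.\<close>

definition embedded_tubes :: "real \<Rightarrow> framed_curve list \<Rightarrow> bool" where
  "embedded_tubes \<epsilon> L \<longleftrightarrow> 0 < \<epsilon> \<and>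
     inj_on (\<lambda>(i, t, w). tube \<epsilon> (L ! i) t w) ({..<length L} \<times> {0..<1} \<times> cball 0 2)"

definition tubes :: "real \<Rightarrow> framed_curve list \<Rightarrow> complex set \<Rightarrow> (real^3) set" where
  "tubes \<epsilon> L D = (\<Union>k\<in>set L. \<Union>t. tube \<epsilon> k t ` D)"

text \<open>\<open>X\<close> is the union of the exterior of the link, embedded by \<open>e\<close> preserving orientation, and of
  solid tori \<open>D\<^sup>2 \<times> S\<^sup>1\<close>, embedded by the maps \<open>g i\<close>, which meet the exterior exactly along the
  boundary. The meridian discs of the \<open>i\<close>-th solid torus are bounded by parallels of the \<open>i\<close>-th
  component (along its framing).\<close>

definition surgery_presentation :: "framed_curve list \<Rightarrow> 'a topology \<Rightarrow> 'a chain set \<Rightarrow> bool" where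
  "surgery_presentation L X \<mu> \<longleftrightarrow> framed_link L \<and>
    (\<exists>\<epsilon> e (g :: nat \<Rightarrow> complex \<times> complex \<Rightarrow> 'a).
      let E = topspace sphere3 - Some ` tubes \<epsilon> L (ball 0 1);
          W = (\<lambda>i. g i ` (cball 0 1 \<times> sphere 0 1))
      in embedded_tubes \<epsilon> L \<and>
         embedding_map (subtopology sphere3 E) X e \<and>
         orientation_preserving (- tubes \<epsilon> L (cball 0 1)) X \<mu> (e \<circ> Some) \<and>
         (\<forall>i<length L.
            embedding_map (top_of_set (cball 0 1 \<times> sphere 0 1)) X (g i) \<and>
            (\<forall>t. \<forall>w\<in>sphere 0 1. g i (cis (2 * pi * t), w) = e (Some (tube \<epsilon> (L ! i) t w))) \<and>
            g i ` (ball 0 1 \<times> sphere 0 1) \<inter> e ` E = {} \<and>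
            (\<forall>j<length L. i \<noteq> j \<longrightarrow> W i \<inter> W j = {})) \<and>
         topspace X = e ` E \<union> (\<Union>i<length L. W i))"

definition tau :: "'a topology \<Rightarrow> 'a chain set \<Rightarrow> complex \<Rightarrow> complex" where
  "tau X \<mu> \<xi> = (THE z. \<exists>L. surgery_presentation L X \<mu> \<and> z = tau_link L \<xi>)"

section \<open>The unified invariant and the Ohtsuki series\<close>

definition is_unified_invariant ::
  "'a topology \<Rightarrow> 'a chain set \<Rightarrow> (nat \<Rightarrow> rat poly fract set) \<Rightarrow> bool" where
  "is_unified_invariant X \<mu> I \<longleftrightarrow> (let d = H1_order X in
     I \<in> hat_Lambda d \<and>
     (\<forall>\<xi>\<in>U_set d. \<xi> \<noteq> 1 \<longrightarrow>
        tau X \<mu> \<xi> = of_int (Jacobi d (root_order \<xi>)) *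
          ev_root 4 \<xi> powi (1 - int d) * hat_ev d \<xi> I))"

definition Z_localized :: "nat \<Rightarrow> rat set" where
  "Z_localized r = {a. \<not> int r dvd snd (quotient_of a)}"

definition Z_localized_adjoin :: "nat \<Rightarrow> complex \<Rightarrow> complex set" where
  "Z_localized_adjoin r \<xi> = subring_gen (of_rat ` Z_localized r \<union> {\<xi>})"

definition cong_in :: "'a::comm_ring_1 set \<Rightarrow> 'a \<Rightarrow> 'a \<Rightarrow> 'a \<Rightarrow> bool" where
  "cong_in R a b m \<longleftrightarrow> a \<in> R \<and> b \<in> R \<and> (\<exists>c\<in>R. a - b = m * c)"

definition is_Ohtsuki_series :: "'a topology \<Rightarrow> 'a chain set \<Rightarrow> complex fps \<Rightarrow> bool" where
  "is_Ohtsuki_series X \<mu> S \<longleftrightarrow>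
     (\<forall>n. fps_nth S n \<in> \<rat>) \<and>
     (\<forall>N. \<exists>R. \<forall>r\<ge>R. prime r \<longrightarrow>
        (let \<xi> = cis (2 * pi / real r) in
         cong_in (Z_localized_adjoin r \<xi>)
           (of_int (Jacobi (H1_order X) r) * tau X \<mu> \<xi>)
           (\<Sum>n\<le>N. fps_nth S n * (\<xi> - 1) ^ n)
           ((\<xi> - 1) ^ (N + 1))))"

definition Ohtsuki_series :: "'a topology \<Rightarrow> 'a chain set \<Rightarrow> complex fps" where
  "Ohtsuki_series X \<mu> = (THE S. is_Ohtsuki_series X \<mu> S)"

text \<open>Taylor expansion of \<open>q\<close> to the power \<open>(1 - d) / 4\<close> times an element of \<open>hat_Lambda d\<close>.\<close>

definition normalized_taylor1 :: "nat \<Rightarrow> (nat \<Rightarrow> rat poly fract set) \<Rightarrow> complex fps" where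
  "normalized_taylor1 d I = fps_binomial ((1 - of_nat d) / 4) * hat_taylor1 d I"

end

theory Submission
  imports Defs "HOL-Library.Real_Mod"
begin

text \<open>Write \<open>x\<close> for \<open>q\<^sup>1\<^sup>/\<^sup>d\<close>. If \<open>S\<close> is coprime to \<open>d\<close>, the inverted cyclotomic polynomials are
  already units in \<open>\<int>[1/d][x]\<close> modulo \<open>x\<^sup>S - 1\<close>, so modulo any power of \<open>x\<^sup>S - 1\<close> every element of
  \<open>Lambda d\<close> is a polynomial with coefficients in \<open>\<int>[1/d]\<close>. With \<open>S = 1\<close> this reduces the integrality
  of Taylor coefficients to that of the binomial series of exponent \<open>1/d\<close>. For injectivity, an element
  with vanishing Taylor expansion is divisible by all powers of \<open>x - 1\<close>. For a prime \<open>p\<close> not dividing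
  \<open>d\<close>, \<open>x\<^sup>p\<^sup>S - 1\<close> is congruent to \<open>(x\<^sup>S - 1)\<^sup>p\<close> modulo \<open>p\<close>, so divisibility by all powers of \<open>x\<^sup>S - 1\<close> makes
  the element infinitely \<open>p\<close>-divisible modulo each power of \<open>x\<^sup>p\<^sup>S - 1\<close>, hence zero there; thus it is
  divisible by all powers of all \<open>x\<^sup>S - 1\<close>, and so by all \<open>(q;q)\<^sub>n\<close>. For the comparison with the Ohtsuki
  series, \<open>\<xi>\<^sup>1\<^sup>/\<^sup>d\<close> and \<open>\<xi>\<^sup>1\<^sup>/\<^sup>4\<close> are congruent modulo powers of \<open>\<xi> - 1\<close> to their binomial series in \<open>\<xi> - 1\<close>.
  The Ohtsuki series is unique because \<open>\<xi> - 1\<close> is not a unit, which follows from Eisenstein's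
  argument for the cyclotomic polynomial of prime order.\<close>

section \<open>Subrings and monic division\<close>

text \<open>A cyclotomic polynomial is inverted only if its index \<open>t\<close> shares a prime
  \<open>p\<close> with \<open>d\<close>. With \<open>z = x^(t/p)\<close> it divides the sum of
  \<open>z^i\<close> over \<open>i < p\<close>, and modulo \<open>x^S - 1\<close> this sum divides
  \<open>p\<close> as soon as \<open>S\<close> is prime to \<open>p\<close>; finally
  \<open>p\<close> is a unit of Z[1/d]. This is why \<open>S\<close> has to be coprime to
  \<open>d\<close>. Modulo \<open>(x^S - 1)^k\<close> there is a unique polynomial remainder of
  degree below \<open>k * S\<close>, so divisibility by \<open>p\<close> can be read off from
  coefficients in Z[1/d]. The obstacle to injectivity is that an element of the completion has no
  single representative: the \<open>n\<close>-th one is known only modulo \<open>(q;q)_n\<close>.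
  Divisibility by powers of \<open>x^S - 1\<close> is therefore asked of arbitrarily late
  representatives and carried back to index \<open>n\<close> at the end. The cyclotomic factors of
  \<open>(q;q)_n\<close> with index not coprime to \<open>d\<close> are units of
  \<open>Lambda d\<close>; the others are absorbed by a suitable \<open>x^S - 1\<close>. For the
  Ohtsuki series, values of power series at \<open>\<xi> - 1\<close> are replaced by truncations
  modulo powers of \<open>\<xi> - 1\<close>, and roots are compared through the uniqueness of a
  \<open>d\<close>-th root congruent to 1.\<close>

locale unital_subring =
  fixes R :: "'a::comm_ring_1 set"
  assumes one_closed: "1 \<in> R"
    and diff_closed: "\<And>x y. x \<in> R \<Longrightarrow> y \<in> R \<Longrightarrow> x - y \<in> R"
    and mult_closed: "\<And>x y. x \<in> R \<Longrightarrow> y \<in> R \<Longrightarrow> x * y \<in> R"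
begin

lemma zero_closed: "0 \<in> R"
  using diff_closed[OF one_closed one_closed] by simp

lemma uminus_closed: "x \<in> R \<Longrightarrow> - x \<in> R"
  using diff_closed[OF zero_closed] by fastforce

lemma add_closed: "x \<in> R \<Longrightarrow> y \<in> R \<Longrightarrow> x + y \<in> R"
  using diff_closed[of x "- y"] uminus_closed by simp

lemma power_closed: "x \<in> R \<Longrightarrow> x ^ n \<in> R"
  by (induction n) (auto intro: one_closed mult_closed)

lemma sum_closed: "(\<And>i. i \<in> A \<Longrightarrow> f i \<in> R) \<Longrightarrow> sum f A \<in> R"
  by (induction A rule: infinite_finite_induct) (auto intro: zero_closed add_closed)

lemma prod_closed: "(\<And>i. i \<in> A \<Longrightarrow> f i \<in> R) \<Longrightarrow> prod f A \<in> R"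
  by (induction A rule: infinite_finite_induct) (auto intro: one_closed mult_closed)

lemma of_nat_closed: "of_nat n \<in> R"
  by (induction n) (auto intro: zero_closed one_closed add_closed)

lemma of_int_closed: "of_int n \<in> R"
  by (cases n rule: int_cases2) (auto intro: of_nat_closed uminus_closed)

lemma Ints_subset: "\<int> \<subseteq> R"
  by (auto elim!: Ints_cases intro: of_int_closed)

end

lemma unital_subring_Ints: "unital_subring (\<int> :: 'a::comm_ring_1 set)"
  by unfold_locales auto

lemma unital_subring_gen: "unital_subring (subring_gen (S :: 'a::comm_ring_1 set))"
  by unfold_locales (auto intro: subring_gen.intros)

lemma subring_gen_subset:
  assumes "unital_subring R" "S \<subseteq> R"
  shows "subring_gen S \<subseteq> R"
proof
  fix x assume "x \<in> subring_gen S"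
  then show "x \<in> R"
    by induction (use assms in \<open>auto intro: unital_subring.one_closed unital_subring.diff_closed
      unital_subring.mult_closed\<close>)
qed

text \<open>Coefficient rings are sets inside a fixed type, not types of their own; polynomials and
  later power series over them are therefore subsets too.\<close>

definition polys_over :: "'a::comm_ring_1 set \<Rightarrow> 'a poly set" where
  "polys_over R = {p. \<forall>i. coeff p i \<in> R}"

lemma unital_subring_polys_over:
  assumes "unital_subring R"
  shows "unital_subring (polys_over R)"
proof -
  interpret unital_subring R by fact
  show ?thesis
    by unfold_locales
      (auto simp: polys_over_def coeff_mult coeff_1 intro!: one_closed zero_closed diff_closed
        sum_closed mult_closed)
qed

lemma polys_over_mono: "R \<subseteq> R' \<Longrightarrow> polys_over R \<subseteq> polys_over R'"
  by (auto simp: polys_over_def)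

lemma monom_polys_over:
  "unital_subring R \<Longrightarrow> c \<in> R \<Longrightarrow> monom c n \<in> polys_over R"
  by (auto simp: polys_over_def unital_subring.zero_closed)

lemma pCons_polys_over: "a \<in> R \<Longrightarrow> p \<in> polys_over R \<Longrightarrow> pCons a p \<in> polys_over R"
  by (auto simp: polys_over_def coeff_pCons split: nat.split)

text \<open>With leading coefficient 1 no reduction step divides, so quotient and remainder stay
  over \<open>R\<close>.\<close>

lemma monic_division:
  fixes M :: "'a::idom poly"
  assumes R: "unital_subring R" and M: "M \<in> polys_over R" "lead_coeff M = 1"
    and p: "p \<in> polys_over R"
  shows "\<exists>q\<in>polys_over R. \<exists>s\<in>polys_over R. p = M * q + s \<and> (s = 0 \<or> degree s < degree M)"
  using p
proof (induction "degree p" arbitrary: p rule: less_induct)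
  case less
  interpret P: unital_subring "polys_over R" by (rule unital_subring_polys_over[OF R])
  show ?case
  proof (cases "p = 0 \<or> degree p < degree M")
    case True
    then show ?thesis using less.prems P.zero_closed
      by (intro bexI[of _ 0] bexI[of _ p]) auto
  next
    case False
    define t where "t = monom (lead_coeff p) (degree p - degree M)"
    have t: "t \<in> polys_over R"
      unfolding t_def using less.prems by (intro monom_polys_over R) (auto simp: polys_over_def)
    have p': "p - M * t \<in> polys_over R"
      using less.prems t M(1) by (intro P.diff_closed P.mult_closed)
    have dt: "degree t = degree p - degree M"
      using False by (simp add: t_def degree_monom_eq)
    have "M \<noteq> 0" using M(2) by auto
    have "degree (M * t) = degree p"
      using False \<open>M \<noteq> 0\<close> dt by (subst degree_mult_eq) (auto simp: t_def)
    moreover have "lead_coeff (M * t) = lead_coeff p"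
      using M(2) dt by (simp add: lead_coeff_mult t_def)
    ultimately have c: "coeff (p - M * t) (degree p) = 0" "degree (p - M * t) \<le> degree p"
      by (auto intro: degree_diff_le)
    have "p - M * t = 0 \<or> degree (p - M * t) < degree p"
      using eq_zero_or_degree_less[OF c(2,1)] .
    then show ?thesis
    proof
      assume "p - M * t = 0"
      then show ?thesis using t P.zero_closed
        by (intro bexI[of _ t] bexI[of _ 0]) auto
    next
      assume "degree (p - M * t) < degree p"
      from less.hyps[OF this p'] obtain q s where qs: "q \<in> polys_over R" "s \<in> polys_over R"
        "p - M * t = M * q + s" "s = 0 \<or> degree s < degree M" by blast
      have "p = M * (t + q) + s" using qs(3) by (simp add: algebra_simps)
      then show ?thesis using qs t P.add_closed by blast
    qed
  qed
qed

text \<open>In a domain the quotient by a monic polynomial is unique, hence equals the one that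
  \<open>monic_division\<close> finds over \<open>R\<close>.\<close>

lemma monic_quotient_polys_over:
  fixes M :: "'a::idom poly"
  assumes R: "unital_subring R" and M: "M \<in> polys_over R" "lead_coeff M = 1"
    and "M * q \<in> polys_over R"
  shows "q \<in> polys_over R"
proof -
  from monic_division[OF assms] obtain q' s where qs: "q' \<in> polys_over R"
    "M * q = M * q' + s" "s = 0 \<or> degree s < degree M" by blast
  have s: "M * (q - q') = s" using qs(2) by (simp add: algebra_simps)
  have "q - q' = 0"
  proof (rule ccontr)
    assume nz: "q - q' \<noteq> 0"
    have "M \<noteq> 0" using M(2) by auto
    with nz have "degree s \<ge> degree M" "s \<noteq> 0" by (auto simp: s[symmetric] degree_mult_eq)
    with qs(3) show False by auto
  qed
  then show ?thesis using qs(1) by simp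
qed

section \<open>Cyclotomic polynomials\<close>

lemma finite_primitive_roots_unity: "0 < n \<Longrightarrow> finite (primitive_roots_unity n)"
  by (rule finite_subset[OF _ finite_roots_unity[of n]]) (auto simp: primitive_roots_unity_def)

lemma root_order_dvd:
  fixes z :: complex
  assumes "0 < n" "z ^ n = 1"
  shows "0 < root_order z" "z ^ root_order z = 1" "root_order z dvd n"
    "z \<in> primitive_roots_unity (root_order z)"
proof -
  let ?s = "root_order z"
  have *: "0 < ?s \<and> z ^ ?s = 1"
    unfolding root_order_def by (rule LeastI_ex) (use assms in blast)
  have min: "z ^ k \<noteq> 1" if "0 < k" "k < ?s" for k
    using not_less_Least[of k "\<lambda>r. 0 < r \<and> z ^ r = 1"] that unfolding root_order_def by auto
  show "0 < ?s" "z ^ ?s = 1" using * by auto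
  show "z \<in> primitive_roots_unity ?s" using * min by (auto simp: primitive_roots_unity_def)
  have "z ^ n = (z ^ ?s) ^ (n div ?s) * z ^ (n mod ?s)"
    unfolding power_mult[symmetric] power_add[symmetric] by simp
  then have "z ^ (n mod ?s) = 1" using * assms by simp
  then have "\<not> 0 < n mod ?s" using min[of "n mod ?s"] * by auto
  then show "?s dvd n" by auto
qed

lemma primitive_roots_unity_unique:
  assumes "z \<in> primitive_roots_unity s" "z \<in> primitive_roots_unity t" "0 < s" "0 < t"
  shows "s = t"
  using assms by (auto simp: primitive_roots_unity_def) (meson linorder_neqE_nat)

definition complex_cyclotomic :: "nat \<Rightarrow> complex poly" where
  "complex_cyclotomic n = (\<Prod>z\<in>primitive_roots_unity n. [:- z, 1:])"

lemma lead_coeff_complex_cyclotomic: "lead_coeff (complex_cyclotomic n) = 1"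
  by (simp add: complex_cyclotomic_def lead_coeff_prod)

text \<open>\<open>x^n - 1\<close> has no multiple root, and its roots fall into disjoint classes
  according to their exact order, a divisor of \<open>n\<close>.\<close>

lemma prod_complex_cyclotomic:
  assumes "0 < n"
  shows "(\<Prod>s | s dvd n. complex_cyclotomic s) = monom 1 n - 1"
proof -
  let ?p = "monom 1 n - 1 :: complex poly"
  have roots: "poly ?p z = 0 \<longleftrightarrow> z ^ n = 1" for z by (simp add: poly_monom)
  have lc: "degree ?p = n" "lead_coeff ?p = 1"
  proof -
    have "degree (monom 1 n + (- 1) :: complex poly) = n"
      using assms by (subst degree_add_eq_left) (auto simp: degree_monom_eq)
    then show "degree ?p = n" by simp
    then show "lead_coeff ?p = 1" using assms by (simp add: coeff_1)
  qed
  have "rsquarefree ?p"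
    unfolding rsquarefree_roots
  proof (intro allI notI)
    fix a assume a: "poly ?p a = 0 \<and> poly (pderiv ?p) a = 0"
    then have "of_nat n * a ^ (n - 1) = 0"
      by (simp add: pderiv_diff pderiv_monom poly_monom)
    then have "a = 0" using assms by auto
    with a assms show False by (simp add: poly_monom power_0_left)
  qed
  from complex_poly_decompose_rsquarefree[OF this]
  have "?p = (\<Prod>z | z ^ n = 1. [:-z, 1:])" using lc roots by simp
  also have "{z. z ^ n = 1} = (\<Union>s\<in>{s. s dvd n}. primitive_roots_unity s)" (is "?A = ?B")
  proof
    show "?A \<subseteq> ?B" using root_order_dvd[OF assms] by blast
    show "?B \<subseteq> ?A" by (auto simp: primitive_roots_unity_def power_mult elim!: dvdE)
  qed
  also have "(\<Prod>z\<in>\<dots>. [:-z, 1:]) = (\<Prod>s | s dvd n. complex_cyclotomic s)"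
    unfolding complex_cyclotomic_def
  proof (rule prod.UNION_disjoint)
    show "finite {s. s dvd n}" using assms by simp
    have pos: "0 < s" if "s dvd n" for s using dvd_pos_nat[OF assms that] .
    then show "\<forall>s\<in>{s. s dvd n}. finite (primitive_roots_unity s)"
      using finite_primitive_roots_unity by blast
    show "\<forall>s\<in>{s. s dvd n}. \<forall>t\<in>{s. s dvd n}. s \<noteq> t \<longrightarrow>
        primitive_roots_unity s \<inter> primitive_roots_unity t = {}"
      using pos primitive_roots_unity_unique by blast
  qed
  finally show ?thesis by simp
qed

lemma monom_minus_one_polys_over:
  "unital_subring R \<Longrightarrow> monom 1 n - 1 \<in> polys_over R"
  by (intro unital_subring.diff_closed unital_subring_polys_over monom_polys_over
      unital_subring.one_closed)

text \<open>Strong induction: the factors for proper divisors form a monic integral polynomial, so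
  the quotient of \<open>x^n - 1\<close> by it is integral as well.\<close>

lemma complex_cyclotomic_polys_over_Ints: "0 < n \<Longrightarrow> complex_cyclotomic n \<in> polys_over \<int>"
proof (induction n rule: less_induct)
  case (less n)
  interpret P: unital_subring "polys_over (\<int> :: complex set)"
    by (rule unital_subring_polys_over[OF unital_subring_Ints])
  let ?M = "\<Prod>s\<in>{s. s dvd n} - {n}. complex_cyclotomic s"
  have "?M * complex_cyclotomic n = monom 1 n - 1"
    using less.prems by (simp add: prod.remove[of _ n] mult.commute flip: prod_complex_cyclotomic)
  moreover have "?M \<in> polys_over \<int>"
  proof (rule P.prod_closed)
    fix s assume "s \<in> {s. s dvd n} - {n}"
    then have "s \<le> n" "s \<noteq> n" "0 < s"
      using dvd_imp_le[OF _ less.prems] dvd_pos_nat[OF less.prems] by auto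
    then show "complex_cyclotomic s \<in> polys_over \<int>" by (intro less.IH) auto
  qed
  moreover have "lead_coeff ?M = 1"
    unfolding lead_coeff_prod by (simp only: lead_coeff_complex_cyclotomic prod.neutral_const)
  ultimately show ?case
    using monic_quotient_polys_over[OF unital_subring_Ints, of ?M]
      monom_minus_one_polys_over[OF unital_subring_Ints] by metis
qed

lemma map_poly_of_rat_eq_iff:
  "map_poly (of_rat :: rat \<Rightarrow> 'a::field_char_0) p = map_poly of_rat q \<longleftrightarrow> p = q"
  by (simp add: poly_eq_iff coeff_map_poly)

lemma map_poly_of_rat_mult:
  "map_poly (of_rat :: rat \<Rightarrow> 'a::field_char_0) (p * q) = map_poly of_rat p * map_poly of_rat q"
  by (simp add: poly_eq_iff coeff_map_poly coeff_mult of_rat_sum of_rat_mult)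

lemma map_poly_of_rat_diff:
  "map_poly (of_rat :: rat \<Rightarrow> 'a::field_char_0) (p - q) = map_poly of_rat p - map_poly of_rat q"
  by (simp add: poly_eq_iff coeff_map_poly of_rat_diff)

text \<open>Justifies the definite description in \<open>cyclotomic\<close>: integrality over the
  complex numbers provides a rational polynomial, and the coefficientwise embedding is
  injective.\<close>

lemma map_poly_cyclotomic:
  assumes "0 < n"
  shows "map_poly of_rat (cyclotomic n) = complex_cyclotomic n"
proof -
  have "\<forall>i. coeff (complex_cyclotomic n) i \<in> \<rat>"
    using complex_cyclotomic_polys_over_Ints[OF assms] Ints_subset_Rats
    by (auto simp: polys_over_def)
  then obtain p where p: "complex_cyclotomic n = map_poly of_rat p"
    using ratpolyE by blast
  have "cyclotomic n = p"
    unfolding cyclotomic_def complex_cyclotomic_def[symmetric] p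
    by (rule the_equality) (simp_all add: map_poly_of_rat_eq_iff)
  with p show ?thesis by simp
qed

lemma of_rat_in_Ints_iff: "(of_rat x :: 'a::field_char_0) \<in> \<int> \<longleftrightarrow> x \<in> \<int>"
proof
  assume "(of_rat x :: 'a) \<in> \<int>"
  then obtain k where "(of_rat x :: 'a) = of_rat (of_int k)" by (auto elim!: Ints_cases)
  then show "x \<in> \<int>" by (simp only: of_rat_eq_iff) auto
qed (auto elim!: Ints_cases)

lemma cyclotomic_polys_over_Ints: "0 < n \<Longrightarrow> cyclotomic n \<in> polys_over \<int>"
  using complex_cyclotomic_polys_over_Ints[of n]
  by (auto simp: polys_over_def of_rat_in_Ints_iff simp flip: map_poly_cyclotomic)

lemma lead_coeff_cyclotomic: "0 < n \<Longrightarrow> lead_coeff (cyclotomic n) = 1"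
  using lead_coeff_complex_cyclotomic[of n] by (simp flip: map_poly_cyclotomic)

lemma cyclotomic_nonzero: "0 < n \<Longrightarrow> cyclotomic n \<noteq> 0"
  using lead_coeff_cyclotomic[of n] by auto

lemma prod_cyclotomic:
  assumes "0 < n"
  shows "(\<Prod>s | s dvd n. cyclotomic s) = monom 1 n - 1"
proof -
  have hom_prod: "map_poly (of_rat :: rat \<Rightarrow> complex) (\<Prod>s\<in>A. cyclotomic s) =
      (\<Prod>s\<in>A. map_poly of_rat (cyclotomic s))" for A
    by (induction A rule: infinite_finite_induct)
      (simp_all add: map_poly_of_rat_mult)
  have "map_poly (of_rat :: rat \<Rightarrow> complex) (\<Prod>s | s dvd n. cyclotomic s) =
      (\<Prod>s | s dvd n. complex_cyclotomic s)"
    unfolding hom_prod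
    by (intro prod.cong) (auto simp: map_poly_cyclotomic dvd_pos_nat[OF assms])
  also have "\<dots> = map_poly of_rat (monom 1 n - 1)"
    using assms by (simp add: prod_complex_cyclotomic map_poly_of_rat_diff map_poly_monom)
  finally show ?thesis by (simp only: map_poly_of_rat_eq_iff)
qed

section \<open>The ring \<open>Lambda d\<close> modulo powers of \<open>q\<^sup>S\<^sup>/\<^sup>d - 1\<close>\<close>

lemma geometric_sum_mult:
  fixes z :: "'a::idom"
  assumes "z \<noteq> 1"
  shows "(\<Sum>i<a. z ^ i) * (\<Sum>j<b. (z ^ a) ^ j) = (\<Sum>i<a * b. z ^ i)"
proof -
  have "(z - 1) * ((\<Sum>i<a. z ^ i) * (\<Sum>j<b. (z ^ a) ^ j)) = (z ^ a - 1) * (\<Sum>j<b. (z ^ a) ^ j)"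
    by (simp add: power_diff_1_eq[of z a] mult.assoc)
  also have "\<dots> = (z - 1) * (\<Sum>i<a * b. z ^ i)"
    by (simp only: power_diff_1_eq[symmetric] power_mult)
  finally show ?thesis using assms by simp
qed

lemma geometric_sum_cong_of_nat:
  fixes z :: "'a::comm_ring_1"
  assumes "unital_subring R" "z \<in> R"
  shows "\<exists>A\<in>R. (\<Sum>i<n. z ^ i) = of_nat n + (z - 1) * A"
proof
  interpret unital_subring R by fact
  show "(\<Sum>i<n. \<Sum>k<i. z ^ k) \<in> R" by (intro sum_closed power_closed assms)
  have "(\<Sum>i<n. z ^ i) = (\<Sum>i<n. 1 + (z ^ i - 1))" by simp
  also have "\<dots> = of_nat n + (\<Sum>i<n. z ^ i - 1)" by (simp only: sum.distrib) simp
  also have "(\<Sum>i<n. z ^ i - 1) = (z - 1) * (\<Sum>i<n. \<Sum>k<i. z ^ k)"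
    unfolding sum_distrib_left by (intro sum.cong refl) (simp only: power_diff_1_eq sum_distrib_left)
  finally show "(\<Sum>i<n. z ^ i) = of_nat n + (z - 1) * (\<Sum>i<n. \<Sum>k<i. z ^ k)" .
qed

text \<open>Let \<open>P\<close> be the sum of \<open>z^i\<close> over \<open>i < p\<close>, and
  \<open>E\<close>, \<open>G\<close> as in the proof. Modulo \<open>z^S - 1\<close> the Bezout
  relation gives \<open>P * G = 1 + l * E\<close>, while \<open>(z - 1) * E = 0\<close> gives
  \<open>P * E = p * E\<close>. The multiplier \<open>H = p * G - l * E\<close> cancels the
  \<open>E\<close> terms and leaves \<open>p\<close>.\<close>

lemma geometric_sum_unit:
  fixes z :: "'a::idom"
  assumes R: "unital_subring R" "z \<in> R" and "z \<noteq> 1" and ml: "p * m = S * l + 1"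
  shows "\<exists>H\<in>R. \<exists>W\<in>R. (\<Sum>i<p. z ^ i) * H = of_nat p + (z ^ S - 1) * W"
proof -
  interpret unital_subring R by fact
  define E G where "E = (\<Sum>i<S. z ^ i)" and "G = (\<Sum>j<m. (z ^ p) ^ j)"
  have zE: "(z - 1) * E = z ^ S - 1" by (simp add: E_def power_diff_1_eq)
  obtain A where A: "A \<in> R" "(\<Sum>i<p. z ^ i) = of_nat p + (z - 1) * A"
    using geometric_sum_cong_of_nat[OF R] by blast
  obtain B where B: "B \<in> R" "(\<Sum>j<l. (z ^ S) ^ j) = of_nat l + (z ^ S - 1) * B"
    using geometric_sum_cong_of_nat[OF R(1) power_closed[OF R(2)]] by blast
  have "(\<Sum>i<p. z ^ i) * G = (\<Sum>i<Suc (S * l). z ^ i)"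
    unfolding G_def using geometric_sum_mult[OF \<open>z \<noteq> 1\<close>, of p m] ml by simp
  also have "\<dots> = 1 + z * (\<Sum>i<S * l. z ^ i)"
    by (subst sum.lessThan_Suc_shift) (simp add: sum_distrib_left)
  also have "(\<Sum>i<S * l. z ^ i) = E * (of_nat l + (z ^ S - 1) * B)"
    using geometric_sum_mult[OF \<open>z \<noteq> 1\<close>, of S l] B(2) by (simp add: E_def)
  finally have PG: "(\<Sum>i<p. z ^ i) * G = 1 + z * (E * (of_nat l + (z ^ S - 1) * B))" .
  have PE: "(\<Sum>i<p. z ^ i) * E = of_nat p * E + (z ^ S - 1) * A"
    unfolding A(2) zE[symmetric] by (simp add: algebra_simps)
  have "(\<Sum>i<p. z ^ i) * (of_nat p * G - of_nat l * E) =
      of_nat p * ((\<Sum>i<p. z ^ i) * G) - of_nat l * ((\<Sum>i<p. z ^ i) * E)"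
    by (simp add: algebra_simps)
  also have "\<dots> = of_nat p + of_nat p * of_nat l * ((z - 1) * E)
      + (z ^ S - 1) * (of_nat p * z * E * B - of_nat l * A)"
    unfolding PG PE by (simp add: algebra_simps)
  also have "\<dots> = of_nat p + (z ^ S - 1) * (of_nat p * of_nat l + of_nat p * z * E * B - of_nat l * A)"
    unfolding zE by (simp add: algebra_simps)
  finally have *: "(\<Sum>i<p. z ^ i) * (of_nat p * G - of_nat l * E) = of_nat p +
      (z ^ S - 1) * (of_nat p * of_nat l + of_nat p * z * E * B - of_nat l * A)" .
  have "E \<in> R" "G \<in> R" unfolding E_def G_def by (intro sum_closed power_closed R)+
  then have "of_nat p * G - of_nat l * E \<in> R"
    "of_nat p * of_nat l + of_nat p * z * E * B - of_nat l * A \<in> R"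
    using R(2) A(1) B(1) by (auto intro!: diff_closed add_closed mult_closed of_nat_closed)
  with * show ?thesis by blast
qed

definition rat_Z_inv :: "nat \<Rightarrow> rat set" where
  "rat_Z_inv d = subring_gen {inverse (of_nat d)}"

interpretation rat_Z_inv: unital_subring "rat_Z_inv d" for d
  unfolding rat_Z_inv_def by (rule unital_subring_gen)

interpretation rat_Z_inv_poly: unital_subring "polys_over (rat_Z_inv d)" for d
  by (rule unital_subring_polys_over[OF rat_Z_inv.unital_subring_axioms])

interpretation A_ring: unital_subring "A_ring d" for d
  unfolding A_ring_def by (rule unital_subring_gen)

interpretation Lambda: unital_subring "Lambda d" for d
  unfolding Lambda_def by (rule unital_subring_gen)

lemma inverse_in_rat_Z_inv:
  assumes "p dvd d" "0 < d"
  shows "inverse (of_nat p) \<in> rat_Z_inv d"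
proof -
  obtain e where "d = p * e" using assms by auto
  then have "inverse (of_nat p) = of_nat e * inverse (of_nat d :: rat)"
    using assms by (simp add: field_simps)
  also have "\<dots> \<in> rat_Z_inv d"
    by (intro rat_Z_inv.mult_closed rat_Z_inv.of_nat_closed)
      (auto simp: rat_Z_inv_def intro: subring_gen.gen)
  finally show ?thesis .
qed

lemma polys_over_Ints_rat_Z_inv: "polys_over \<int> \<subseteq> polys_over (rat_Z_inv d)"
  by (intro polys_over_mono rat_Z_inv.Ints_subset)

lemma cyclotomic_unit_mod:
  assumes "0 < d" "0 < t" "\<not> coprime t d" "0 < S" "coprime S d"
  shows "\<exists>u\<in>polys_over (rat_Z_inv d). \<exists>w\<in>polys_over (rat_Z_inv d).
    cyclotomic t * u = 1 + (monom 1 S - 1) * w"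
proof -
  obtain p where p: "prime p" "p dvd t" "p dvd d"
  proof -
    have "gcd t d \<noteq> 1" using assms(3) coprime_iff_gcd_eq_1 by blast
    then obtain p where "prime p" "p dvd gcd t d" using prime_factor_nat by blast
    then show ?thesis using that by auto
  qed
  obtain m where t: "t = p * m" using p(2) by auto
  have "0 < m" using t assms(2) by auto
  have "coprime p S" using p(3) assms(5) coprime_common_divisor
    by (meson coprime_commute coprime_divisors dvd_refl)
  then obtain m' l where ml: "p * m' = S * l + 1"
    using bezout_nat[of p S] prime_gt_0_nat[OF p(1)] coprime_iff_gcd_eq_1 by (metis less_irrefl)
  interpret Z: unital_subring "polys_over (\<int> :: rat set)"
    by (rule unital_subring_polys_over[OF unital_subring_Ints])
  define z :: "rat poly" where "z = monom 1 m"
  have z: "z \<noteq> 1" using \<open>0 < m\<close> monom_eq_1_iff[of 1 m] by (auto simp: z_def)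
  have zR: "z \<in> polys_over (rat_Z_inv d)" unfolding z_def
    by (intro monom_polys_over rat_Z_inv.unital_subring_axioms rat_Z_inv.one_closed)
  have zS: "(monom 1 S :: rat poly) ^ m = z ^ S" by (simp add: z_def monom_power mult.commute)
  \<comment> \<open>The cofactor of \<open>cyclotomic t\<close> in
    \<open>(x^t - 1) / (x^m - 1)\<close>, whose cyclotomic factors are those with index dividing
    \<open>t\<close> but not \<open>m\<close>.\<close>
  define C where "C = (\<Prod>s\<in>{s. s dvd t \<and> \<not> s dvd m} - {t}. cyclotomic s)"
  have fin: "finite {s. s dvd t}" using assms(2) by simp
  have sub: "{s. s dvd m} \<subseteq> {s. s dvd t}" using t by auto
  have "(z - 1) * (\<Sum>i<p. z ^ i) = (\<Prod>s | s dvd t. cyclotomic s)"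
    unfolding power_diff_1_eq[symmetric] prod_cyclotomic[OF assms(2)]
    by (simp add: z_def monom_power t mult.commute)
  also have "\<dots> = (\<Prod>s\<in>{s. s dvd t} - {s. s dvd m}. cyclotomic s) * (\<Prod>s | s dvd m. cyclotomic s)"
    by (rule prod.subset_diff[OF sub fin])
  also have "{s. s dvd t} - {s. s dvd m} = {s. s dvd t \<and> \<not> s dvd m}" by auto
  also have "(\<Prod>s | s dvd m. cyclotomic s) = z - 1"
    using prod_cyclotomic[OF \<open>0 < m\<close>] by (simp add: z_def)
  also have "(\<Prod>s | s dvd t \<and> \<not> s dvd m. cyclotomic s) = cyclotomic t * C"
    unfolding C_def using fin t \<open>0 < m\<close> prime_gt_1_nat[OF p(1)]
    by (intro prod.remove) (auto dest: dvd_imp_le)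
  finally have PC: "(\<Sum>i<p. z ^ i) = cyclotomic t * C" using z by (simp add: mult.commute)
  have C: "C \<in> polys_over (rat_Z_inv d)"
    unfolding C_def using dvd_pos_nat[OF assms(2)] polys_over_Ints_rat_Z_inv
    by (intro rat_Z_inv_poly.prod_closed) (auto intro!: cyclotomic_polys_over_Ints)
  obtain H W where H: "H \<in> polys_over (rat_Z_inv d)" and W: "W \<in> polys_over (rat_Z_inv d)"
    and HW: "(\<Sum>i<p. z ^ i) * H = of_nat p + (z ^ S - 1) * W"
    using geometric_sum_unit[OF rat_Z_inv_poly.unital_subring_axioms zR z ml] by blast
  \<comment> \<open>The constant \<open>1 / p\<close>, available because \<open>p\<close> divides
    \<open>d\<close>.\<close>
  define c :: "rat poly" where "c = [:inverse (of_nat p):]"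
  have c: "c \<in> polys_over (rat_Z_inv d)"
    unfolding c_def using inverse_in_rat_Z_inv[OF p(3) assms(1)] rat_Z_inv_poly.zero_closed
    by (intro pCons_polys_over)
  have cp: "c * of_nat p = 1"
    using prime_gt_0_nat[OF p(1)] by (simp add: c_def of_nat_poly one_pCons)
  \<comment> \<open>With \<open>z = x^m\<close>, the modulus \<open>z^S - 1\<close> obtained so far
    is a multiple of the wanted \<open>x^S - 1\<close>.\<close>
  define V :: "rat poly" where "V = (\<Sum>i<m. (monom 1 S) ^ i)"
  have V: "V \<in> polys_over (rat_Z_inv d)" unfolding V_def
    by (intro rat_Z_inv_poly.sum_closed rat_Z_inv_poly.power_closed monom_polys_over
        rat_Z_inv.unital_subring_axioms rat_Z_inv.one_closed)
  have VS: "z ^ S - 1 = (monom 1 S - 1) * V"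
    unfolding V_def power_diff_1_eq[symmetric] zS ..
  have "cyclotomic t * (C * H * c) = c * ((\<Sum>i<p. z ^ i) * H)"
    unfolding PC by (simp add: mult_ac)
  also have "\<dots> = c * of_nat p + (monom 1 S - 1) * (c * V * W)"
    unfolding HW VS by (simp add: algebra_simps)
  finally have "cyclotomic t * (C * H * c) = 1 + (monom 1 S - 1) * (c * V * W)"
    unfolding cp .
  then show ?thesis
    using rat_Z_inv_poly.mult_closed C H c V W by blast
qed

section \<open>Remainders and denominators in \<open>Lambda d\<close>\<close>

lemma to_fract_power: "to_fract (p ^ n) = to_fract p ^ n"
  by (induction n) auto

lemma to_fract_prod: "to_fract (prod f A) = (\<Prod>x\<in>A. to_fract (f x))"
  by (induction A rule: infinite_finite_induct) auto

lemma to_fract_of_nat: "to_fract (of_nat n) = of_nat n"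
  by (induction n) auto

lemma to_fract_inverse_of_nat:
  assumes "0 < n"
  shows "to_fract [:inverse (of_nat n :: rat):] = inverse (of_nat n)"
proof -
  have "of_nat n * to_fract [:inverse (of_nat n :: rat):] = 1"
    using assms by (simp add: of_nat_poly flip: to_fract_of_nat to_fract_mult one_pCons)
  then show ?thesis by (metis inverse_unique)
qed

lemma to_fract_monom: "to_fract (monom 1 n) = qroot ^ n"
  by (simp add: qroot_def monom_altdef flip: to_fract_power)

lemma qroot_nonzero: "qroot \<noteq> 0"
  by (simp add: qroot_def)

lemma A_ring_subset_Lambda: "A_ring d \<subseteq> Lambda d"
  by (auto simp: Lambda_def intro: subring_gen.gen)

lemma qroot_in_Lambda: "qroot \<in> Lambda d" "inverse qroot \<in> Lambda d"
  using A_ring_subset_Lambda by (auto simp: A_ring_def intro: subring_gen.gen)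

lemma inverse_cyclotomic_in_Lambda:
  "0 < s \<Longrightarrow> \<not> coprime s d \<Longrightarrow> inverse (to_fract (cyclotomic s)) \<in> Lambda d"
  by (auto simp: Lambda_def coprime_nats_def intro!: subring_gen.gen)

lemma to_fract_polys_over_in_Lambda:
  assumes "0 < d" "r \<in> polys_over (rat_Z_inv d)"
  shows "to_fract r \<in> Lambda d"
proof -
  have "unital_subring {a. to_fract [:a:] \<in> Lambda d}"
  proof
    show "1 \<in> {a. to_fract [:a:] \<in> Lambda d}"
      using Lambda.one_closed[of d] by (simp flip: one_pCons)
    fix a b assume ab: "a \<in> {a. to_fract [:a:] \<in> Lambda d}" "b \<in> {a. to_fract [:a:] \<in> Lambda d}"
    have "to_fract [:a - b:] = to_fract [:a:] - to_fract [:b:]"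
      "to_fract [:a * b:] = to_fract [:a:] * to_fract [:b:]" by (simp_all flip: to_fract_diff to_fract_mult)
    then show "a - b \<in> {a. to_fract [:a:] \<in> Lambda d}" "a * b \<in> {a. to_fract [:a:] \<in> Lambda d}"
      using ab by (auto intro: Lambda.diff_closed Lambda.mult_closed)
  qed
  moreover have "to_fract [:inverse (of_nat d):] \<in> Lambda d"
    using to_fract_inverse_of_nat[OF assms(1)] A_ring_subset_Lambda by (auto simp: A_ring_def intro: subring_gen.gen)
  ultimately have const: "to_fract [:a:] \<in> Lambda d" if "a \<in> rat_Z_inv d" for a
    using subring_gen_subset[of "{a. to_fract [:a:] \<in> Lambda d}" "{inverse (of_nat d)}"] that
    unfolding rat_Z_inv_def by auto
  show ?thesis using assms(2)
  proof (induction r)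
    case 0
    then show ?case by (simp add: Lambda.zero_closed)
  next
    case (pCons a r)
    have ar: "a \<in> rat_Z_inv d" "r \<in> polys_over (rat_Z_inv d)"
      using pCons.prems by (auto simp: polys_over_def coeff_pCons split: nat.splits)
    have "to_fract (pCons a r) = to_fract ([:a:] + [:0, 1:] * r)" by simp
    also have "\<dots> = to_fract [:a:] + qroot * to_fract r"
      unfolding qroot_def to_fract_add to_fract_mult ..
    finally show ?case
      using pCons.IH[OF ar(2)] const[OF ar(1)] qroot_in_Lambda
      by (auto intro!: Lambda.add_closed Lambda.mult_closed)
  qed
qed

lemma Lambda_subsetI:
  assumes B: "unital_subring B" and "0 < d"
    and "inverse (of_nat d) \<in> B" "qroot \<in> B" "inverse qroot \<in> B"
    and "\<And>t. 0 < t \<Longrightarrow> \<not> coprime t d \<Longrightarrow> inverse (to_fract (cyclotomic t)) \<in> B"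
  shows "Lambda d \<subseteq> B"
proof -
  have "A_ring d \<subseteq> B" unfolding A_ring_def using assms by (intro subring_gen_subset) auto
  then show ?thesis unfolding Lambda_def coprime_nats_def using assms
    by (intro subring_gen_subset) auto
qed

lemma Lambda_decomp_one:
  assumes "0 < d" "0 < S" "coprime S d" "c \<in> Lambda d"
  shows "\<exists>r\<in>polys_over (rat_Z_inv d). \<exists>g\<in>Lambda d. c = to_fract r + (qroot ^ S - 1) * g"
proof -
  let ?y = "qroot ^ S - 1"
  let ?B = "{c. \<exists>r\<in>polys_over (rat_Z_inv d). \<exists>g\<in>Lambda d. c = to_fract r + ?y * g}"
  have y: "?y \<in> Lambda d"
    by (intro Lambda.diff_closed Lambda.power_closed qroot_in_Lambda Lambda.one_closed)
  have poly: "to_fract r \<in> ?B" if "r \<in> polys_over (rat_Z_inv d)" for r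
    using that Lambda.zero_closed by force
  have sub: "unital_subring ?B"
  proof
    show "1 \<in> ?B" using poly[OF rat_Z_inv_poly.one_closed] by simp
    fix a b assume "a \<in> ?B" "b \<in> ?B"
    then obtain r g r' g' where rg: "r \<in> polys_over (rat_Z_inv d)" "g \<in> Lambda d"
      "r' \<in> polys_over (rat_Z_inv d)" "g' \<in> Lambda d"
      and ab: "a = to_fract r + ?y * g" "b = to_fract r' + ?y * g'" by blast
    have "a - b = to_fract (r - r') + ?y * (g - g')" by (simp add: ab algebra_simps)
    then show "a - b \<in> ?B"
      using rg rat_Z_inv_poly.diff_closed Lambda.diff_closed by blast
    have 1: "a * b = to_fract (r * r') + ?y * (g * to_fract r' + to_fract r * g' + ?y * g * g')"
      by (simp add: ab algebra_simps)
    have "g * to_fract r' + to_fract r * g' + ?y * g * g' \<in> Lambda d"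
      using rg y assms(1)
      by (intro Lambda.add_closed Lambda.mult_closed to_fract_polys_over_in_Lambda)
    then show "a * b \<in> ?B" using 1 rg rat_Z_inv_poly.mult_closed by blast
  qed
  have "Lambda d \<subseteq> ?B"
  proof (rule Lambda_subsetI[OF sub assms(1)])
    have c: "[:inverse (of_nat d):] \<in> polys_over (rat_Z_inv d)"
      using inverse_in_rat_Z_inv[of d d] assms(1) rat_Z_inv_poly.zero_closed
      by (intro pCons_polys_over) auto
    show "inverse (of_nat d) \<in> ?B"
      using to_fract_inverse_of_nat[OF assms(1)] poly[OF c] by simp
    have mon: "monom 1 n \<in> polys_over (rat_Z_inv d)" for n
      by (intro monom_polys_over rat_Z_inv.unital_subring_axioms rat_Z_inv.one_closed)
    show "qroot \<in> ?B" using poly[OF mon[of 1]] unfolding to_fract_monom by simp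
    \<comment> \<open>Modulo \<open>x^S - 1\<close> the inverse of \<open>x\<close> is
      \<open>x^(S - 1)\<close>.\<close>
    have "inverse qroot = to_fract (monom 1 (S - 1)) + ?y * (- inverse qroot)"
      using assms(2) qroot_nonzero
      by (cases S) (simp_all add: to_fract_monom field_simps)
    then show "inverse qroot \<in> ?B"
      using mon Lambda.uminus_closed[OF qroot_in_Lambda(2)] by blast
  next
    fix t :: nat assume t: "0 < t" "\<not> coprime t d"
    from cyclotomic_unit_mod[OF assms(1) t assms(2,3)] obtain u w
      where u: "u \<in> polys_over (rat_Z_inv d)" and w: "w \<in> polys_over (rat_Z_inv d)"
        and uw: "cyclotomic t * u = 1 + (monom 1 S - 1) * w" by blast
    let ?i = "inverse (to_fract (cyclotomic t))"
    have "to_fract (cyclotomic t) * to_fract u = 1 + ?y * to_fract w"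
      unfolding to_fract_mult[symmetric] uw by (simp add: to_fract_monom)
    then have "?i * (to_fract (cyclotomic t) * to_fract u) = ?i * (1 + ?y * to_fract w)" by simp
    \<comment> \<open>Solving for the inverse leaves that inverse in the cofactor of
      \<open>?y\<close>, which is harmless because it lies in \<open>Lambda d\<close>.\<close>
    then have "?i = to_fract u + ?y * (- (?i * to_fract w))"
      using cyclotomic_nonzero[OF t(1)] by (simp add: algebra_simps)
    moreover have "- (?i * to_fract w) \<in> Lambda d"
      using w assms(1) t
      by (intro Lambda.uminus_closed Lambda.mult_closed inverse_cyclotomic_in_Lambda
          to_fract_polys_over_in_Lambda)
    ultimately show "?i \<in> ?B" using u by blast
  qed
  then show ?thesis using assms(4) by blast
qed

lemma lead_coeff_monom_minus_one:
  assumes "0 < n"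
  shows "degree (monom 1 n - 1 :: 'a::idom poly) = n" "lead_coeff (monom 1 n - 1 :: 'a poly) = 1"
proof -
  have "degree (monom 1 n + (- 1) :: 'a poly) = n"
    using assms by (subst degree_add_eq_left) (auto simp: degree_monom_eq)
  then show "degree (monom 1 n - 1 :: 'a poly) = n" by simp
  then show "lead_coeff (monom 1 n - 1 :: 'a poly) = 1" using assms by (simp add: coeff_1)
qed

text \<open>Iterating the one-step decomposition gives a polynomial modulo the \<open>k\<close>-th
  power; division by the monic \<open>(x^S - 1)^k\<close> then bounds its degree. This is the normal
  form that \<open>Lambda_small_multiple_zero\<close> shows to be unique.\<close>

lemma Lambda_decomp:
  assumes "0 < d" "0 < S" "coprime S d" "c \<in> Lambda d"
  shows "\<exists>r\<in>polys_over (rat_Z_inv d). \<exists>g\<in>Lambda d.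
    c = to_fract r + (qroot ^ S - 1) ^ k * g \<and> (r = 0 \<or> degree r < k * S)"
proof -
  let ?y = "qroot ^ S - 1"
  have "\<exists>r\<in>polys_over (rat_Z_inv d). \<exists>g\<in>Lambda d. c = to_fract r + ?y ^ k * g"
  proof (induction k)
    case 0
    show ?case using assms(4) rat_Z_inv_poly.zero_closed by force
  next
    case (Suc k)
    then obtain r g where rg: "r \<in> polys_over (rat_Z_inv d)" "g \<in> Lambda d"
      "c = to_fract r + ?y ^ k * g" by blast
    from Lambda_decomp_one[OF assms(1-3) rg(2)] obtain r' g' where
      rg': "r' \<in> polys_over (rat_Z_inv d)" "g' \<in> Lambda d" "g = to_fract r' + ?y * g'" by blast
    have "c = to_fract (r + (monom 1 S - 1) ^ k * r') + ?y ^ Suc k * g'"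
      by (simp add: rg(3) rg'(3) to_fract_monom to_fract_power algebra_simps)
    moreover have "r + (monom 1 S - 1) ^ k * r' \<in> polys_over (rat_Z_inv d)"
      by (intro rat_Z_inv_poly.add_closed rat_Z_inv_poly.mult_closed rg rg'
          rat_Z_inv_poly.power_closed monom_minus_one_polys_over rat_Z_inv.unital_subring_axioms)
    ultimately show ?case using rg'(2) by blast
  qed
  then obtain r g where rg: "r \<in> polys_over (rat_Z_inv d)" "g \<in> Lambda d"
    "c = to_fract r + ?y ^ k * g" by blast
  let ?M = "(monom 1 S - 1 :: rat poly) ^ k"
  have M: "?M \<in> polys_over (rat_Z_inv d)"
    by (intro rat_Z_inv_poly.power_closed monom_minus_one_polys_over rat_Z_inv.unital_subring_axioms)
  have lM: "lead_coeff ?M = 1"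
    using lead_coeff_monom_minus_one[OF assms(2), where ?'a = rat] by (simp add: lead_coeff_power)
  have dM: "degree ?M = k * S"
    using lead_coeff_monom_minus_one[OF assms(2), where ?'a = rat]
    by (subst degree_power_eq) auto
  from monic_division[OF rat_Z_inv.unital_subring_axioms M lM rg(1)] obtain q s where
    qs: "q \<in> polys_over (rat_Z_inv d)" "s \<in> polys_over (rat_Z_inv d)" "r = ?M * q + s"
      "s = 0 \<or> degree s < degree ?M" by blast
  have "c = to_fract s + ?y ^ k * (to_fract q + g)"
    by (simp add: rg(3) qs(3) to_fract_power to_fract_monom algebra_simps)
  moreover have "to_fract q + g \<in> Lambda d"
    by (intro Lambda.add_closed to_fract_polys_over_in_Lambda assms qs rg)
  ultimately show ?thesis using qs dM by auto
qed

text \<open>A denominator invertible modulo \<open>x^S - 1\<close> has no zero at an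
  \<open>S\<close>-th root of unity and no factor in common with \<open>x^S - 1\<close>. The first
  gives regularity there, the second the uniqueness of remainders.\<close>

lemma Lambda_denominator:
  assumes "0 < d" "0 < S" "coprime S d" "c \<in> Lambda d"
  shows "\<exists>D a u w. c * to_fract D = to_fract a \<and> D * u = 1 + (monom 1 S - 1) * w"
proof -
  let ?Y = "monom 1 S - 1 :: rat poly"
  let ?B = "{c. \<exists>D a u w. c * to_fract D = to_fract a \<and> D * u = 1 + ?Y * w}"
  have poly: "to_fract r \<in> ?B" for r
  proof -
    have "to_fract r * to_fract 1 = to_fract r" "1 * 1 = 1 + ?Y * 0" by simp_all
    then show ?thesis by blast
  qed
  have sub: "unital_subring ?B"
  proof
    show "1 \<in> ?B" using poly[of 1] by simp
    fix a b assume "a \<in> ?B" "b \<in> ?B"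
    then obtain D n u w D' n' u' w' where
      D: "a * to_fract D = to_fract n" "D * u = 1 + ?Y * w" and
      D': "b * to_fract D' = to_fract n'" "D' * u' = 1 + ?Y * w'" by blast
    have "D * D' * (u * u') = (D * u) * (D' * u')" by (simp add: algebra_simps)
    also have "\<dots> = 1 + ?Y * (w + w' + ?Y * w * w')" by (simp add: D D' algebra_simps)
    finally have DD: "D * D' * (u * u') = 1 + ?Y * (w + w' + ?Y * w * w')" .
    have "(a - b) * to_fract (D * D') = (a * to_fract D) * to_fract D' - (b * to_fract D') * to_fract D"
      by (simp add: algebra_simps)
    also have "\<dots> = to_fract (n * D' - n' * D)" by (simp add: D(1) D'(1))
    finally show "a - b \<in> ?B" using DD by blast
    have "(a * b) * to_fract (D * D') = (a * to_fract D) * (b * to_fract D')"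
      by (simp add: algebra_simps)
    also have "\<dots> = to_fract (n * n')" by (simp add: D(1) D'(1))
    finally show "a * b \<in> ?B" using DD by blast
  qed
  have "Lambda d \<subseteq> ?B"
  proof (rule Lambda_subsetI[OF sub assms(1)])
    show "inverse (of_nat d) \<in> ?B"
      using to_fract_inverse_of_nat[OF assms(1)] poly[of "[:inverse (of_nat d):]"] by simp
    show "qroot \<in> ?B" unfolding qroot_def by (rule poly)
    have "inverse qroot * to_fract (monom 1 1) = to_fract 1"
      using qroot_nonzero by (simp add: to_fract_monom)
    moreover have "monom 1 1 * monom 1 (S - 1) = 1 + ?Y * 1"
      using assms(2) by (simp add: mult_monom)
    ultimately show "inverse qroot \<in> ?B" by blast
  next
    fix t :: nat assume t: "0 < t" "\<not> coprime t d"
    have "inverse (to_fract (cyclotomic t)) * to_fract (cyclotomic t) = to_fract 1"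
      using cyclotomic_nonzero[OF t(1)] by simp
    then show "inverse (to_fract (cyclotomic t)) \<in> ?B"
      using cyclotomic_unit_mod[OF assms(1) t assms(2,3)] by blast
  qed
  then show ?thesis using assms(4) by blast
qed

lemma Lambda_small_multiple_zero:
  assumes "0 < d" "0 < S" "coprime S d" "g \<in> Lambda d"
    and r: "to_fract r = (qroot ^ S - 1) ^ k * g" "r = 0 \<or> degree r < k * S"
  shows "r = 0"
proof (rule ccontr)
  assume "r \<noteq> 0"
  let ?Y = "monom 1 S - 1 :: rat poly"
  obtain D a u w where D: "g * to_fract D = to_fract a" "D * u = 1 + ?Y * w"
    using Lambda_denominator[OF assms(1-4)] by blast
  have "to_fract (r * D) = to_fract (?Y ^ k * a)"
    by (simp add: r(1) to_fract_power to_fract_monom mult.assoc flip: D(1))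
  then have "?Y ^ k dvd r * D" by (simp only: to_fract_eq_iff) simp
  \<comment> \<open>Since \<open>D * u = 1 + ?Y * w\<close>, multiplying by this finite geometric
    series as well inverts \<open>D\<close> modulo \<open>?Y^k\<close>, so \<open>?Y^k\<close> must
    divide \<open>r\<close> itself.\<close>
  then have dvd: "?Y ^ k dvd r * D * u * (\<Sum>i<k. (- (?Y * w)) ^ i)"
    by (rule dvd_mult2[OF dvd_mult2])
  have "r * D * u * (\<Sum>i<k. (- (?Y * w)) ^ i) = r * ((1 - (- (?Y * w))) * (\<Sum>i<k. (- (?Y * w)) ^ i))"
    using D(2) by (simp add: mult.assoc[of r D u])
  also have "\<dots> = r - ?Y ^ k * (r * (- w) ^ k)"
    unfolding one_diff_power_eq[symmetric] by (simp add: algebra_simps flip: power_mult_distrib)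
  finally have "?Y ^ k dvd r" using dvd by (metis dvd_add_right_iff dvd_triv_left diff_add_cancel)
  then have "degree (?Y ^ k) \<le> degree r" using \<open>r \<noteq> 0\<close> by (rule dvd_imp_degree_le)
  then show False
    using r(2) \<open>r \<noteq> 0\<close> lead_coeff_monom_minus_one[OF assms(2), where ?'a = rat]
    by (subst (asm) degree_power_eq) (auto simp: mult.commute)
qed

section \<open>Evaluation and Taylor expansion\<close>

definition poly_at :: "complex \<Rightarrow> rat poly \<Rightarrow> complex" where
  "poly_at z p = poly (map_poly of_rat p) z"

lemma map_poly_of_rat_pCons:
  "map_poly (of_rat :: rat \<Rightarrow> 'a::field_char_0) (pCons a p) = pCons (of_rat a) (map_poly of_rat p)"
  by (simp add: poly_eq_iff coeff_map_poly coeff_pCons split: nat.split)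

lemma poly_at_simps [simp]:
  "poly_at z (p - q) = poly_at z p - poly_at z q"
  "poly_at z (p * q) = poly_at z p * poly_at z q"
  "poly_at z 0 = 0"
  "poly_at z 1 = 1"
  "poly_at z [:a:] = of_rat a"
  "poly_at z (pCons a p) = of_rat a + z * poly_at z p"
  "poly_at z (monom 1 n) = z ^ n"
  by (simp_all add: poly_at_def map_poly_of_rat_diff map_poly_of_rat_mult map_poly_monom
      poly_monom map_poly_of_rat_pCons)

lemma poly_at_add [simp]: "poly_at z (p + q) = poly_at z p + poly_at z q"
  using poly_at_simps(1)[of z "p + q" q] by simp

text \<open>The equation \<open>f = a / b\<close> is cross-multiplied, so that closure under
  difference and product reduces to ring identities.\<close>

definition regular_at :: "complex \<Rightarrow> rat poly fract set" where
  "regular_at z = {f. \<exists>a b. f * to_fract b = to_fract a \<and> poly_at z b \<noteq> 0}"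

lemma regular_atE:
  assumes "f \<in> regular_at z"
  obtains a b where "f * to_fract b = to_fract a" "poly_at z b \<noteq> 0"
  using assms by (auto simp: regular_at_def)

text \<open>The description in \<open>eval_ratfun\<close> is well defined: two fractions for
  \<open>f\<close> agree after cross-multiplication, and so do their values.\<close>

lemma eval_ratfun_eq:
  assumes f: "f * to_fract b = to_fract a" and b: "poly_at z b \<noteq> 0"
  shows "eval_ratfun f z = poly_at z a / poly_at z b"
  unfolding eval_ratfun_def
proof (rule the_equality)
  have "b \<noteq> 0" using b by auto
  then have fr: "f = Fract a b" using f by (simp add: Fract_conv_to_fract field_simps)
  then show "\<exists>a' b'. f = Fract a' b' \<and> poly (map_poly of_rat b') z \<noteq> 0 \<and>
      poly_at z a / poly_at z b = poly (map_poly of_rat a') z / poly (map_poly of_rat b') z"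
    using b unfolding poly_at_def by blast
  fix y assume "\<exists>a' b'. f = Fract a' b' \<and> poly (map_poly of_rat b') z \<noteq> 0 \<and>
      y = poly (map_poly of_rat a') z / poly (map_poly of_rat b') z"
  then obtain a' b' where a': "f = Fract a' b'" "poly_at z b' \<noteq> 0" "y = poly_at z a' / poly_at z b'"
    unfolding poly_at_def by blast
  then have "b' \<noteq> 0" by auto
  then have "a * b' = a' * b" using a' fr \<open>b \<noteq> 0\<close> by (simp add: eq_fract)
  then have "poly_at z a * poly_at z b' = poly_at z a' * poly_at z b"
    by (simp flip: poly_at_simps(2))
  then show "y = poly_at z a / poly_at z b" using a'(2,3) b by (simp add: frac_eq_eq)
qed

lemma eval_ratfun_to_fract: "eval_ratfun (to_fract p) z = poly_at z p"
  using eval_ratfun_eq[of "to_fract p" 1 p z] by simp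

lemma to_fract_regular_at: "to_fract p \<in> regular_at z"
  unfolding regular_at_def by (intro CollectI exI[of _ p] exI[of _ 1]) simp

lemma
  assumes "f \<in> regular_at z" "g \<in> regular_at z"
  shows regular_at_diff: "f - g \<in> regular_at z"
    and eval_ratfun_diff: "eval_ratfun (f - g) z = eval_ratfun f z - eval_ratfun g z"
    and regular_at_mult: "f * g \<in> regular_at z"
    and eval_ratfun_mult: "eval_ratfun (f * g) z = eval_ratfun f z * eval_ratfun g z"
proof -
  from assms obtain a b a' b' where
    f: "f * to_fract b = to_fract a" "poly_at z b \<noteq> 0" and
    g: "g * to_fract b' = to_fract a'" "poly_at z b' \<noteq> 0" by (elim regular_atE)
  have "(f - g) * to_fract (b * b') = (f * to_fract b) * to_fract b' - (g * to_fract b') * to_fract b"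
    by (simp add: algebra_simps)
  also have "\<dots> = to_fract (a * b' - a' * b)" by (simp add: f g)
  finally have d: "(f - g) * to_fract (b * b') = to_fract (a * b' - a' * b)" .
  have "(f * g) * to_fract (b * b') = (f * to_fract b) * (g * to_fract b')" by (simp add: algebra_simps)
  also have "\<dots> = to_fract (a * a')" by (simp add: f g)
  finally have m: "(f * g) * to_fract (b * b') = to_fract (a * a')" .
  have nz: "poly_at z (b * b') \<noteq> 0" using f g by simp
  show "f - g \<in> regular_at z" "f * g \<in> regular_at z"
    using d m nz unfolding regular_at_def by blast+
  show "eval_ratfun (f - g) z = eval_ratfun f z - eval_ratfun g z"
    "eval_ratfun (f * g) z = eval_ratfun f z * eval_ratfun g z"
    using f(2) g(2) unfolding eval_ratfun_eq[OF d nz] eval_ratfun_eq[OF m nz]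
      eval_ratfun_eq[OF f] eval_ratfun_eq[OF g] by (simp_all add: field_simps)
qed

lemma Lambda_regular_at:
  assumes "0 < d" "0 < S" "coprime S d" "z ^ S = 1" "c \<in> Lambda d"
  shows "c \<in> regular_at z"
proof -
  obtain D a u w where D: "c * to_fract D = to_fract a" "D * u = 1 + (monom 1 S - 1) * w"
    using Lambda_denominator[OF assms(1-3,5)] by blast
  have "poly_at z D * poly_at z u = 1"
    unfolding poly_at_simps(2)[symmetric] D(2) by (simp add: assms(4))
  then show ?thesis using D(1) unfolding regular_at_def by force
qed

lemma Lambda_regular_at_1: "0 < d \<Longrightarrow> c \<in> Lambda d \<Longrightarrow> c \<in> regular_at 1"
  using Lambda_regular_at[of d 1] by simp

lemma eventually_regular_at:
  assumes "f \<in> regular_at z"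
  shows "\<forall>\<^sub>F w in nhds z. f \<in> regular_at w"
    and "eval_ratfun f analytic_on {z}"
proof -
  from assms obtain a b where f: "f * to_fract b = to_fract a" "poly_at z b \<noteq> 0"
    by (elim regular_atE)
  have "continuous_on UNIV (\<lambda>w. poly_at w b)" unfolding poly_at_def by (intro continuous_intros)
  then have "open {w. poly_at w b \<noteq> 0}" by (intro open_Collect_neq continuous_intros)
  then have ev: "\<forall>\<^sub>F w in nhds z. poly_at w b \<noteq> 0"
    using f(2) eventually_nhds_in_open by fastforce
  then show "\<forall>\<^sub>F w in nhds z. f \<in> regular_at w"
    by eventually_elim (use f(1) in \<open>auto simp: regular_at_def\<close>)
  have "(\<lambda>w. poly_at w a / poly_at w b) analytic_on {z}"
    unfolding poly_at_def using f(2)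
    by (intro analytic_on_divide holomorphic_on_imp_analytic_at[of _ UNIV] holomorphic_intros)
      (auto simp: poly_at_def)
  moreover have "\<forall>\<^sub>F w in nhds z. eval_ratfun f w = poly_at w a / poly_at w b"
    using ev by eventually_elim (use eval_ratfun_eq[OF f(1)] in auto)
  ultimately show "eval_ratfun f analytic_on {z}" by (simp only: analytic_at_cong[OF _ refl])
qed

lemma fps_expansion_eval_ratfun:
  "f \<in> regular_at z \<Longrightarrow> (\<lambda>x. eval_ratfun f (z + x)) has_fps_expansion fps_expansion (eval_ratfun f) z"
  by (intro analytic_at_imp_has_fps_expansion eventually_regular_at)

lemma eventually_regular_at_shift:
  assumes "f \<in> regular_at z"
  shows "\<forall>\<^sub>F x in nhds 0. f \<in> regular_at (z + x)"
  using eventually_regular_at(1)[OF assms] by (simp add: nhds_to_0' eventually_filtermap)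

lemma
  assumes "f \<in> regular_at z" "g \<in> regular_at z"
  shows fps_expansion_eval_ratfun_diff: "fps_expansion (eval_ratfun (f - g)) z =
      fps_expansion (eval_ratfun f) z - fps_expansion (eval_ratfun g) z"
    and fps_expansion_eval_ratfun_mult: "fps_expansion (eval_ratfun (f * g)) z =
      fps_expansion (eval_ratfun f) z * fps_expansion (eval_ratfun g) z"
proof -
  note F = fps_expansion_eval_ratfun[OF assms(1)] fps_expansion_eval_ratfun[OF assms(2)]
  have ev: "\<forall>\<^sub>F x in nhds 0. f \<in> regular_at (z + x) \<and> g \<in> regular_at (z + x)"
    using assms by (intro eventually_conj eventually_regular_at_shift)
  have d: "\<forall>\<^sub>F x in nhds 0. eval_ratfun f (z + x) - eval_ratfun g (z + x) = eval_ratfun (f - g) (z + x)"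
    using ev by eventually_elim (simp add: eval_ratfun_diff)
  have m: "\<forall>\<^sub>F x in nhds 0. eval_ratfun f (z + x) * eval_ratfun g (z + x) = eval_ratfun (f * g) (z + x)"
    using ev by eventually_elim (simp add: eval_ratfun_mult)
  show "fps_expansion (eval_ratfun (f - g)) z =
      fps_expansion (eval_ratfun f) z - fps_expansion (eval_ratfun g) z"
    using fps_expansion_eval_ratfun[OF regular_at_diff[OF assms]]
      has_fps_expansion_diff[OF F] has_fps_expansion_cong[OF d refl] fps_expansion_unique_complex
    by blast
  show "fps_expansion (eval_ratfun (f * g)) z =
      fps_expansion (eval_ratfun f) z * fps_expansion (eval_ratfun g) z"
    using fps_expansion_eval_ratfun[OF regular_at_mult[OF assms]]
      has_fps_expansion_mult[OF F] has_fps_expansion_cong[OF m refl] fps_expansion_unique_complex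
    by blast
qed

lemma fps_expansion_eval_ratfun_const:
  "fps_expansion (eval_ratfun (to_fract [:a:])) z = fps_const (of_rat a)"
  using fps_expansion_eval_ratfun[OF to_fract_regular_at, of "[:a:]" z]
  by (auto simp: eval_ratfun_to_fract intro: fps_expansion_unique_complex)

lemma fps_expansion_eval_ratfun_qroot:
  "fps_expansion (eval_ratfun qroot) z = fps_const z + fps_X"
proof (rule fps_expansion_unique_complex)
  show "(\<lambda>x. eval_ratfun qroot (z + x)) has_fps_expansion fps_expansion (eval_ratfun qroot) z"
    unfolding qroot_def by (intro fps_expansion_eval_ratfun to_fract_regular_at)
  show "(\<lambda>x. eval_ratfun qroot (z + x)) has_fps_expansion fps_const z + fps_X"
    unfolding qroot_def eval_ratfun_to_fract by (auto intro!: fps_expansion_intros)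
qed

lemma
  assumes "f \<in> regular_at 1" "g \<in> regular_at 1"
  shows taylor1_diff: "taylor1 d (f - g) = taylor1 d f - taylor1 d g"
    and taylor1_mult: "taylor1 d (f * g) = taylor1 d f * taylor1 d g"
  unfolding taylor1_def
    fps_expansion_eval_ratfun_diff[OF assms] fps_expansion_eval_ratfun_mult[OF assms]
  by (auto simp: fps_compose_sub_distrib intro!: fps_compose_mult_distrib)

lemma taylor1_const: "taylor1 d (to_fract [:a:]) = fps_const (of_rat a)"
  by (simp add: taylor1_def fps_expansion_eval_ratfun_const)

lemma taylor1_one: "taylor1 d 1 = 1"
  using taylor1_const[of d 1] by (simp flip: one_pCons)

lemma taylor1_qroot: "taylor1 d qroot = fps_binomial (1 / of_nat d)"
  by (simp add: taylor1_def fps_expansion_eval_ratfun_qroot fps_compose_add_distrib)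

lemma taylor1_nth_0: "taylor1 d f $ 0 = eval_ratfun f 1"
  by (simp add: taylor1_def fps_expansion_def)

lemma taylor1_add:
  assumes "f \<in> regular_at 1" "g \<in> regular_at 1"
  shows "taylor1 d (f + g) = taylor1 d f + taylor1 d g"
proof -
  have "0 \<in> regular_at 1" "taylor1 d 0 = 0"
    using to_fract_regular_at[of 0 1] taylor1_const[of d 0] by simp_all
  then show ?thesis
    using taylor1_diff[of f "0 - g" d] taylor1_diff[of 0 g d] regular_at_diff[of 0 1 g] assms by simp
qed

lemma regular_at_power: "f \<in> regular_at z \<Longrightarrow> f ^ n \<in> regular_at z"
  using to_fract_regular_at[of 1] by (induction n) (auto intro: regular_at_mult)

lemma taylor1_power: "f \<in> regular_at 1 \<Longrightarrow> taylor1 d (f ^ n) = taylor1 d f ^ n"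
  by (induction n) (auto simp: taylor1_one taylor1_mult regular_at_power)

lemma qroot_regular_at: "qroot \<in> regular_at z"
  unfolding qroot_def by (rule to_fract_regular_at)

lemma one_regular_at: "1 \<in> regular_at z"
  using to_fract_regular_at[of 1] by simp

section \<open>Coefficients of Taylor expansions\<close>

definition fps_over :: "'a::comm_ring_1 set \<Rightarrow> 'a fps set" where
  "fps_over R = {F. \<forall>n. fps_nth F n \<in> R}"

lemma unital_subring_fps_over:
  assumes "unital_subring R"
  shows "unital_subring (fps_over R)"
proof -
  interpret unital_subring R by fact
  show ?thesis
    by unfold_locales
      (auto simp: fps_over_def fps_mult_nth intro!: one_closed zero_closed diff_closed
        sum_closed mult_closed)
qed

lemma fps_nth_mult_eq_0:
  fixes F G :: "'a::comm_ring_1 fps"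
  assumes "\<And>i. i < n \<Longrightarrow> fps_nth F i = 0" "\<And>i. i < m \<Longrightarrow> fps_nth G i = 0" "j < n + m"
  shows "fps_nth (F * G) j = 0"
  unfolding fps_mult_nth
proof (rule sum.neutral, intro ballI)
  fix i assume "i \<in> {0..j}"
  then have "i < n \<or> j - i < m" using assms(3) by auto
  then show "fps_nth F i * fps_nth G (j - i) = 0" using assms by auto
qed

lemma fps_nth_power_mult_eq_0:
  fixes F G :: "'a::comm_ring_1 fps"
  assumes "fps_nth F 0 = 0" "j < n"
  shows "fps_nth (F ^ n * G) j = 0"
proof -
  have "\<And>i. i < n \<Longrightarrow> fps_nth (F ^ n) i = 0"
  proof (induction n)
    case (Suc n)
    show ?case unfolding power_Suc2
      by (rule fps_nth_mult_eq_0[of n _ 1]) (use Suc assms(1) in auto)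
  qed simp
  then show ?thesis using fps_nth_mult_eq_0[of n _ 0 G j] assms(2) by auto
qed

text \<open>For \<open>n > 0\<close> the coefficient of index \<open>n\<close> of \<open>F^d\<close>
  is \<open>d\<close> times that of \<open>F\<close> plus an expression in earlier coefficients, and
  \<open>d\<close> is invertible. The earlier part is isolated as the \<open>d\<close>-th power of
  the truncation \<open>C\<close>.\<close>

lemma fps_over_root:
  fixes F :: "'a::field fps"
  assumes R: "unital_subring R" and d: "0 < d" "inverse (of_nat d) \<in> R" "(of_nat d :: 'a) \<noteq> 0"
    and F: "F ^ d \<in> fps_over R" "fps_nth F 0 = 1"
  shows "F \<in> fps_over R"
proof -
  interpret unital_subring R by fact
  interpret F: unital_subring "fps_over R" by (rule unital_subring_fps_over[OF R])
  have "fps_nth F n \<in> R" for n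
  proof (induction n rule: less_induct)
    case (less n)
    show ?case
    proof (cases "n = 0")
      case True
      then show ?thesis using F(2) one_closed by simp
    next
      case False
      define C where "C = fps_cutoff n F"
      have "C \<in> fps_over R" unfolding C_def fps_over_def using less zero_closed by auto
      then have Cd: "fps_nth (C ^ d) n \<in> R" using F.power_closed[of C d] by (auto simp: fps_over_def)
      let ?Q = "\<Sum>i<d. C ^ (d - Suc i) * F ^ i"
      have "F ^ d - C ^ d = (F - C) * ?Q" by (rule power_diff_sumr2)
      also have "F - C = fps_X ^ n * fps_shift n F"
        unfolding C_def using fps_shift_cutoff'[of n F] by (simp add: algebra_simps)
      finally have "fps_nth (F ^ d - C ^ d) n = fps_nth (fps_X ^ n * (fps_shift n F * ?Q)) n"
        by (simp only: mult.assoc)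
      also have "\<dots> = fps_nth F n * fps_nth ?Q 0" by (simp add: fps_X_power_mult_nth)
      \<comment> \<open>Both series have constant term 1 (for \<open>C\<close> this uses
        \<open>n > 0\<close>), so each of the \<open>d\<close> summands contributes 1.\<close>
      also have "fps_nth ?Q 0 = of_nat d"
        using F(2) False by (simp add: fps_sum_nth C_def fps_nth_power_0)
      finally have "fps_nth F n = (fps_nth (F ^ d) n - fps_nth (C ^ d) n) * inverse (of_nat d)"
        using d(3) by simp
      then show ?thesis
        using Cd F(1) d(2) by (auto simp: fps_over_def intro!: mult_closed diff_closed)
    qed
  qed
  then show ?thesis by (simp add: fps_over_def)
qed

interpretation Z_inv: unital_subring "Z_inv d" for d
  unfolding Z_inv_def by (rule unital_subring_gen)

interpretation Z_inv_fps: unital_subring "fps_over (Z_inv d)" for d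
  by (rule unital_subring_fps_over[OF Z_inv.unital_subring_axioms])

lemma inverse_in_Z_inv: "inverse (of_nat d) \<in> Z_inv d"
  by (auto simp: Z_inv_def intro: subring_gen.gen)

lemma of_rat_in_Z_inv:
  assumes "a \<in> rat_Z_inv d"
  shows "of_rat a \<in> Z_inv d"
proof -
  have "unital_subring {a. of_rat a \<in> Z_inv d}"
    by unfold_locales (auto simp: of_rat_diff of_rat_mult
        intro: Z_inv.one_closed Z_inv.diff_closed Z_inv.mult_closed)
  moreover have "of_rat (inverse (of_nat d)) \<in> Z_inv d"
    using inverse_in_Z_inv by (simp add: of_rat_inverse)
  ultimately show ?thesis
    using subring_gen_subset[of "{a. of_rat a \<in> Z_inv d}" "{inverse (of_nat d)}"] assms
    by (auto simp: rat_Z_inv_def)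
qed

lemma Z_inv_subset_Rats: "Z_inv d \<subseteq> \<rat>"
  unfolding Z_inv_def by (rule subring_gen_subset) (unfold_locales, auto)

lemma fps_binomial_power_eq:
  "0 < d \<Longrightarrow> fps_binomial (a / of_nat d :: complex) ^ d = fps_binomial a"
  by (simp add: fps_binomial_power)

lemma fps_binomial_nth_0: "fps_nth (fps_binomial a) 0 = 1"
  by simp

text \<open>Obtained as the \<open>d\<close>-th root of \<open>1 + X\<close> rather than from the
  formula for the binomial coefficients.\<close>

lemma fps_binomial_inverse_over_Z_inv:
  assumes "0 < d"
  shows "fps_binomial (1 / of_nat d) \<in> fps_over (Z_inv d)"
proof (rule fps_over_root[OF Z_inv.unital_subring_axioms assms inverse_in_Z_inv])
  have "fps_binomial (1 / of_nat d) ^ d = (1 + fps_X :: complex fps)"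
    using assms by (simp add: fps_binomial_power_eq fps_binomial_1)
  then show "fps_binomial (1 / of_nat d) ^ d \<in> fps_over (Z_inv d)"
    using Z_inv.zero_closed Z_inv.one_closed by (auto simp: fps_over_def fps_X_def)
qed (use assms in auto)

lemma taylor1_to_fract_over_Z_inv:
  assumes "0 < d" "r \<in> polys_over (rat_Z_inv d)"
  shows "taylor1 d (to_fract r) \<in> fps_over (Z_inv d)"
  using assms(2)
proof (induction r)
  case 0
  then show ?case using taylor1_const[of d 0] Z_inv_fps.zero_closed by simp
next
  case (pCons a r)
  have ar: "a \<in> rat_Z_inv d" "r \<in> polys_over (rat_Z_inv d)"
    using pCons.prems by (auto simp: polys_over_def coeff_pCons split: nat.splits)
  have "to_fract (pCons a r) = to_fract ([:a:] + [:0, 1:] * r)" by simp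
  also have "\<dots> = to_fract [:a:] + qroot * to_fract r"
    unfolding qroot_def to_fract_add to_fract_mult ..
  finally have "taylor1 d (to_fract (pCons a r)) =
      fps_const (of_rat a) + fps_binomial (1 / of_nat d) * taylor1 d (to_fract r)"
    by (simp only: taylor1_add taylor1_mult regular_at_mult to_fract_regular_at qroot_regular_at
        taylor1_const taylor1_qroot)
  moreover have "fps_const (of_rat a) \<in> fps_over (Z_inv d)"
    using of_rat_in_Z_inv[OF ar(1)] Z_inv.zero_closed by (auto simp: fps_over_def)
  ultimately show ?case
    using pCons.IH[OF ar(2)] fps_binomial_inverse_over_Z_inv[OF assms(1)]
    by (auto intro!: Z_inv_fps.add_closed Z_inv_fps.mult_closed)
qed

lemma qroot_minus_one_regular_at: "qroot ^ n - 1 \<in> regular_at z"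
  by (intro regular_at_diff regular_at_power qroot_regular_at one_regular_at)

lemma taylor1_decomp:
  assumes "0 < d" "g \<in> Lambda d" "f \<in> regular_at 1" "n < k"
  shows "fps_nth (taylor1 d (f + (qroot - 1) ^ k * g)) n = fps_nth (taylor1 d f) n"
proof -
  have reg: "qroot - 1 \<in> regular_at 1" "(qroot - 1) ^ k \<in> regular_at 1" "g \<in> regular_at 1"
    using qroot_minus_one_regular_at[of 1 1] Lambda_regular_at_1[OF assms(1,2)]
    by (auto intro: regular_at_power)
  have "taylor1 d (qroot - 1) = fps_binomial (1 / of_nat d) - 1"
    by (simp only: taylor1_diff qroot_regular_at one_regular_at taylor1_qroot taylor1_one)
  then have "fps_nth (taylor1 d ((qroot - 1) ^ k * g)) n = 0"
    using reg assms(4) by (simp add: taylor1_mult taylor1_power fps_nth_power_mult_eq_0)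
  then show ?thesis
    using assms(3) reg by (simp add: taylor1_add regular_at_mult)
qed

lemma taylor1_over_Z_inv:
  assumes "0 < d" "c \<in> Lambda d"
  shows "fps_nth (taylor1 d c) n \<in> Z_inv d"
proof -
  \<comment> \<open>Exponent \<open>Suc n\<close> keeps the non-polynomial part away from the
    coefficient of index \<open>n\<close>.\<close>
  obtain r g where rg: "r \<in> polys_over (rat_Z_inv d)" "g \<in> Lambda d"
    "c = to_fract r + (qroot ^ 1 - 1) ^ Suc n * g"
    using Lambda_decomp[of d 1 c "Suc n"] assms by auto
  then have "fps_nth (taylor1 d c) n = fps_nth (taylor1 d (to_fract r)) n"
    using taylor1_decomp[OF assms(1) rg(2) to_fract_regular_at, of n "Suc n"] by simp
  then show ?thesis
    using taylor1_to_fract_over_Z_inv[OF assms(1) rg(1)] by (simp add: fps_over_def)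
qed

text \<open>If \<open>r\<close> is nonzero, the coefficient whose index is the order of vanishing of \<open>r\<close> at 1 is nonzero.\<close>

lemma taylor1_small_degree_zero:
  assumes "0 < d" "r = 0 \<or> degree r < n" "\<And>j. j < n \<Longrightarrow> fps_nth (taylor1 d (to_fract r)) j = 0"
  shows "r = 0"
proof (rule ccontr)
  assume "r \<noteq> 0"
  let ?j = "order 1 r"
  obtain s where s: "r = [:- 1, 1:] ^ ?j * s" "\<not> [:- 1, 1:] dvd s"
    using order_decomp[OF \<open>r \<noteq> 0\<close>] by metis
  have "poly s 1 \<noteq> 0" using s(2) by (simp add: poly_eq_0_iff_dvd)
  moreover have "poly_at 1 s = of_rat (poly s 1)"
    using of_rat_hom.poly_map_poly[of s 1] by (simp add: poly_at_def)
  ultimately have s1: "poly_at 1 s \<noteq> 0" by simp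
  have jn: "?j < n" using order_degree[OF \<open>r \<noteq> 0\<close>, of 1] assms(2) \<open>r \<noteq> 0\<close> by auto
  let ?b = "fps_binomial (1 / of_nat d) - 1 :: complex fps"
  have lin: "to_fract [:- 1, 1 :: rat:] = qroot - 1"
    unfolding qroot_def by (simp flip: to_fract_1 to_fract_diff add: one_pCons)
  have b: "taylor1 d (qroot - 1) = ?b"
    by (simp only: taylor1_diff qroot_regular_at one_regular_at taylor1_qroot taylor1_one)
  \<comment> \<open>The inner series starts with \<open>X / d\<close>; extracting \<open>X\<close>
    separates the order of vanishing from a factor with nonzero constant term.\<close>
  have bX: "?b = fps_X * fps_shift 1 ?b"
    using fps_shift_cutoff'[of 1 ?b] by (simp add: fps_eq_iff)
  have reg: "qroot - 1 \<in> regular_at 1" using qroot_minus_one_regular_at[of 1 1] by simp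
  have "taylor1 d (to_fract r) = ?b ^ ?j * taylor1 d (to_fract s)"
    by (subst s(1)) (simp only: to_fract_mult to_fract_power lin taylor1_mult taylor1_power
        regular_at_power reg to_fract_regular_at b)
  also have "\<dots> = fps_X ^ ?j * (fps_shift 1 ?b ^ ?j * taylor1 d (to_fract s))"
    by (subst bX) (simp only: power_mult_distrib mult.assoc)
  finally have "fps_nth (taylor1 d (to_fract r)) ?j =
      fps_nth (fps_shift 1 ?b) 0 ^ ?j * poly_at 1 s"
    by (simp add: fps_X_power_mult_nth fps_nth_power_0 taylor1_nth_0 eval_ratfun_to_fract)
  also have "\<dots> = (1 / of_nat d) ^ ?j * poly_at 1 s" by (simp add: gbinomial_1)
  finally show False using assms(3)[OF jn] s1 assms(1) by simp
qed

section \<open>The completion\<close>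

lemma qpoch_Suc: "qpoch d (Suc n) = qpoch d n * (1 - (qroot ^ d) ^ Suc n)"
  by (simp add: qpoch_def)

lemma one_minus_qroot_power_in_Lambda: "1 - (qroot ^ d) ^ n \<in> Lambda d"
  by (intro Lambda.diff_closed Lambda.power_closed qroot_in_Lambda Lambda.one_closed)

lemma qpoch_in_Lambda: "qpoch d n \<in> Lambda d"
  unfolding qpoch_def by (intro Lambda.prod_closed one_minus_qroot_power_in_Lambda)

definition Lambda_ideal :: "nat \<Rightarrow> rat poly fract \<Rightarrow> rat poly fract set" where
  "Lambda_ideal d y = (\<lambda>g. y * g) ` Lambda d"

lemma Lambda_idealI: "g \<in> Lambda d \<Longrightarrow> y * g \<in> Lambda_ideal d y"
  by (auto simp: Lambda_ideal_def)

lemma Lambda_ideal_self: "y \<in> Lambda_ideal d y"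
  using Lambda_idealI[OF Lambda.one_closed, of y] by simp

lemma Lambda_ideal_diff:
  "a \<in> Lambda_ideal d y \<Longrightarrow> b \<in> Lambda_ideal d y \<Longrightarrow> a - b \<in> Lambda_ideal d y"
  by (auto simp: Lambda_ideal_def simp flip: right_diff_distrib intro!: imageI Lambda.diff_closed)

lemma Lambda_ideal_uminus: "a \<in> Lambda_ideal d y \<Longrightarrow> - a \<in> Lambda_ideal d y"
  using Lambda_ideal_diff[of a d y a] Lambda_ideal_diff[of "a - a" d y a] by simp

lemma Lambda_ideal_mult_right:
  "a \<in> Lambda_ideal d y \<Longrightarrow> b \<in> Lambda d \<Longrightarrow> a * b \<in> Lambda_ideal d y"
  by (auto simp: Lambda_ideal_def mult.assoc intro!: imageI Lambda.mult_closed)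

lemma Lambda_ideal_mult:
  assumes "a \<in> Lambda_ideal d y" "b \<in> Lambda_ideal d z"
  shows "a * b \<in> Lambda_ideal d (y * z)"
proof -
  obtain g h where "a = y * g" "b = z * h" "g \<in> Lambda d" "h \<in> Lambda d"
    using assms by (auto simp: Lambda_ideal_def)
  then show ?thesis
    using Lambda_idealI[OF Lambda.mult_closed, of g d h "y * z"] by (simp add: mult_ac)
qed

lemma Lambda_ideal_trans:
  "a \<in> Lambda_ideal d y \<Longrightarrow> y \<in> Lambda_ideal d z \<Longrightarrow> a \<in> Lambda_ideal d z"
  by (auto simp: Lambda_ideal_def mult.assoc intro!: imageI Lambda.mult_closed)

lemma qpoch_ideal_mono: "m \<le> n \<Longrightarrow> qpoch d n \<in> Lambda_ideal d (qpoch d m)"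
proof (induction n rule: dec_induct)
  case base
  show ?case by (rule Lambda_ideal_self)
next
  case (step n)
  show ?case unfolding qpoch_Suc
    by (intro Lambda_ideal_mult_right step.IH one_minus_qroot_power_in_Lambda)
qed

lemma mem_Lambda_coset: "b \<in> Lambda_coset d n a \<longleftrightarrow> b - a \<in> Lambda_ideal d (qpoch d n)"
  by (auto simp: Lambda_coset_def Lambda_ideal_def image_iff algebra_simps)

lemma Lambda_coset_eqI:
  assumes "b - a \<in> Lambda_ideal d (qpoch d n)"
  shows "Lambda_coset d n a = Lambda_coset d n b"
proof -
  have "c - a \<in> Lambda_ideal d (qpoch d n) \<longleftrightarrow> c - b \<in> Lambda_ideal d (qpoch d n)" for c
    using Lambda_ideal_diff[OF _ assms, of "c - a"]
      Lambda_ideal_diff[OF _ Lambda_ideal_uminus[OF assms], of "c - b"] by auto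
  then show ?thesis by (auto simp: mem_Lambda_coset)
qed

lemma Lambda_ideal_subset: "y \<in> Lambda d \<Longrightarrow> Lambda_ideal d y \<subseteq> Lambda d"
  by (auto simp: Lambda_ideal_def intro: Lambda.mult_closed)

lemma hat_Lambda_nonempty:
  assumes "f \<in> hat_Lambda d"
  shows "\<exists>a. a \<in> f n"
proof -
  obtain a where "f n = Lambda_coset d n a" using assms unfolding hat_Lambda_def by blast
  moreover have "a \<in> Lambda_coset d n a"
    using Lambda_ideal_diff[OF Lambda_ideal_self Lambda_ideal_self] by (auto simp: mem_Lambda_coset)
  ultimately show ?thesis by blast
qed

lemma hat_Lambda_mem:
  assumes "f \<in> hat_Lambda d" "a \<in> f n"
  shows "a \<in> Lambda d" "f n = Lambda_coset d n a"
proof -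
  obtain b where b: "b \<in> Lambda d" "f n = Lambda_coset d n b"
    using assms(1) unfolding hat_Lambda_def by blast
  then have ab: "a - b \<in> Lambda_ideal d (qpoch d n)" using assms(2) by (simp add: mem_Lambda_coset)
  then show "f n = Lambda_coset d n a" using b(2) Lambda_coset_eqI by simp
  have "a - b \<in> Lambda d" using ab Lambda_ideal_subset[OF qpoch_in_Lambda] by blast
  then have "(a - b) + b \<in> Lambda d" using b(1) by (rule Lambda.add_closed)
  then show "a \<in> Lambda d" by simp
qed

lemma hat_Lambda_antimono:
  assumes "f \<in> hat_Lambda d" "m \<le> n"
  shows "f n \<subseteq> f m"
proof (rule lift_Suc_antimono_le[OF _ assms(2)])
  show "f (Suc k) \<subseteq> f k" for k using assms(1) unfolding hat_Lambda_def by blast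
qed

lemma hat_Lambda_diff:
  assumes "f \<in> hat_Lambda d" "a \<in> f m" "b \<in> f n" "m \<le> n"
  shows "b - a \<in> Lambda_ideal d (qpoch d m)"
  using hat_Lambda_antimono[OF assms(1,4)] assms(3) hat_Lambda_mem(2)[OF assms(1,2)]
  by (auto simp: mem_Lambda_coset)

lemma one_minus_qroot_power_regular_at: "1 - (qroot ^ d) ^ n \<in> regular_at z"
  by (intro regular_at_diff regular_at_power qroot_regular_at one_regular_at)

lemma qpoch_regular_at: "qpoch d n \<in> regular_at z"
  by (induction n) (auto simp: qpoch_Suc simp del: power_Suc
      intro!: regular_at_mult one_minus_qroot_power_regular_at, simp add: qpoch_def one_regular_at)

lemma eval_one_minus_qroot_power: "eval_ratfun (1 - (qroot ^ d) ^ n) z = 1 - z ^ (d * n)"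
proof -
  have "1 - (qroot ^ d) ^ n = to_fract (1 - monom 1 (d * n))"
    by (simp add: to_fract_monom power_mult)
  then show ?thesis by (simp only: eval_ratfun_to_fract poly_at_simps)
qed

lemma taylor1_qpoch: "j < n \<Longrightarrow> fps_nth (taylor1 d (qpoch d n)) j = 0"
proof (induction n arbitrary: j)
  case (Suc n)
  have "taylor1 d (qpoch d (Suc n)) = taylor1 d (qpoch d n) * taylor1 d (1 - (qroot ^ d) ^ Suc n)"
    unfolding qpoch_Suc by (intro taylor1_mult qpoch_regular_at one_minus_qroot_power_regular_at)
  moreover have "fps_nth (taylor1 d (1 - (qroot ^ d) ^ Suc n)) 0 = 0"
    unfolding taylor1_nth_0 eval_one_minus_qroot_power by simp
  ultimately show ?case using Suc by (auto intro!: fps_nth_mult_eq_0[of n _ 1])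
qed simp

lemma taylor1_Lambda_ideal_qpoch:
  assumes "0 < d" "a \<in> Lambda_ideal d (qpoch d n)" "j < n"
  shows "fps_nth (taylor1 d a) j = 0"
proof -
  obtain g where "g \<in> Lambda d" "a = qpoch d n * g" using assms(2) by (auto simp: Lambda_ideal_def)
  moreover have "fps_nth (taylor1 d (qpoch d n) * taylor1 d g) j = 0"
    by (rule fps_nth_mult_eq_0[of n _ 0]) (use assms(3) taylor1_qpoch in auto)
  ultimately show ?thesis
    using assms(1) by (simp add: taylor1_mult qpoch_regular_at Lambda_regular_at_1)
qed

text \<open>Removes the \<open>SOME\<close> from \<open>hat_taylor1\<close>: representatives of
  index above \<open>n\<close> differ by a multiple of \<open>(q;q)_(n+1)\<close>, whose Taylor
  series has no term of degree \<open>n\<close> or less.\<close>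

lemma hat_taylor1_nth:
  assumes d: "0 < d" and f: "f \<in> hat_Lambda d" and a: "a \<in> f m" and "n < m"
  shows "fps_nth (hat_taylor1 d f) n = fps_nth (taylor1 d a) n"
proof -
  define b where "b = (SOME b. b \<in> f (Suc n))"
  have b: "b \<in> f (Suc n)" unfolding b_def using hat_Lambda_nonempty[OF f] by (rule someI_ex)
  have "a - b \<in> Lambda_ideal d (qpoch d (Suc n))"
    using hat_Lambda_diff[OF f b a] assms(4) by simp
  then have "fps_nth (taylor1 d (a - b)) n = 0" using taylor1_Lambda_ideal_qpoch[OF d] by simp
  then have "fps_nth (taylor1 d a) n = fps_nth (taylor1 d b) n"
    using hat_Lambda_mem(1)[OF f] a b by (simp add: taylor1_diff Lambda_regular_at_1[OF d])
  then show ?thesis by (simp add: hat_taylor1_def b_def)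
qed

lemma hat_taylor1_over_Z_inv:
  assumes "0 < d" "f \<in> hat_Lambda d"
  shows "fps_nth (hat_taylor1 d f) n \<in> Z_inv d"
proof -
  obtain a where a: "a \<in> f (Suc n)" using hat_Lambda_nonempty[OF assms(2)] by blast
  show ?thesis
    using taylor1_over_Z_inv[OF assms(1) hat_Lambda_mem(1)[OF assms(2) a]]
      hat_taylor1_nth[OF assms a] by simp
qed

section \<open>Injectivity\<close>

text \<open>A product of \<open>k + j\<close> factors, each \<open>a\<close> or \<open>b\<close>,
  contains \<open>a\<close> at least \<open>k\<close> times or \<open>b\<close> at least
  \<open>j\<close> times. The induction peels off one factor \<open>a + b\<close>.\<close>

lemma power_sum_split:
  fixes a b :: "'a::comm_ring_1"
  assumes R: "unital_subring R" "a \<in> R" "b \<in> R"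
  shows "\<exists>u\<in>R. \<exists>v\<in>R. (a + b) ^ (k + j) = a ^ k * u + b ^ j * v"
proof (induction "k + j" arbitrary: k j)
  case 0
  then show ?case using unital_subring.one_closed[OF R(1)] unital_subring.zero_closed[OF R(1)]
    by (intro bexI[of _ 1] bexI[of _ 0]) auto
next
  case (Suc n)
  interpret unital_subring R by fact
  show ?case
  proof (cases k)
    case 0
    then show ?thesis using power_closed[OF add_closed[OF R(2,3)], of j] zero_closed
      by (intro bexI[of _ "(a + b) ^ j"] bexI[of _ 0]) auto
  next
    case k: (Suc k')
    show ?thesis
    proof (cases j)
      case 0
      then show ?thesis using power_closed[OF add_closed[OF R(2,3)], of k] zero_closed
        by (intro bexI[of _ 0] bexI[of _ "(a + b) ^ k"]) auto
    next
      case j: (Suc j')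
      obtain u v where uv: "u \<in> R" "v \<in> R" "(a + b) ^ (k' + j) = a ^ k' * u + b ^ j * v"
        using Suc(1)[of k' j] Suc(2) k by auto
      obtain u' v' where uv': "u' \<in> R" "v' \<in> R" "(a + b) ^ (k + j') = a ^ k * u' + b ^ j' * v'"
        using Suc(1)[of k j'] Suc(2) j by auto
      have "(a + b) ^ (k + j) = a * (a + b) ^ (k' + j) + b * (a + b) ^ (k + j')"
        by (simp add: k j algebra_simps)
      also have "\<dots> = a ^ k * (u + b * u') + b ^ j * (a * v + v')"
        unfolding uv(3) uv'(3) by (simp add: k j algebra_simps)
      finally show ?thesis using uv uv' R add_closed mult_closed by blast
    qed
  qed
qed

lemma prime_power_minus_one:
  fixes z :: "'a::comm_ring_1"
  assumes R: "unital_subring R" "z \<in> R" and p: "prime p"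
  shows "\<exists>h\<in>R. (z - 1) ^ p = z ^ p - 1 + of_nat p * h"
proof -
  interpret unital_subring R by fact
  \<comment> \<open>For odd \<open>p\<close> the power is exactly \<open>- 1\<close>; for
    \<open>p = 2\<close> it is \<open>1 = - 1 + 2 * 1\<close>.\<close>
  obtain e where e: "e \<in> R" "(- 1) ^ p = (- 1 :: 'a) + of_nat p * e"
  proof (cases "p = 2")
    case True
    then show ?thesis using that[of 1] one_closed by simp
  next
    case False
    then have "odd p" using p prime_odd_nat prime_ge_2_nat[OF p] by force
    then show ?thesis using that[of 0] zero_closed by simp
  qed
  define t where "t k = of_nat ((p choose k) div p) * z ^ k * (- 1) ^ (p - k)" for k
  have t: "of_nat (p choose k) * z ^ k * (- 1) ^ (p - k) = of_nat p * t k" if "k \<in> {1..<p}" for k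
  proof -
    have "p dvd (p choose k)" using that p by (intro dvd_choose_prime) auto
    then have "of_nat (p choose k) = (of_nat p * of_nat ((p choose k) div p) :: 'a)"
      by (simp flip: of_nat_mult)
    then show ?thesis by (simp add: t_def mult.assoc)
  qed
  have p0: "0 < p" using p prime_gt_0_nat by blast
  have "(z - 1) ^ p = (\<Sum>k\<le>p. of_nat (p choose k) * z ^ k * (- 1) ^ (p - k))"
    using binomial_ring[of z "- 1" p] by simp
  also have "{..p} = insert 0 (insert p {1..<p})" using p0 by auto
  also have "(\<Sum>k\<in>\<dots>. of_nat (p choose k) * z ^ k * (- 1) ^ (p - k)) =
      (- 1) ^ p + (z ^ p + (\<Sum>k\<in>{1..<p}. of_nat (p choose k) * z ^ k * (- 1) ^ (p - k)))"
    using p0 by simp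
  also have "(\<Sum>k\<in>{1..<p}. of_nat (p choose k) * z ^ k * (- 1) ^ (p - k)) = of_nat p * sum t {1..<p}"
    unfolding sum_distrib_left by (intro sum.cong refl t)
  finally have "(z - 1) ^ p = z ^ p - 1 + of_nat p * (e + sum t {1..<p})"
    unfolding e(2) by (simp add: algebra_simps)
  moreover have "e + sum t {1..<p} \<in> R"
    unfolding t_def using e(1) R(2)
    by (intro add_closed sum_closed mult_closed of_nat_closed power_closed uminus_closed one_closed)
  ultimately show ?thesis by blast
qed

lemma rat_Z_inv_numerator:
  assumes "a \<in> rat_Z_inv d" "0 < d"
  shows "\<exists>k m. a * of_nat d ^ k = of_int m"
proof -
  let ?B = "{a :: rat. \<exists>k m. a * of_nat d ^ k = of_int m}"
  have "unital_subring ?B"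
  proof
    have "1 * of_nat d ^ 0 = (of_int 1 :: rat)" by simp
    then show "1 \<in> ?B" by blast
    fix a b assume "a \<in> ?B" "b \<in> ?B"
    then obtain k m l n where a: "a * of_nat d ^ k = of_int m" and b: "b * of_nat d ^ l = of_int n"
      by blast
    have "(a - b) * of_nat d ^ (k + l) = of_nat d ^ l * (a * of_nat d ^ k) - of_nat d ^ k * (b * of_nat d ^ l)"
      by (simp add: power_add algebra_simps)
    also have "\<dots> = of_int (int d ^ l * m - int d ^ k * n)" by (simp add: a b)
    finally show "a - b \<in> ?B" by blast
    have "(a * b) * of_nat d ^ (k + l) = (a * of_nat d ^ k) * (b * of_nat d ^ l)"
      by (simp add: power_add)
    also have "\<dots> = of_int (m * n)" by (simp add: a b)
    finally show "a * b \<in> ?B" by blast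
  qed
  moreover have "inverse (of_nat d) * of_nat d ^ 1 = (of_int 1 :: rat)" using assms(2) by simp
  then have "inverse (of_nat d) \<in> ?B" by blast
  ultimately show ?thesis
    using subring_gen_subset[of ?B "{inverse (of_nat d)}"] assms(1) by (auto simp: rat_Z_inv_def)
qed

text \<open>Clearing the denominator, a power of \<open>d\<close> prime to \<open>p\<close>, turns
  \<open>a\<close> into an integer divisible by every power of \<open>p\<close>.\<close>

lemma rat_Z_inv_separated:
  assumes "0 < d" "prime p" "\<not> p dvd d" "a \<in> rat_Z_inv d"
    and div: "\<And>j. \<exists>u\<in>rat_Z_inv d. a = of_nat p ^ j * u"
  shows "a = 0"
proof -
  obtain k m where m: "a * of_nat d ^ k = of_int m"
    using rat_Z_inv_numerator[OF assms(4,1)] by blast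
  have cop: "coprime (int p ^ j) (int d ^ l)" for j l
    using assms(2,3) prime_imp_coprime[of p d] by simp
  have dvd: "int p ^ j dvd m" for j
  proof -
    obtain u where u: "u \<in> rat_Z_inv d" "a = of_nat p ^ j * u" using div by blast
    obtain l n where n: "u * of_nat d ^ l = of_int n" using rat_Z_inv_numerator[OF u(1) assms(1)] by blast
    have "of_int (m * int d ^ l) = a * of_nat d ^ k * of_nat d ^ l" by (simp add: m)
    also have "\<dots> = of_nat p ^ j * (u * of_nat d ^ l) * of_nat d ^ k" by (simp add: u(2) mult_ac)
    also have "\<dots> = of_int (int p ^ j * n * int d ^ k)" by (simp add: n)
    finally have "m * int d ^ l = int p ^ j * n * int d ^ k" by (simp only: of_int_eq_iff)
    then have "int p ^ j dvd m * int d ^ l" by simp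
    then show ?thesis using cop[of j l] by (simp only: coprime_dvd_mult_left_iff)
  qed
  have "m = 0"
  proof (rule ccontr)
    assume "m \<noteq> 0"
    then have "int p ^ nat \<bar>m\<bar> \<le> \<bar>m\<bar>" using dvd[of "nat \<bar>m\<bar>"] by (intro zdvd_imp_le) auto
    moreover have "nat \<bar>m\<bar> < p ^ nat \<bar>m\<bar>"
      using prime_gt_Suc_0_nat[OF assms(2)] by (intro power_gt_expt)
    then have "\<bar>m\<bar> < int (p ^ nat \<bar>m\<bar>)" by linarith
    ultimately show False by simp
  qed
  then show ?thesis using m assms(1) by simp
qed

section \<open>Divisibility between \<open>(q;q)_n\<close> and powers of
  \<open>x^s - 1\<close>\<close>

lemma qroot_power_minus_one_ideal:
  "qroot ^ (s * n) - 1 \<in> Lambda_ideal d (qroot ^ s - 1)"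
proof -
  have "qroot ^ (s * n) - 1 = (qroot ^ s - 1) * (\<Sum>i<n. (qroot ^ s) ^ i)"
    by (simp only: power_diff_1_eq[symmetric] power_mult)
  then show ?thesis
    using Lambda_idealI[OF Lambda.sum_closed[of "{..<n}" "\<lambda>i. (qroot ^ s) ^ i" d]]
    by (simp add: Lambda.power_closed qroot_in_Lambda)
qed

text \<open>At least \<open>k\<close> of the first \<open>n\<close> indices are multiples of
  \<open>s\<close>, and each such factor of \<open>(q;q)_n\<close> is divisible by
  \<open>x^s - 1\<close>.\<close>

lemma qpoch_in_power_ideal:
  assumes "0 < s" "k * s \<le> n"
  shows "qpoch d n \<in> Lambda_ideal d ((qroot ^ s - 1) ^ k)"
  using assms(2)
proof (induction k arbitrary: n)
  case 0
  show ?case using Lambda_idealI[OF qpoch_in_Lambda, of 1 d n] by simp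
next
  case (Suc k)
  \<comment> \<open>The factor of index \<open>Suc m = Suc k * s\<close> supplies one more
    \<open>x^s - 1\<close>; the product before it is covered by the induction hypothesis.\<close>
  define m where "m = Suc k * s - 1"
  have m: "Suc m = s * Suc k" "k * s \<le> m" using assms(1) by (simp_all add: m_def)
  have "(qroot ^ d) ^ Suc m = qroot ^ (s * (Suc k * d))" by (simp add: m algebra_simps flip: power_mult)
  then have "1 - (qroot ^ d) ^ Suc m \<in> Lambda_ideal d (qroot ^ s - 1)"
    using Lambda_ideal_uminus[OF qroot_power_minus_one_ideal[of s "Suc k * d" d]] by simp
  then have "qpoch d (Suc m) \<in> Lambda_ideal d ((qroot ^ s - 1) ^ k * (qroot ^ s - 1))"
    unfolding qpoch_Suc using Suc.IH[OF m(2)] by (intro Lambda_ideal_mult)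
  moreover have "qpoch d n \<in> Lambda_ideal d (qpoch d (Suc m))"
    using Suc.prems m(1) by (intro qpoch_ideal_mono) (simp add: mult.commute)
  ultimately show ?case using Lambda_ideal_trans by (simp only: power_Suc2)
qed

text \<open>Among the cyclotomic factors of \<open>q^i - 1\<close>, that is of
  \<open>x^(d * i) - 1\<close>, those with index not coprime to \<open>d\<close> are units of
  \<open>Lambda d\<close>. Any other index divides \<open>i\<close>, hence \<open>S\<close>, so its
  factor occurs in \<open>x^S - 1\<close>.\<close>

lemma qroot_power_minus_one_in_cyclotomic_ideal:
  assumes "0 < d" "0 < S" "0 < i" "\<And>s. s dvd i \<Longrightarrow> coprime s d \<Longrightarrow> s dvd S"
  shows "qroot ^ S - 1 \<in> Lambda_ideal d (1 - (qroot ^ d) ^ i)"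
proof -
  let ?P = "\<lambda>A. \<Prod>s\<in>A. to_fract (cyclotomic s)"
  have x: "qroot ^ n - 1 = ?P {s. s dvd n}" if "0 < n" for n
    using prod_cyclotomic[OF that] by (simp add: to_fract_monom flip: to_fract_prod)
  define A B where "A = {s. s dvd d * i \<and> coprime s d}" and "B = {s. s dvd d * i \<and> \<not> coprime s d}"
  have di: "0 < d * i" using assms by simp
  have fin: "finite {s. s dvd d * i}" "finite {s. s dvd S}" using di assms(2) by auto
  then have finAB: "finite A" "finite B" unfolding A_def B_def by auto
  have sub: "A \<subseteq> {s. s dvd S}"
    using assms(4) by (auto simp: A_def coprime_dvd_mult_right_iff)
  have nz: "?P B \<noteq> 0"
    using finAB dvd_pos_nat[OF di] by (auto simp: B_def cyclotomic_nonzero)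
  have "{s. s dvd d * i} = A \<union> B" "A \<inter> B = {}" by (auto simp: A_def B_def)
  then have "qroot ^ (d * i) - 1 = ?P A * ?P B"
    unfolding x[OF di] using finAB by (simp add: prod.union_disjoint)
  then have "?P A = (1 - (qroot ^ d) ^ i) * (- inverse (?P B))"
    using nz by (simp add: field_simps power_mult)
  then have "qroot ^ S - 1 = (1 - (qroot ^ d) ^ i) * (- inverse (?P B) * ?P ({s. s dvd S} - A))"
    unfolding x[OF assms(2)] prod.subset_diff[OF sub fin(2)] by (simp add: mult_ac)
  moreover have "- inverse (?P B) * ?P ({s. s dvd S} - A) \<in> Lambda d"
  proof (intro Lambda.mult_closed Lambda.uminus_closed Lambda.prod_closed)
    show "inverse (?P B) \<in> Lambda d"
      unfolding prod_inversef[symmetric] o_def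
      by (intro Lambda.prod_closed inverse_cyclotomic_in_Lambda)
        (auto simp: B_def intro: dvd_pos_nat[OF di])
    fix s assume "s \<in> {s. s dvd S} - A"
    then have "0 < s" using dvd_pos_nat[OF assms(2)] by auto
    then have "cyclotomic s \<in> polys_over (rat_Z_inv d)"
      using cyclotomic_polys_over_Ints polys_over_Ints_rat_Z_inv by blast
    then show "to_fract (cyclotomic s) \<in> Lambda d" by (rule to_fract_polys_over_in_Lambda[OF assms(1)])
  qed
  ultimately show ?thesis by (simp only: Lambda_idealI)
qed

lemma degree_diff_less_or_zero:
  fixes a b :: "'a::ab_group_add poly"
  assumes "a = 0 \<or> degree a < K" "b = 0 \<or> degree b < K"
  shows "a - b = 0 \<or> degree (a - b) < K"
  using assms by (cases "K = 0") (auto intro!: degree_diff_less)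

text \<open>Representatives of one element of the completion. Injectivity applies this to the
  termwise difference of representatives of two elements.\<close>

locale compatible_sequence =
  fixes d :: nat and c :: "nat \<Rightarrow> rat poly fract"
  assumes d_pos: "0 < d"
    and in_Lambda: "c n \<in> Lambda d"
    and compatible: "n \<le> m \<Longrightarrow> c m - c n \<in> Lambda_ideal d (qpoch d n)"
begin

text \<open>As \<open>c m\<close> is fixed only modulo \<open>(q;q)_m\<close>, divisibility by a
  \<open>k\<close>-th power is to be expected only for large \<open>m\<close>; compatibility makes
  arbitrarily late occurrences sufficient.\<close>

definition divisible_at :: "nat \<Rightarrow> bool" where
  "divisible_at s \<longleftrightarrow> (\<forall>k n. \<exists>m\<ge>n. c m \<in> Lambda_ideal d ((qroot ^ s - 1) ^ k))"

text \<open>Modulo \<open>p\<close>, \<open>qroot ^ (p * s) - 1\<close> is the \<open>p\<close>-th power of \<open>qroot ^ s - 1\<close>, so \<open>c\<close> is arbitrarily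
  divisible by \<open>p\<close> modulo any fixed power of \<open>qroot ^ (p * s) - 1\<close>.\<close>

lemma divisible_at_prime_mult:
  assumes s: "0 < s" "coprime s d" and p: "prime p" "\<not> p dvd d" and div: "divisible_at s"
  shows "divisible_at (p * s)"
  unfolding divisible_at_def
proof (intro allI)
  fix k n
  \<comment> \<open>From this index on, \<open>(q;q)_N\<close> is a multiple of \<open>?y^k\<close>,
    so all later \<open>c m\<close> agree with \<open>c N\<close> modulo
    \<open>?y^k\<close>.\<close>
  define N where "N = max n (k * (p * s))"
  let ?y = "qroot ^ (p * s) - 1"
  have ps: "0 < p * s" "coprime (p * s) d"
    using s p prime_gt_0_nat[OF p(1)] prime_imp_coprime[OF p] by auto
  have L: "qroot ^ i - 1 \<in> Lambda d" for i
    by (intro Lambda.diff_closed Lambda.power_closed qroot_in_Lambda Lambda.one_closed)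
  obtain r g where rg: "r \<in> polys_over (rat_Z_inv d)" "g \<in> Lambda d"
    "c N = to_fract r + ?y ^ k * g" "r = 0 \<or> degree r < k * (p * s)"
    using Lambda_decomp[OF d_pos ps in_Lambda] by blast
  obtain h where h: "h \<in> Lambda d" "(qroot ^ s - 1) ^ p = ?y + of_nat p * h"
    using prime_power_minus_one[OF Lambda.unital_subring_axioms
        Lambda.power_closed[OF qroot_in_Lambda(1), of s] p(1)]
    by (auto simp: mult.commute simp flip: power_mult)
  have "\<exists>r'\<in>polys_over (rat_Z_inv d). r = of_nat (p ^ j) * r'" for j
  proof -
    \<comment> \<open>The factor \<open>p\<close> in the exponent turns \<open>x^s - 1\<close> into
      \<open>?y + of_nat p * h\<close>; the exponent \<open>k + j\<close> then splits into a
      multiple of \<open>?y^k\<close> and a multiple of \<open>p^j\<close>.\<close>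
    obtain m where m: "m \<ge> N" "c m \<in> Lambda_ideal d ((qroot ^ s - 1) ^ (p * (k + j)))"
      using div unfolding divisible_at_def by blast
    obtain e where e: "e \<in> Lambda d" "c m = (?y + of_nat p * h) ^ (k + j) * e"
      using m(2) by (auto simp: Lambda_ideal_def power_mult h(2))
    obtain u v where uv: "u \<in> Lambda d" "v \<in> Lambda d"
      "(?y + of_nat p * h) ^ (k + j) = ?y ^ k * u + (of_nat p * h) ^ j * v"
      using power_sum_split[OF Lambda.unital_subring_axioms L[of "p * s"]
          Lambda.mult_closed[OF Lambda.of_nat_closed h(1)]] by blast
    have "c m - c N \<in> Lambda_ideal d (?y ^ k)"
      using compatible[OF m(1)] qpoch_in_power_ideal[OF ps(1), of k N d]
      by (auto simp: N_def intro: Lambda_ideal_trans)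
    then obtain w where w: "w \<in> Lambda d" "c m - c N = ?y ^ k * w" by (auto simp: Lambda_ideal_def)
    have hv: "h ^ j * v * e \<in> Lambda d"
      using h(1) uv(2) e(1) by (intro Lambda.mult_closed Lambda.power_closed)
    \<comment> \<open>Reducing the cofactor of \<open>p^j\<close> gives a second remainder of small
      degree for the same element; by uniqueness it equals \<open>r\<close>, which is thus a
      multiple of \<open>p^j\<close>.\<close>
    obtain r' g' where rg': "r' \<in> polys_over (rat_Z_inv d)" "g' \<in> Lambda d"
      "h ^ j * v * e = to_fract r' + ?y ^ k * g'" "r' = 0 \<or> degree r' < k * (p * s)"
      using Lambda_decomp[OF d_pos ps hv] by blast
    have "to_fract r = c m - ?y ^ k * w - ?y ^ k * g"
      using w(2) rg(3) by (simp add: algebra_simps)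
    also have "c m = ?y ^ k * (u * e) + of_nat (p ^ j) * (h ^ j * v * e)"
      unfolding e(2) uv(3) by (simp add: algebra_simps power_mult_distrib)
    finally have "to_fract (r - of_nat (p ^ j) * r') =
        ?y ^ k * (u * e - w - g + of_nat (p ^ j) * g')"
      unfolding rg'(3) by (simp add: to_fract_of_nat algebra_simps del: of_nat_power)
    moreover have "u * e - w - g + of_nat (p ^ j) * g' \<in> Lambda d"
      using uv e w rg rg' by (intro Lambda.add_closed Lambda.diff_closed Lambda.mult_closed
          Lambda.of_nat_closed)
    moreover have "r - of_nat (p ^ j) * r' = 0 \<or> degree (r - of_nat (p ^ j) * r') < k * (p * s)"
    proof -
      have "degree (of_nat (p ^ j) * r') \<le> degree r'"
        using degree_mult_le[of "of_nat (p ^ j)" r'] by (simp del: of_nat_power)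
      then have "of_nat (p ^ j) * r' = 0 \<or> degree (of_nat (p ^ j) * r') < k * (p * s)"
        using rg'(4) by (auto simp del: of_nat_power)
      then show ?thesis by (rule degree_diff_less_or_zero[OF rg(4)])
    qed
    ultimately have "r - of_nat (p ^ j) * r' = 0"
      using Lambda_small_multiple_zero[OF d_pos ps] by blast
    then show ?thesis using rg'(1) by auto
  qed
  then have "\<exists>u\<in>rat_Z_inv d. coeff r i = of_nat p ^ j * u" for i j
  proof -
    assume "\<And>j. \<exists>r'\<in>polys_over (rat_Z_inv d). r = of_nat (p ^ j) * r'"
    then obtain r' where r': "r' \<in> polys_over (rat_Z_inv d)" "r = of_nat (p ^ j) * r'" by blast
    have "coeff (of_nat (p ^ j) * r') i = of_nat (p ^ j) * coeff r' i"
      unfolding of_nat_poly by simp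
    then have "coeff r i = of_nat p ^ j * coeff r' i" unfolding r'(2) by simp
    then show ?thesis using r'(1) by (auto simp: polys_over_def)
  qed
  then have "coeff r i = 0" for i
    using rg(1) by (intro rat_Z_inv_separated[OF d_pos p]) (auto simp: polys_over_def)
  then have "r = 0" by (simp add: poly_eq_iff)
  then have "c N \<in> Lambda_ideal d (?y ^ k)" using rg(2,3) Lambda_idealI by simp
  then show "\<exists>m\<ge>n. c m \<in> Lambda_ideal d (?y ^ k)" by (intro exI[of _ N]) (simp add: N_def)
qed

lemma divisible_at_coprime:
  assumes "divisible_at 1" "0 < s" "coprime s d"
  shows "divisible_at s"
  using assms(2,3)
proof (induction s rule: less_induct)
  case (less s)
  show ?case
  proof (cases "s = 1")
    case False
    then obtain p where p: "prime p" "p dvd s" using prime_factor_nat by blast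
    then obtain s' where s': "s = p * s'" by auto
    have "0 < s'" "s' < s" using less.prems(1) s' prime_gt_1_nat[OF p(1)] by auto
    moreover have "coprime s' d" "coprime p d" using less.prems(2) s' by auto
    moreover have "\<not> p dvd d"
      using \<open>coprime p d\<close> p(1) coprime_common_divisor_nat[of p d p] by (auto simp: prime_nat_iff)
    moreover from calculation have "divisible_at s'" by (intro less.IH)
    ultimately show ?thesis
      unfolding s' by (intro divisible_at_prime_mult p)
  qed (use assms(1) in simp)
qed

lemma in_qpoch_ideal:
  assumes "\<And>n j. j < n \<Longrightarrow> fps_nth (taylor1 d (c n)) j = 0"
  shows "c n \<in> Lambda_ideal d (qpoch d n)"
proof -
  have base: "c m \<in> Lambda_ideal d ((qroot - 1) ^ m)" for m
  proof -
    obtain r g where rg: "g \<in> Lambda d" "c m = to_fract r + (qroot - 1) ^ m * g"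
      "r = 0 \<or> degree r < m"
      using Lambda_decomp[OF d_pos _ _ in_Lambda, of 1 m m] by auto
    have "fps_nth (taylor1 d (to_fract r)) j = 0" if "j < m" for j
      using taylor1_decomp[OF d_pos rg(1) to_fract_regular_at that, of r] assms[OF that] rg(2) by simp
    then have "r = 0" by (rule taylor1_small_degree_zero[OF d_pos rg(3)])
    then show ?thesis using rg(1,2) Lambda_idealI by simp
  qed
  have "divisible_at 1"
    unfolding divisible_at_def
  proof (intro allI)
    fix k n :: nat
    have "(qroot - 1) ^ max k n = (qroot - 1) ^ k * (qroot - 1) ^ (max k n - k)"
      by (simp flip: power_add)
    then have "(qroot - 1) ^ max k n \<in> Lambda_ideal d ((qroot - 1) ^ k)"
      by (simp only:) (intro Lambda_idealI Lambda.power_closed Lambda.diff_closed qroot_in_Lambda Lambda.one_closed)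
    then show "\<exists>m\<ge>n. c m \<in> Lambda_ideal d ((qroot ^ 1 - 1) ^ k)"
      using Lambda_ideal_trans[OF base[of "max k n"]] by (intro exI[of _ "max k n"]) simp
  qed
  \<comment> \<open>A multiple of every number up to \<open>n\<close> coprime to \<open>d\<close>,
    and itself coprime to \<open>d\<close>: one \<open>S\<close> serves all factors of
    \<open>(q;q)_n\<close>.\<close>
  define S where "S = (\<Prod>j | j \<in> {1..n} \<and> coprime j d. j)"
  have S: "0 < S" "coprime S d" unfolding S_def by (auto intro!: prod_pos prod_coprime_left)
  obtain m where m: "m \<ge> n" "c m \<in> Lambda_ideal d ((qroot ^ S - 1) ^ n)"
    using divisible_at_coprime[OF \<open>divisible_at 1\<close> S] unfolding divisible_at_def by blast
  have "(qroot ^ S - 1) ^ k \<in> Lambda_ideal d (qpoch d k)" if "k \<le> n" for k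
    using that
  proof (induction k)
    case 0
    show ?case using Lambda_ideal_self[of 1 d] by (simp add: qpoch_def)
  next
    case (Suc k)
    have "s dvd S" if "s dvd Suc k" "coprime s d" for s
      unfolding S_def using that Suc.prems dvd_imp_le[OF that(1)] dvd_pos_nat[OF _ that(1)]
      by (intro dvd_prodI) auto
    then have "qroot ^ S - 1 \<in> Lambda_ideal d (1 - (qroot ^ d) ^ Suc k)"
      by (intro qroot_power_minus_one_in_cyclotomic_ideal d_pos S) auto
    then show ?case using Suc unfolding qpoch_Suc power_Suc2[of "qroot ^ S - 1"]
      by (intro Lambda_ideal_mult) auto
  qed
  then have "c m \<in> Lambda_ideal d (qpoch d n)" using m(2) Lambda_ideal_trans by blast
  \<comment> \<open>Compatibility carries the divisibility from the late index \<open>m\<close> back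
    to \<open>n\<close>.\<close>
  then have "c m - (c m - c n) \<in> Lambda_ideal d (qpoch d n)"
    using compatible[OF m(1)] by (rule Lambda_ideal_diff)
  then show ?thesis by simp
qed

end

lemma inj_on_hat_taylor1:
  assumes "0 < d"
  shows "inj_on (hat_taylor1 d) (hat_Lambda d)"
proof (rule inj_onI)
  fix f g assume f: "f \<in> hat_Lambda d" and g: "g \<in> hat_Lambda d"
    and eq: "hat_taylor1 d f = hat_taylor1 d g"
  have "\<forall>n. \<exists>a. a \<in> f n" "\<forall>n. \<exists>b. b \<in> g n" using hat_Lambda_nonempty f g by blast+
  then obtain a b where a: "\<And>n. a n \<in> f n" and b: "\<And>n. b n \<in> g n" by metis
  interpret compatible_sequence d "\<lambda>n. a n - b n"
  proof
    show "a n - b n \<in> Lambda d" for n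
      using hat_Lambda_mem(1)[OF f a] hat_Lambda_mem(1)[OF g b] by (rule Lambda.diff_closed)
    fix n m :: nat assume "n \<le> m"
    then have "(a m - a n) - (b m - b n) \<in> Lambda_ideal d (qpoch d n)"
      by (intro Lambda_ideal_diff hat_Lambda_diff[OF f a a] hat_Lambda_diff[OF g b b])
    then show "a m - b m - (a n - b n) \<in> Lambda_ideal d (qpoch d n)" by (simp add: algebra_simps)
  qed fact
  have "fps_nth (taylor1 d (a n - b n)) j = 0" if "j < n" for n j
    using hat_taylor1_nth[OF assms f a that] hat_taylor1_nth[OF assms g b that] eq
      hat_Lambda_mem(1)[OF f a] hat_Lambda_mem(1)[OF g b]
    by (simp add: taylor1_diff Lambda_regular_at_1[OF assms])
  then have "a n - b n \<in> Lambda_ideal d (qpoch d n)" for n by (rule in_qpoch_ideal)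
  then show "f = g"
    using hat_Lambda_mem(2)[OF f a] hat_Lambda_mem(2)[OF g b] Lambda_coset_eqI by (metis ext)
qed

section \<open>Adic approximation by power series\<close>

lemma fps_shift_mult_eq:
  fixes F G :: "'a::comm_ring_1 fps"
  shows "fps_shift 1 (F * G) = fps_const (fps_nth F 0) * fps_shift 1 G + fps_shift 1 F * G"
proof (rule fps_ext)
  fix n
  have "fps_nth (F * G) (Suc n) =
      fps_nth F 0 * fps_nth G (Suc n) + (\<Sum>i=0..n. fps_nth F (Suc i) * fps_nth G (n - i))"
    unfolding fps_mult_nth by (subst sum.atLeast0_atMost_Suc_shift) simp
  then show "fps_nth (fps_shift 1 (F * G)) n =
      fps_nth (fps_const (fps_nth F 0) * fps_shift 1 G + fps_shift 1 F * G) n"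
    by (simp add: fps_mult_nth[of "fps_shift (Suc 0) F"])
qed

locale adic_approximation = unital_subring R for R :: "complex set" +
  fixes \<pi> :: complex
  assumes \<pi>_in: "\<pi> \<in> R"
begin

sublocale fps: unital_subring "fps_over R"
  by (rule unital_subring_fps_over) (rule unital_subring_axioms)

definition trunc :: "nat \<Rightarrow> complex fps \<Rightarrow> complex" where
  "trunc N F = (\<Sum>n<N. fps_nth F n * \<pi> ^ n)"

text \<open>Congruence of \<open>w\<close> with the value of \<open>F\<close> at
  \<open>\<pi>\<close> modulo \<open>\<pi>^N * R\<close>, phrased with truncations because
  \<open>R\<close> comes with no notion of convergence.\<close>

definition approx :: "nat \<Rightarrow> complex \<Rightarrow> complex fps \<Rightarrow> bool" where
  "approx N w F \<longleftrightarrow> (\<exists>e\<in>R. w = trunc N F + \<pi> ^ N * e)"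

lemma \<pi>_power_in: "\<pi> ^ n \<in> R"
  by (rule power_closed[OF \<pi>_in])

lemma fps_nth_in: "F \<in> fps_over R \<Longrightarrow> fps_nth F n \<in> R"
  by (simp add: fps_over_def)

lemma trunc_in: "F \<in> fps_over R \<Longrightarrow> trunc N F \<in> R"
  unfolding trunc_def by (intro sum_closed mult_closed fps_nth_in \<pi>_power_in)

lemma trunc_Suc_shift: "trunc (Suc N) F = fps_nth F 0 + \<pi> * trunc N (fps_shift 1 F)"
  unfolding trunc_def by (subst sum.lessThan_Suc_shift) (simp add: sum_distrib_left mult_ac)

lemma trunc_add: "trunc N (F + G) = trunc N F + trunc N G"
  by (simp add: trunc_def sum.distrib algebra_simps)

lemma trunc_const_mult: "trunc N (fps_const c * F) = c * trunc N F"
  by (simp add: trunc_def sum_distrib_left mult.assoc)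

text \<open>Terms of degree \<open>N\<close> or more in the product of truncations carry a factor
  \<open>\<pi>^N\<close>. Peeling off the constant coefficient of \<open>F\<close> avoids
  rearranging a double sum.\<close>

lemma trunc_mult:
  "F \<in> fps_over R \<Longrightarrow> G \<in> fps_over R \<Longrightarrow>
    \<exists>e\<in>R. trunc N F * trunc N G = trunc N (F * G) + \<pi> ^ N * e"
proof (induction N arbitrary: F G)
  case 0
  show ?case using zero_closed by (auto simp: trunc_def)
next
  case (Suc N)
  have "fps_shift 1 F \<in> fps_over R" using Suc.prems by (simp add: fps_over_def)
  from Suc.IH[OF this Suc.prems(2)] obtain e where e: "e \<in> R"
    "trunc N (fps_shift 1 F) * trunc N G = trunc N (fps_shift 1 F * G) + \<pi> ^ N * e" by blast
  let ?F = "trunc N (fps_shift 1 F)"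
  have F: "?F \<in> R" using Suc.prems by (intro trunc_in) (simp add: fps_over_def)
  have "trunc (Suc N) F * trunc (Suc N) G =
      fps_nth F 0 * fps_nth G 0 + \<pi> * (fps_nth F 0 * trunc N (fps_shift 1 G) + ?F * trunc (Suc N) G)"
    unfolding trunc_Suc_shift[of N F] by (simp add: trunc_Suc_shift algebra_simps)
  also have "?F * trunc (Suc N) G = ?F * trunc N G + \<pi> ^ N * (?F * fps_nth G N)"
    by (simp add: trunc_def algebra_simps)
  also have "\<dots> = trunc N (fps_shift 1 F * G) + \<pi> ^ N * (e + ?F * fps_nth G N)"
    unfolding e(2) by (simp add: algebra_simps)
  also have "fps_nth F 0 * fps_nth G 0 + \<pi> * (fps_nth F 0 * trunc N (fps_shift 1 G) + \<dots>) =
      trunc (Suc N) (F * G) + \<pi> ^ Suc N * (e + ?F * fps_nth G N)"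
    unfolding trunc_Suc_shift fps_shift_mult_eq trunc_add trunc_const_mult
    by (simp add: algebra_simps)
  finally show ?case using e(1) F Suc.prems by (blast intro: add_closed mult_closed fps_nth_in)
qed

lemma approx_trunc: "approx N (trunc N F) F"
  unfolding approx_def using zero_closed by force

lemma approx_in: "F \<in> fps_over R \<Longrightarrow> approx N w F \<Longrightarrow> w \<in> R"
  unfolding approx_def by (auto intro!: add_closed mult_closed trunc_in \<pi>_power_in)

lemma approx_cong: "approx N w F \<Longrightarrow> (\<And>n. n < N \<Longrightarrow> fps_nth F n = fps_nth G n) \<Longrightarrow> approx N w G"
  unfolding approx_def trunc_def by auto

lemma approx_shift:
  assumes "approx N w F" "u \<in> R"
  shows "approx N (w + \<pi> ^ N * u) F"
proof -
  obtain e where "e \<in> R" "w = trunc N F + \<pi> ^ N * e" using assms(1) by (auto simp: approx_def)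
  then have "w + \<pi> ^ N * u = trunc N F + \<pi> ^ N * (e + u)" "e + u \<in> R"
    using assms(2) by (auto simp: algebra_simps intro: add_closed)
  then show ?thesis unfolding approx_def by blast
qed

lemma approx_unique:
  assumes "approx N w F" "approx N v F"
  shows "\<exists>e\<in>R. w - v = \<pi> ^ N * e"
proof -
  obtain e e' where "e \<in> R" "w = trunc N F + \<pi> ^ N * e" "e' \<in> R" "v = trunc N F + \<pi> ^ N * e'"
    using assms by (auto simp: approx_def)
  then have "w - v = \<pi> ^ N * (e - e')" "e - e' \<in> R" by (auto simp: algebra_simps intro: diff_closed)
  then show ?thesis by blast
qed

lemma approx_const: "c \<in> R \<Longrightarrow> approx N c (fps_const c)"
proof (cases N)
  case 0
  assume "c \<in> R"
  then show ?thesis using 0 by (auto simp: approx_def trunc_def)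
next
  case (Suc n)
  have "trunc N (fps_const c) = c"
    unfolding Suc trunc_Suc_shift by (simp add: trunc_def)
  then show ?thesis using approx_trunc[of N "fps_const c"] by simp
qed

lemma approx_one: "approx N 1 1"
  using approx_const[OF one_closed] by simp

lemma approx_add:
  assumes "approx N w F" "approx N v G"
  shows "approx N (w + v) (F + G)"
proof -
  obtain e e' where "e \<in> R" "w = trunc N F + \<pi> ^ N * e" "e' \<in> R" "v = trunc N G + \<pi> ^ N * e'"
    using assms by (auto simp: approx_def)
  then have "w + v = trunc N (F + G) + \<pi> ^ N * (e + e')" "e + e' \<in> R"
    by (auto simp: algebra_simps trunc_add intro: add_closed)
  then show ?thesis unfolding approx_def by blast
qed

lemma approx_mult:
  assumes "F \<in> fps_over R" "G \<in> fps_over R" "approx N w F" "approx N v G"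
  shows "approx N (w * v) (F * G)"
proof -
  obtain e e' where e: "e \<in> R" "w = trunc N F + \<pi> ^ N * e" "e' \<in> R" "v = trunc N G + \<pi> ^ N * e'"
    using assms by (auto simp: approx_def)
  obtain e'' where e'': "e'' \<in> R" "trunc N F * trunc N G = trunc N (F * G) + \<pi> ^ N * e''"
    using trunc_mult[OF assms(1,2)] by blast
  have "w * v = trunc N (F * G) + \<pi> ^ N * (e'' + trunc N F * e' + e * trunc N G + \<pi> ^ N * e * e')"
    unfolding e(2,4) using e''(2) by (simp add: algebra_simps)
  moreover have "e'' + trunc N F * e' + e * trunc N G + \<pi> ^ N * e * e' \<in> R"
    using assms e e'' by (intro add_closed mult_closed trunc_in \<pi>_power_in)
  ultimately show ?thesis unfolding approx_def by blast
qed

lemma approx_power: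
  assumes "F \<in> fps_over R" "approx N w F"
  shows "approx N (w ^ k) (F ^ k)"
  by (induction k) (auto intro!: approx_one approx_mult assms fps.power_closed)

lemma approx_one_plus_X: "approx N (1 + \<pi>) (1 + fps_X)"
proof -
  have "trunc (Suc (Suc n)) (1 + fps_X) = 1 + \<pi>" for n
    unfolding trunc_Suc_shift by (simp add: trunc_def)
  moreover have "approx 0 (1 + \<pi>) (1 + fps_X)"
    using add_closed[OF one_closed \<pi>_in] by (auto simp: approx_def trunc_def)
  moreover have "approx (Suc 0) (1 + \<pi>) (1 + fps_X)"
    using one_closed by (auto simp: approx_def trunc_def)
  ultimately show ?thesis using approx_trunc[of N "1 + fps_X"]
    by (metis old.nat.exhaust)
qed

text \<open>\<open>w\<close> times the truncation of \<open>F'\<close> is 1 modulo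
  \<open>\<pi>^N\<close>; multiplying by \<open>w'\<close>, already known to lie in
  \<open>R\<close>, gives the claim.\<close>

lemma approx_inverse:
  assumes "F \<in> fps_over R" "F' \<in> fps_over R" "F * F' = 1" "w' \<in> R" "w * w' = 1" "approx N w F"
  shows "approx N w' F'"
proof -
  have "approx N (w * trunc N F') 1"
    using approx_mult[OF assms(1,2,6) approx_trunc] assms(3) by simp
  then obtain e where e: "e \<in> R" "w * trunc N F' - 1 = \<pi> ^ N * e"
    using approx_unique[OF _ approx_one] by blast
  have "trunc N F' - w' = w' * (w * trunc N F' - 1)"
    using assms(5) by (simp add: algebra_simps)
  then have "w' = trunc N F' + \<pi> ^ N * (- (w' * e))" unfolding e(2) by (simp add: algebra_simps)
  then show ?thesis
    unfolding approx_def using assms(4) e(1) by (blast intro: uminus_closed mult_closed)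
qed

text \<open>For \<open>N > 0\<close>, \<open>w\<close> and the truncation \<open>B\<close> of
  \<open>F\<close> are both 1 modulo \<open>\<pi>\<close>, and their \<open>d\<close>-th powers
  agree modulo \<open>\<pi>^N\<close>. The cofactor of \<open>w - B\<close> in
  \<open>w^d - B^d\<close> is \<open>d\<close> modulo \<open>\<pi>\<close>, and \<open>d\<close> is
  invertible.\<close>

lemma approx_root:
  assumes F: "F \<in> fps_over R" "fps_nth F 0 = 1" and d: "0 < d" "inverse (of_nat d) \<in> R"
    and w: "u \<in> R" "w = 1 + \<pi> * u" and wd: "approx N (w ^ d) (F ^ d)"
  shows "approx N w F"
proof (cases N)
  case 0
  have "w \<in> R" unfolding w(2) by (intro add_closed mult_closed one_closed \<pi>_in w)
  then show ?thesis using 0 by (auto simp: approx_def trunc_def)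
next
  case (Suc M)
  define B where "B = trunc N F"
  have wR: "w \<in> R" unfolding w(2) by (intro add_closed mult_closed one_closed \<pi>_in w)
  have BR: "B \<in> R" unfolding B_def by (rule trunc_in[OF F(1)])
  have "trunc M (fps_shift 1 F) \<in> R" using F by (intro trunc_in) (simp add: fps_over_def)
  then obtain v where v: "v \<in> R" "B = 1 + \<pi> * v"
    unfolding B_def Suc trunc_Suc_shift F(2) by blast
  have pow: "\<exists>e\<in>R. (1 + \<pi> * x) ^ k = 1 + \<pi> * e" if "x \<in> R" for x k
  proof (induction k)
    case 0
    show ?case using zero_closed by force
  next
    case (Suc k)
    then obtain e where e: "e \<in> R" "(1 + \<pi> * x) ^ k = 1 + \<pi> * e" by blast
    have "(1 + \<pi> * x) ^ Suc k = 1 + \<pi> * (x + e + \<pi> * x * e)" by (simp add: e(2) algebra_simps)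
    then show ?case using that e(1) \<pi>_in by (blast intro: add_closed mult_closed)
  qed
  let ?Q = "\<lambda>k. \<Sum>i<k. B ^ (d - Suc i) * w ^ i"
  have "\<exists>q\<in>R. ?Q k = of_nat k + \<pi> * q" for k
  proof (induction k)
    case 0
    show ?case using zero_closed by force
  next
    case (Suc k)
    then obtain q where q: "q \<in> R" "?Q k = of_nat k + \<pi> * q" by blast
    obtain a b where ab: "a \<in> R" "B ^ (d - Suc k) = 1 + \<pi> * a" "b \<in> R" "w ^ k = 1 + \<pi> * b"
      using pow[OF v(1)] pow[OF w(1)] unfolding v(2) w(2) by blast
    have "?Q (Suc k) = of_nat (Suc k) + \<pi> * (q + a + b + \<pi> * a * b)"
      unfolding sum.lessThan_Suc q(2) ab by (simp add: algebra_simps)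
    then show ?case using q ab \<pi>_in by (blast intro: add_closed mult_closed)
  qed
  then obtain q where q: "q \<in> R" "?Q d = of_nat d + \<pi> * q" by blast
  have "approx N (B ^ d) (F ^ d)" unfolding B_def by (intro approx_power F approx_trunc)
  then obtain t where t: "t \<in> R" "w ^ d - B ^ d = \<pi> ^ N * t" using approx_unique[OF wd] by blast
  have "(w - B) * (of_nat d + \<pi> * q) = \<pi> ^ N * t"
    unfolding q(2)[symmetric] t(2)[symmetric] by (rule power_diff_sumr2[symmetric])
  then have "of_nat d * (w - B) = \<pi> ^ N * t - \<pi> * q * (w - B)" by (simp add: algebra_simps)
  then have eq: "w - B = inverse (of_nat d) * (\<pi> ^ N * t - \<pi> * q * (w - B))"
    using d(1) by (simp add: field_simps)
  \<comment> \<open>\<open>of_nat d + \<pi> * q\<close> need not be invertible in \<open>R\<close>.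
    Instead \<open>eq\<close> is iterated, each pass gaining one factor \<open>\<pi>\<close> in
    \<open>w - B\<close>.\<close>
  have "\<exists>e\<in>R. w - B = \<pi> ^ j * e" if "j \<le> N" for j
    using that
  proof (induction j)
    case 0
    show ?case using diff_closed[OF wR BR] by auto
  next
    case (Suc j)
    then obtain e where e: "e \<in> R" "w - B = \<pi> ^ j * e" by auto
    have "\<pi> ^ N = \<pi> ^ Suc j * \<pi> ^ (N - Suc j)"
      unfolding power_add[symmetric] using Suc.prems by simp
    then have "w - B = \<pi> ^ Suc j * (inverse (of_nat d) * (\<pi> ^ (N - Suc j) * t - q * e))"
      by (subst eq) (simp add: e(2) algebra_simps)
    moreover have "inverse (of_nat d) * (\<pi> ^ (N - Suc j) * t - q * e) \<in> R"
      by (intro mult_closed diff_closed \<pi>_power_in d t q e)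
    ultimately show ?case by blast
  qed
  then obtain e where "e \<in> R" "w - B = \<pi> ^ N * e" by blast
  then show ?thesis unfolding approx_def B_def by (intro bexI[of _ e]) (simp_all add: algebra_simps)
qed

end

section \<open>Roots of unity of prime order\<close>

lemma Z_localized_iff:
  assumes "prime r"
  shows "a \<in> Z_localized r \<longleftrightarrow> (\<exists>m n. a * of_int n = of_int m \<and> \<not> int r dvd n)"
proof
  obtain p q where pq: "quotient_of a = (p, q)" by fastforce
  have q: "a * of_int q = of_int p"
    using quotient_of_div[OF pq] quotient_of_denom_pos[OF pq] by simp
  show "\<exists>m n. a * of_int n = of_int m \<and> \<not> int r dvd n" if "a \<in> Z_localized r"
    using that q unfolding Z_localized_def pq mem_Collect_eq snd_conv pq by blast
  show "a \<in> Z_localized r" if ex: "\<exists>m n. a * of_int n = of_int m \<and> \<not> int r dvd n"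
  proof -
    obtain m n where mn: "a * of_int n = of_int m" "\<not> int r dvd n" using ex by blast
    have "of_int (p * n) = (a * of_int q) * of_int n" by (simp add: q)
    also have "\<dots> = of_int (m * q)" using mn(1) by (simp add: mult_ac)
    finally have "p * n = m * q" by (simp only: of_int_eq_iff)
    have "\<not> int r dvd q"
    proof
      assume *: "int r dvd q"
      then have "int r dvd p * n" using \<open>p * n = m * q\<close> by simp
      then have "int r dvd p" using mn(2) assms prime_dvd_mult_iff[of "int r"] by auto
      with * have "is_unit (int r)" using quotient_of_coprime[OF pq] coprime_common_divisor by blast
      then show False using prime_gt_1_nat[OF assms] by simp
    qed
    then show ?thesis by (simp add: Z_localized_def pq)
  qed
qed

lemma root_order_prime:
  fixes \<xi> :: complex
  assumes "prime r" "\<xi> ^ r = 1" "\<xi> \<noteq> 1"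
  shows "root_order \<xi> = r"
proof -
  have "0 < r" using assms(1) prime_gt_0_nat by blast
  note o = root_order_dvd[OF this assms(2)]
  have "root_order \<xi> \<noteq> 1" using o(2) assms(3) by auto
  then show ?thesis using o(3) assms(1) by (auto simp: prime_nat_iff)
qed

lemma cis_root:
  assumes "2 \<le> r"
  shows "cis (2 * pi / real r) ^ r = 1" "cis (2 * pi / real r) \<noteq> 1"
proof -
  show "cis (2 * pi / real r) ^ r = 1" using assms unfolding Complex.DeMoivre by simp
  show "cis (2 * pi / real r) \<noteq> 1"
  proof
    assume "cis (2 * pi / real r) = 1"
    then obtain n :: int where "2 * pi / real r = of_int n * (2 * pi)" by (auto simp: cis_eq_1_iff)
    then have "of_int n * real r = 1" using assms by (simp add: field_simps)
    then have "n * int r = 1" by (metis of_int_eq_1_iff of_int_mult of_int_of_nat_eq)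
    then show False using assms zmult_eq_1_iff[of n "int r"] by auto
  qed
qed

lemma power_int_root_of_unity:
  fixes \<xi> :: complex
  assumes "0 < r" "\<xi> ^ r = 1"
  shows "\<xi> powi b = \<xi> ^ nat (b mod int r)"
proof -
  have "\<xi> \<noteq> 0" using assms by (auto simp: power_0_left split: if_splits)
  have "\<xi> powi b = \<xi> powi (int r * (b div int r) + b mod int r)" by simp
  also have "\<dots> = (\<xi> powi int r) powi (b div int r) * \<xi> powi (b mod int r)"
    by (simp only: power_int_add[OF disjI1[OF \<open>\<xi> \<noteq> 0\<close>]] power_int_mult)
  also have "\<xi> powi int r = 1" using assms by simp
  also have "\<xi> powi (b mod int r) = \<xi> ^ nat (b mod int r)"
    using assms(1) by (simp add: power_int_def)
  finally show ?thesis by simp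
qed

text \<open>A Bezout inverse of \<open>h\<close> modulo \<open>r\<close> witnesses the exponent
  chosen by \<open>SOME\<close>; reduction modulo \<open>r\<close> turns the chosen integer into a
  natural number.\<close>

lemma ev_root:
  fixes \<xi> :: complex
  assumes "0 < r" "\<xi> ^ r = 1" "coprime h r" "0 < h"
  shows "\<exists>b. ev_root h \<xi> = \<xi> ^ b" "ev_root h \<xi> ^ h = \<xi>"
proof -
  obtain x y where xy: "h * x = r * y + 1"
    using bezout_nat[of h r] assms(3,4) coprime_iff_gcd_eq_1 by (metis less_irrefl)
  have "(\<xi> powi int x) ^ h = \<xi> ^ (h * x)" by (simp add: mult.commute flip: power_mult)
  also have "\<dots> = \<xi>" unfolding xy power_add power_mult assms(2) by simp
  finally have "(\<xi> powi (SOME b. (\<xi> powi b) ^ h = \<xi>)) ^ h = \<xi>"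
    by (rule someI[where P = "\<lambda>b. (\<xi> powi b) ^ h = \<xi>"])
  then show "ev_root h \<xi> ^ h = \<xi>" by (simp add: ev_root_def)
  show "\<exists>b. ev_root h \<xi> = \<xi> ^ b"
    unfolding ev_root_def power_int_root_of_unity[OF assms(1,2)] by blast
qed

locale prime_root_of_unity =
  fixes r :: nat and \<xi> :: complex
  assumes prime: "prime r" and root: "\<xi> ^ r = 1" and nontrivial: "\<xi> \<noteq> 1"
begin

abbreviation R :: "complex set" where
  "R \<equiv> Z_localized_adjoin r \<xi>"

lemma \<xi>_in: "\<xi> \<in> R"
  by (auto simp: Z_localized_adjoin_def intro: subring_gen.gen)

lemma r_pos: "0 < r"
  using prime prime_gt_0_nat by blast

sublocale adic_approximation R "\<xi> - 1"
proof -
  interpret unital_subring R unfolding Z_localized_adjoin_def by (rule unital_subring_gen)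
  show "adic_approximation R (\<xi> - 1)"
    by unfold_locales (intro diff_closed \<xi>_in one_closed)
qed

lemma inverse_of_nat_in:
  assumes "\<not> r dvd n"
  shows "inverse (of_nat n) \<in> R"
proof -
  have "inverse (of_nat n) * of_int (int n) = (of_int 1 :: rat)"
    using assms by (cases "n = 0") auto
  moreover have "\<not> int r dvd int n" using assms by simp
  ultimately have "inverse (of_nat n) \<in> Z_localized r"
    unfolding Z_localized_iff[OF prime] by blast
  then have "of_rat (inverse (of_nat n)) \<in> R"
    unfolding Z_localized_adjoin_def by (intro subring_gen.gen) auto
  then show ?thesis by (simp add: of_rat_inverse)
qed

lemma Z_inv_subset:
  assumes "\<not> r dvd d"
  shows "Z_inv d \<subseteq> R"
  unfolding Z_inv_def using inverse_of_nat_in[OF assms]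
  by (intro subring_gen_subset unital_subring_axioms) auto

lemma power_eq_one_plus: "\<exists>u\<in>R. \<xi> ^ b = 1 + (\<xi> - 1) * u"
proof
  show "\<xi> ^ b = 1 + (\<xi> - 1) * (\<Sum>i<b. \<xi> ^ i)"
    using power_diff_1_eq[of \<xi> b] by (simp add: algebra_simps)
  show "(\<Sum>i<b. \<xi> ^ i) \<in> R" by (intro sum_closed power_closed \<xi>_in)
qed

lemma approx_\<xi>: "approx N \<xi> (fps_binomial 1)"
  using approx_one_plus_X[of N] by (simp add: fps_binomial_1)

lemma fps_binomial_one_over: "fps_binomial 1 \<in> fps_over R"
  using zero_closed one_closed by (auto simp: fps_binomial_1 fps_over_def fps_X_def)

lemma approx_\<xi>_root:
  assumes "0 < h" "\<not> r dvd h" "(\<xi> ^ b) ^ h = \<xi>"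
  shows "fps_binomial (1 / of_nat h) \<in> fps_over R" "approx N (\<xi> ^ b) (fps_binomial (1 / of_nat h))"
proof -
  have p: "fps_binomial (1 / of_nat h) ^ h = (fps_binomial 1 :: complex fps)"
    using assms(1) by (rule fps_binomial_power_eq)
  show F: "fps_binomial (1 / of_nat h) \<in> fps_over R"
  proof (rule fps_over_root[OF unital_subring_axioms assms(1) inverse_of_nat_in[OF assms(2)]])
    show "(of_nat h :: complex) \<noteq> 0" using assms(1) by simp
    show "fps_binomial (1 / of_nat h) ^ h \<in> fps_over R" unfolding p by (rule fps_binomial_one_over)
  qed (rule fps_binomial_nth_0)
  obtain u where u: "u \<in> R" "\<xi> ^ b = 1 + (\<xi> - 1) * u" using power_eq_one_plus by blast
  show "approx N (\<xi> ^ b) (fps_binomial (1 / of_nat h))"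
    by (rule approx_root[OF F fps_binomial_nth_0 assms(1) inverse_of_nat_in[OF assms(2)] u])
      (simp only: p assms(3) approx_\<xi>)
qed

lemma approx_poly:
  assumes d: "0 < d" "\<not> r dvd d" and b: "(\<xi> ^ b) ^ d = \<xi>" and p: "p \<in> polys_over (rat_Z_inv d)"
  shows "taylor1 d (to_fract p) \<in> fps_over R" "approx N (poly_at (\<xi> ^ b) p) (taylor1 d (to_fract p))"
proof -
  note over = taylor1_to_fract_over_Z_inv[OF d(1)]
  have sub: "fps_over (Z_inv d) \<subseteq> fps_over R" using Z_inv_subset[OF d(2)] by (auto simp: fps_over_def)
  show "taylor1 d (to_fract p) \<in> fps_over R" using over[OF p] sub by blast
  show "approx N (poly_at (\<xi> ^ b) p) (taylor1 d (to_fract p))"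
    using p
  proof (induction p)
    case 0
    show ?case using approx_const[OF zero_closed, of N] taylor1_const[of d 0] by simp
  next
    case (pCons a p)
    have ap: "a \<in> rat_Z_inv d" "p \<in> polys_over (rat_Z_inv d)"
      using pCons.prems by (auto simp: polys_over_def coeff_pCons split: nat.splits)
    have "to_fract (pCons a p) = to_fract ([:a:] + [:0, 1:] * p)" by simp
    also have "\<dots> = to_fract [:a:] + qroot * to_fract p"
      unfolding qroot_def to_fract_add to_fract_mult ..
    finally have t: "taylor1 d (to_fract (pCons a p)) =
        fps_const (of_rat a) + fps_binomial (1 / of_nat d) * taylor1 d (to_fract p)"
      by (simp only: taylor1_add taylor1_mult regular_at_mult to_fract_regular_at qroot_regular_at
          taylor1_const taylor1_qroot)
    have "of_rat a \<in> R" using of_rat_in_Z_inv[OF ap(1)] Z_inv_subset[OF d(2)] by blast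
    then show ?case
      unfolding t poly_at_simps using over[OF ap(2)] sub
      by (intro approx_add approx_const approx_mult approx_\<xi>_root[OF d b] pCons.IH[OF ap(2)]) blast+
  qed
qed

text \<open>Two decompositions are used: modulo \<open>x^r - 1\<close>, which vanishes at
  \<open>?\<eta>\<close>, to see that values of \<open>Lambda d\<close> at \<open>?\<eta>\<close>
  lie in \<open>R\<close>; and modulo \<open>(x - 1)^N\<close> for the approximation.\<close>

lemma approx_Lambda:
  assumes d: "0 < d" "\<not> r dvd d" and b: "(\<xi> ^ b) ^ d = \<xi>" and c: "c \<in> Lambda d"
  shows "approx N (eval_ratfun c (\<xi> ^ b)) (taylor1 d c)"
proof -
  let ?\<eta> = "\<xi> ^ b"
  have cop: "coprime r d" using prime_imp_coprime[OF prime d(2)] .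
  have \<eta>r: "?\<eta> ^ r = 1" using root by (metis power_mult mult.commute power_one)
  have reg: "g \<in> regular_at ?\<eta>" if "g \<in> Lambda d" for g
    by (rule Lambda_regular_at[OF d(1) r_pos cop \<eta>r that])
  have eval_y: "eval_ratfun (qroot ^ s - 1) ?\<eta> = ?\<eta> ^ s - 1" for s
  proof -
    have "qroot ^ s - 1 = to_fract (monom 1 s - 1)" by (simp add: to_fract_monom)
    then show ?thesis by (simp only: eval_ratfun_to_fract poly_at_simps)
  qed
  have eval_decomp: "eval_ratfun (to_fract p + (qroot ^ s - 1) ^ k * g) ?\<eta> =
      poly_at ?\<eta> p + (?\<eta> ^ s - 1) ^ k * eval_ratfun g ?\<eta>" if "g \<in> Lambda d" for p s k g
  proof -
    have y: "(qroot ^ s - 1) ^ k \<in> regular_at ?\<eta>"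
      by (intro regular_at_power qroot_minus_one_regular_at)
    have "eval_ratfun ((qroot ^ s - 1) ^ k) ?\<eta> = (?\<eta> ^ s - 1) ^ k"
      by (induction k) (simp_all add: eval_ratfun_mult regular_at_power qroot_minus_one_regular_at
          eval_y eval_ratfun_to_fract[of 1, simplified])
    moreover have "to_fract p + (qroot ^ s - 1) ^ k * g = to_fract p - (to_fract 0 - (qroot ^ s - 1) ^ k * g)"
      by simp
    ultimately show ?thesis
      using reg[OF that] y
      by (simp only: eval_ratfun_diff eval_ratfun_mult regular_at_diff regular_at_mult
          to_fract_regular_at eval_ratfun_to_fract poly_at_simps) simp
  qed
  have eval_in: "eval_ratfun g ?\<eta> \<in> R" if g: "g \<in> Lambda d" for g
  proof -
    obtain p g' where "p \<in> polys_over (rat_Z_inv d)" "g' \<in> Lambda d"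
      "g = to_fract p + (qroot ^ r - 1) ^ 1 * g'"
      using Lambda_decomp[OF d(1) r_pos cop g] by blast
    then have "eval_ratfun g ?\<eta> = poly_at ?\<eta> p"
      using eval_decomp[of g' p r 1] by (simp add: \<eta>r)
    then show ?thesis
      using approx_in[OF approx_poly[OF d b \<open>p \<in> polys_over _\<close>]] by simp
  qed
  obtain p g where pg: "p \<in> polys_over (rat_Z_inv d)" "g \<in> Lambda d"
    "c = to_fract p + (qroot ^ 1 - 1) ^ N * g"
    using Lambda_decomp[OF d(1) _ _ c, of 1 N] by auto
  obtain u where u: "u \<in> R" "?\<eta> = 1 + (\<xi> - 1) * u" using power_eq_one_plus by blast
  \<comment> \<open>\<open>?\<eta> - 1\<close> is a multiple of \<open>\<xi> - 1\<close>, so the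
    second summand is a multiple of its \<open>N\<close>-th power.\<close>
  have "eval_ratfun c ?\<eta> = poly_at ?\<eta> p + (\<xi> - 1) ^ N * (u ^ N * eval_ratfun g ?\<eta>)"
    unfolding pg(3) eval_decomp[OF pg(2)] using u(2) by (simp add: power_mult_distrib mult.assoc)
  moreover have "approx N \<dots> (taylor1 d (to_fract p))"
    by (intro approx_shift approx_poly[OF d b pg(1)] mult_closed power_closed u eval_in pg)
  moreover have "fps_nth (taylor1 d c) n = fps_nth (taylor1 d (to_fract p)) n" if "n < N" for n
    using taylor1_decomp[OF d(1) pg(2) to_fract_regular_at that, of p] pg(3) by simp
  ultimately show ?thesis using approx_cong by metis
qed

text \<open>The exponent \<open>1 - d\<close> is not positive, so both sides are treated as
  \<open>(d - 1)\<close>-th powers of inverse fourth roots; the inverse of \<open>\<xi>^b\<close> is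
  again a power of \<open>\<xi>\<close>.\<close>

lemma approx_ev_root_4:
  assumes "odd r" "0 < d"
  shows "fps_binomial ((1 - of_nat d) / 4) \<in> fps_over R"
    "approx N (ev_root 4 \<xi> powi (1 - int d)) (fps_binomial ((1 - of_nat d) / 4))"
proof -
  have "coprime 4 r" using assms(1) coprime_power_left_iff[of 2 2 r] by simp
  then obtain b where b: "ev_root 4 \<xi> = \<xi> ^ b" "(\<xi> ^ b) ^ 4 = \<xi>"
    using ev_root[OF r_pos root, of 4] by auto
  have r4: "\<not> r dvd 4"
  proof
    assume "r dvd 4"
    then have "r dvd 2" using prime prime_dvd_power[of r 2 2] by simp
    then have "r = 2" using prime two_is_prime_nat primes_dvd_imp_eq by blast
    then show False using assms(1) by simp
  qed
  note F = approx_\<xi>_root[OF _ r4 b(2), simplified]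
  let ?w = "\<xi> ^ b" and ?w' = "\<xi> ^ (b * (r - 1))"
  have "?w * ?w' = ?w ^ Suc (r - 1)" by (simp only: power_mult power_Suc)
  also have "\<dots> = (\<xi> ^ r) ^ b" using r_pos by (simp add: mult.commute flip: power_mult)
  finally have ww': "?w * ?w' = 1" using root by simp
  let ?F = "fps_binomial (1 / 4) :: complex fps" and ?F' = "fps_binomial (- 1 / 4) :: complex fps"
  have FF': "?F * ?F' = 1" by (simp flip: fps_binomial_add_mult)
  have "?F' ^ 4 = inverse (1 + fps_X)"
    using fps_binomial_power[of "- 1 / 4 :: complex" 4] by (simp add: fps_binomial_minus_one)
  also have "\<dots> \<in> fps_over R"
    unfolding fps_inverse_fps_X_plus1 fps_over_def
    by (auto intro!: power_closed uminus_closed one_closed)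
  finally have F': "?F' \<in> fps_over R"
    using inverse_of_nat_in[OF r4]
    by (intro fps_over_root[OF unital_subring_axioms, of 4 ?F']) (simp_all only: fps_binomial_nth_0, simp_all)
  have aF': "approx N ?w' ?F'"
    by (rule approx_inverse[OF F(1) F' FF' _ ww' F(2)]) (intro power_closed \<xi>_in)
  have "(1 - of_nat d) / 4 = of_nat (d - 1) * (- 1 / 4 :: complex)"
    using assms(2) by (simp add: field_simps)
  then have "fps_binomial ((1 - of_nat d) / 4) = ?F' ^ (d - 1)" by (simp only: fps_binomial_power)
  moreover have "ev_root 4 \<xi> powi (1 - int d) = ?w' ^ (d - 1)"
  proof -
    have "1 - int d = - int (d - 1)" using assms(2) by simp
    then have "?w powi (1 - int d) = inverse ?w ^ (d - 1)"
      by (simp only: power_int_minus power_int_of_nat power_inverse)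
    also have "inverse ?w = ?w'" using ww' by (rule inverse_unique)
    finally show ?thesis unfolding b(1) .
  qed
  ultimately show "fps_binomial ((1 - of_nat d) / 4) \<in> fps_over R"
    "approx N (ev_root 4 \<xi> powi (1 - int d)) (fps_binomial ((1 - of_nat d) / 4))"
    using fps.power_closed[OF F'] approx_power[OF F' aF'] by auto
qed

text \<open>The bound \<open>N \<le> r\<close> comes from \<open>hat_ev\<close>: it evaluates a
  representative of index \<open>r\<close>, whose Taylor coefficients are known to agree with
  \<open>hat_taylor1\<close> only below \<open>r\<close>.\<close>

lemma approx_normalized_taylor1:
  assumes "odd r" "0 < d" "\<not> r dvd d" "I \<in> hat_Lambda d" "N \<le> r"
  shows "normalized_taylor1 d I \<in> fps_over R"
    "approx N (ev_root 4 \<xi> powi (1 - int d) * hat_ev d \<xi> I) (normalized_taylor1 d I)"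
proof -
  have "coprime d r" using prime_imp_coprime[OF prime assms(3)] by (simp add: coprime_commute)
  then obtain b where b: "ev_root d \<xi> = \<xi> ^ b" "(\<xi> ^ b) ^ d = \<xi>"
    using ev_root[OF r_pos root _ assms(2)] by auto
  define a where "a = (SOME a. a \<in> I r)"
  have a: "a \<in> I r" unfolding a_def using hat_Lambda_nonempty[OF assms(4)] by (rule someI_ex)
  have ev: "hat_ev d \<xi> I = eval_ratfun a (\<xi> ^ b)"
    unfolding hat_ev_def root_order_prime[OF prime root nontrivial] a_def b(1) ..
  have "approx N (hat_ev d \<xi> I) (hat_taylor1 d I)"
    unfolding ev
    by (rule approx_cong[OF approx_Lambda[OF assms(2,3) b(2) hat_Lambda_mem(1)[OF assms(4) a]]])
      (use hat_taylor1_nth[OF assms(2,4) a] assms(5) in auto)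
  moreover have "hat_taylor1 d I \<in> fps_over R"
    using hat_taylor1_over_Z_inv[OF assms(2,4)] Z_inv_subset[OF assms(3)] by (auto simp: fps_over_def)
  ultimately show "normalized_taylor1 d I \<in> fps_over R"
    "approx N (ev_root 4 \<xi> powi (1 - int d) * hat_ev d \<xi> I) (normalized_taylor1 d I)"
    unfolding normalized_taylor1_def using approx_ev_root_4[OF assms(1,2)]
    by (simp_all add: fps.mult_closed approx_mult)
qed

end

text \<open>Lets the Jacobi symbol in the Ohtsuki congruence cancel the one in the unified
  invariant.\<close>

lemma Jacobi_prime_square:
  assumes "prime r" "\<not> r dvd d"
  shows "Jacobi d r * Jacobi d r = 1"
proof -
  have "\<not> [int d = 0] (mod int r)" using assms(2) by (simp add: cong_0_iff)
  then show ?thesis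
    using assms(1) by (simp add: Jacobi_def prime_factorization_prime Legendre_def)
qed

lemma Rats_sum: "(\<And>i. i \<in> A \<Longrightarrow> f i \<in> \<rat>) \<Longrightarrow> sum f A \<in> \<rat>"
  by (induction A rule: infinite_finite_induct) auto

lemma normalized_taylor1_Rats:
  assumes "0 < d" "I \<in> hat_Lambda d"
  shows "fps_nth (normalized_taylor1 d I) n \<in> \<rat>"
proof -
  have "((1 - of_nat d) / 4 :: complex) gchoose i \<in> \<rat>" for i
    unfolding gbinomial_prod_rev by (intro Rats_divide) (induction i; auto)+
  then show ?thesis
    unfolding normalized_taylor1_def fps_mult_nth
    using hat_taylor1_over_Z_inv[OF assms] Z_inv_subset_Rats by (intro Rats_sum Rats_mult) auto
qed

lemma is_Ohtsuki_series_normalized_taylor1: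
  assumes "0 < d" "H1_order X = d" "is_unified_invariant X \<mu> I"
  shows "is_Ohtsuki_series X \<mu> (normalized_taylor1 d I)"
  unfolding is_Ohtsuki_series_def
proof (intro conjI allI)
  have I: "I \<in> hat_Lambda d" using assms by (simp add: is_unified_invariant_def Let_def)
  show "fps_nth (normalized_taylor1 d I) n \<in> \<rat>" for n
    by (rule normalized_taylor1_Rats[OF assms(1) I])
  fix N
  show "\<exists>R. \<forall>r\<ge>R. prime r \<longrightarrow> (let \<xi> = cis (2 * pi / real r) in
      cong_in (Z_localized_adjoin r \<xi>) (of_int (Jacobi (H1_order X) r) * tau X \<mu> \<xi>)
        (\<Sum>n\<le>N. fps_nth (normalized_taylor1 d I) n * (\<xi> - 1) ^ n) ((\<xi> - 1) ^ (N + 1)))"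
  proof (intro exI[of _ "d + N + 3"] allI impI)
    \<comment> \<open>Such an \<open>r\<close> is odd, does not divide the smaller \<open>d\<close>,
      and satisfies the bound \<open>Suc N \<le> r\<close> of
      \<open>approx_normalized_taylor1\<close>.\<close>
    fix r assume r: "d + N + 3 \<le> r" "prime r"
    define \<xi> where "\<xi> = cis (2 * pi / real r)"
    have \<xi>: "\<xi> ^ r = 1" "\<xi> \<noteq> 1" using cis_root[of r] r(1) by (auto simp: \<xi>_def)
    interpret prime_root_of_unity r \<xi> by unfold_locales (use r \<xi> in auto)
    have odd: "odd r" using r prime_odd_nat by auto
    have rd: "\<not> r dvd d" using r assms(1) by (auto dest: dvd_imp_le)
    have ord: "root_order \<xi> = r" by (rule root_order_prime[OF r(2) \<xi>])
    have "\<xi> \<in> U_set d"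
      unfolding U_set_def mem_Collect_eq ord
      using odd \<xi>(1) r_pos prime_imp_coprime[OF r(2) rd] by blast
    then have "tau X \<mu> \<xi> = of_int (Jacobi d r) * ev_root 4 \<xi> powi (1 - int d) * hat_ev d \<xi> I"
      using assms(2,3) \<xi>(2) by (simp add: is_unified_invariant_def Let_def ord)
    then have "of_int (Jacobi d r) * tau X \<mu> \<xi> =
        of_int (Jacobi d r * Jacobi d r) * (ev_root 4 \<xi> powi (1 - int d) * hat_ev d \<xi> I)"
      by (simp only: of_int_mult mult.assoc)
    then have tau: "of_int (Jacobi d r) * tau X \<mu> \<xi> = ev_root 4 \<xi> powi (1 - int d) * hat_ev d \<xi> I"
      by (simp add: Jacobi_prime_square[OF r(2) rd])
    note A = approx_normalized_taylor1[OF odd assms(1) rd I, of "Suc N"]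
    have a: "approx (Suc N) (of_int (Jacobi d r) * tau X \<mu> \<xi>) (normalized_taylor1 d I)"
      unfolding tau using A(2) r(1) by simp
    have over: "normalized_taylor1 d I \<in> fps_over R" using A(1) r(1) by simp
    have tr: "trunc (Suc N) (normalized_taylor1 d I) =
        (\<Sum>n\<le>N. fps_nth (normalized_taylor1 d I) n * (\<xi> - 1) ^ n)"
      by (simp add: trunc_def lessThan_Suc_atMost)
    have "cong_in R (of_int (Jacobi d r) * tau X \<mu> \<xi>)
        (\<Sum>n\<le>N. fps_nth (normalized_taylor1 d I) n * (\<xi> - 1) ^ n) ((\<xi> - 1) ^ (N + 1))"
      unfolding cong_in_def
      using approx_in[OF over a] trunc_in[OF over, of "Suc N"] a
      by (auto simp: tr approx_def)
    then show "let \<xi> = cis (2 * pi / real r) in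
      cong_in (Z_localized_adjoin r \<xi>) (of_int (Jacobi (H1_order X) r) * tau X \<mu> \<xi>)
        (\<Sum>n\<le>N. fps_nth (normalized_taylor1 d I) n * (\<xi> - 1) ^ n) ((\<xi> - 1) ^ (N + 1))"
      by (simp only: Let_def \<xi>_def assms(2))
  qed
qed

section \<open>Uniqueness of the Ohtsuki series\<close>

definition int_poly_at :: "complex \<Rightarrow> int poly \<Rightarrow> complex" where
  "int_poly_at z p = poly (map_poly of_int p) z"

lemma int_poly_at_simps [simp]:
  "int_poly_at z 0 = 0"
  "int_poly_at z (pCons a p) = of_int a + z * int_poly_at z p"
  by (simp_all add: int_poly_at_def of_int_hom.map_poly_pCons_hom)

lemma int_poly_at_add [simp]: "int_poly_at z (p + q) = int_poly_at z p + int_poly_at z q"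
proof -
  have "map_poly of_int (p + q) = (map_poly of_int p + map_poly of_int q :: complex poly)"
    by (simp add: poly_eq_iff coeff_map_poly)
  then show ?thesis by (simp add: int_poly_at_def)
qed

lemma int_poly_at_mult [simp]: "int_poly_at z (p * q) = int_poly_at z p * int_poly_at z q"
proof -
  have "map_poly of_int (p * q) = (map_poly of_int p * map_poly of_int q :: complex poly)"
    by (simp add: poly_eq_iff coeff_map_poly coeff_mult)
  then show ?thesis by (simp add: int_poly_at_def)
qed

lemma int_poly_at_diff [simp]: "int_poly_at z (p - q) = int_poly_at z p - int_poly_at z q"
  using int_poly_at_add[of z "p - q" q] by simp

lemma int_poly_at_one [simp]: "int_poly_at z 1 = 1"
  by (simp add: one_pCons)

lemma int_poly_at_smult [simp]: "int_poly_at z (smult a p) = of_int a * int_poly_at z p"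
  using int_poly_at_mult[of z "[:a:]" p] by simp

lemma int_poly_at_power [simp]: "int_poly_at z (p ^ n) = int_poly_at z p ^ n"
  by (induction n) simp_all

text \<open>A primitive integer polynomial of least degree vanishing at \<open>z\<close>; by Gauss's lemma it
  divides all the others over the integers.\<close>

lemma exists_primitive_annihilator:
  assumes "G \<noteq> 0" "int_poly_at z G = 0"
  shows "\<exists>K. 0 < degree K \<and> (\<forall>H. int_poly_at z H = 0 \<longrightarrow> K dvd H)"
proof -
  obtain M where M: "M \<noteq> 0" "int_poly_at z M = 0"
    and min: "\<And>p. p \<noteq> 0 \<Longrightarrow> int_poly_at z p = 0 \<Longrightarrow> degree M \<le> degree p"
    using ex_has_least_nat[of "\<lambda>p. p \<noteq> 0 \<and> int_poly_at z p = 0" G degree] assms by blast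
  define K where "K = primitive_part M"
  have MK: "M = smult (content M) K" by (simp add: K_def)
  have cM: "content M \<noteq> 0" using M(1) by simp
  have "of_int (content M) * int_poly_at z K = 0"
    using M(2) MK int_poly_at_smult[of z "content M" K] by simp
  then have K0: "int_poly_at z K = 0" using cM by simp
  have K: "K \<noteq> 0" using M(1) MK by auto
  have dK: "degree K = degree M" using MK cM by (metis degree_smult_eq)
  have "0 < degree K"
  proof (rule ccontr)
    assume "\<not> 0 < degree K"
    then obtain c where "K = [:c:]" by (metis degree_eq_zeroE neq0_conv)
    then show False using K K0 by simp
  qed
  moreover have "K dvd H" if "int_poly_at z H = 0" for H
  proof -
    \<comment> \<open>Pseudo-division stays over the integers; its remainder vanishes at
      \<open>z\<close> and has degree below the minimum, so it is zero.\<close>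
    obtain a q where aq: "a \<noteq> 0" "smult a H = K * q + pseudo_mod H K"
      using pseudo_mod(1)[OF K, of H] by blast
    have "int_poly_at z (pseudo_mod H K) = int_poly_at z (smult a H) - int_poly_at z (K * q)"
      unfolding aq(2) by simp
    then have "int_poly_at z (pseudo_mod H K) = 0" using that K0 by simp
    then have "pseudo_mod H K = 0"
      using pseudo_mod(2)[OF K, of H] min[of "pseudo_mod H K"] dK by (metis not_less)
    then have eq: "smult a H = K * q" using aq(2) by simp
    have "content K = 1" unfolding K_def using M(1) by simp
    \<comment> \<open>Contents multiply and \<open>K\<close> has content 1, so \<open>a\<close>
      divides the content of \<open>q\<close> and can be cancelled.\<close>
    then have "content q = normalize a * content H"
      using arg_cong[OF eq, of content] by (simp add: content_mult)
    then have "[:a:] dvd q" by (simp add: const_poly_dvd_iff_dvd_content)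
    then obtain q' where "q = [:a:] * q'" by (elim dvdE)
    then have "smult a H = smult a (K * q')" using eq by simp
    then have "H = K * q'" using aq(1) by (metis smult_cancel)
    then show ?thesis by simp
  qed
  ultimately show ?thesis by blast
qed

lemma coeff_one_plus_X_power: "coeff ([:1, 1:] ^ n :: int poly) i = int (n choose i)"
proof (cases "i \<le> n")
  case True
  then show ?thesis by (simp add: coeff_linear_poly_power)
next
  case False
  then show ?thesis by (simp add: coeff_eq_0 degree_linear_power)
qed

lemma pcompose_power_eq: "pcompose (p ^ n) q = pcompose p q ^ n"
  for p q :: "'a::comm_semiring_1 poly"
  by (induction n) (simp_all add: pcompose_mult pcompose_1)

context prime_root_of_unity
begin

text \<open>Eisenstein's argument after the substitution of \<open>x + 1\<close> for \<open>x\<close>.\<close>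

lemma prime_dvd_poly_1:
  assumes "int_poly_at \<xi> G = 0"
  shows "int r dvd poly G 1"
proof -
  let ?x = "[:0, 1:] :: int poly"
  define \<Psi> where "\<Psi> = (\<Sum>i<r. ?x ^ i)"
  have x\<Psi>: "(?x - 1) * \<Psi> = ?x ^ r - 1" unfolding \<Psi>_def by (rule power_diff_1_eq[symmetric])
  have "(\<xi> - 1) * int_poly_at \<xi> \<Psi> = int_poly_at \<xi> ((?x - 1) * \<Psi>)"
    unfolding int_poly_at_mult by simp
  also have "\<dots> = 0" unfolding x\<Psi> using root by simp
  finally have \<Psi>0: "int_poly_at \<xi> \<Psi> = 0" using nontrivial by simp
  have "poly (?x ^ r - 1) 0 \<noteq> 0" using r_pos by (simp add: poly_power power_0_left)
  then have "?x ^ r - 1 \<noteq> 0" by (metis poly_0)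
  then have "\<Psi> \<noteq> 0" using x\<Psi> by auto
  then obtain K where K: "0 < degree K" "\<And>H. int_poly_at \<xi> H = 0 \<Longrightarrow> K dvd H"
    using exists_primitive_annihilator[OF _ \<Psi>0] by blast
  \<comment> \<open>The argument runs on this factorisation and shows that \<open>r\<close> divides
    \<open>poly K 1\<close>; as \<open>K\<close> divides \<open>G\<close>, the claim
    follows.\<close>
  obtain L where L: "\<Psi> = K * L" using K(2)[OF \<Psi>0] by (elim dvdE)
  define \<psi> k l where "\<psi> = pcompose \<Psi> [:1, 1:]" and "k = pcompose K [:1, 1:]" and "l = pcompose L [:1, 1:]"
  have \<psi>: "\<psi> = k * l" by (simp add: \<psi>_def k_def l_def L pcompose_mult)
  have "pcompose ((?x - 1) * \<Psi>) [:1, 1:] = pcompose (?x ^ r - 1) [:1, 1:]" unfolding x\<Psi> ..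
  then have "([:1, 1:] - 1) * \<psi> = [:1, 1:] ^ r - 1"
    by (simp add: \<psi>_def pcompose_mult pcompose_diff pcompose_power_eq pcompose_pCons pcompose_1)
  moreover have "[:1, 1:] - 1 = [:0, 1 :: int:]" by (simp add: one_pCons)
  ultimately have x\<psi>: "pCons 0 \<psi> = [:1, 1:] ^ r - 1" by simp
  have coeff: "coeff \<psi> i = int (r choose Suc i)" for i
  proof -
    have "coeff \<psi> i = coeff (pCons 0 \<psi>) (Suc i)" by simp
    also have "\<dots> = int (r choose Suc i)" unfolding x\<psi> by (simp add: coeff_one_plus_X_power)
    finally show ?thesis .
  qed
  have nz: "\<psi> \<noteq> 0" "k \<noteq> 0" "l \<noteq> 0"
  proof -
    have "coeff \<psi> (r - 1) = 1" using r_pos by (simp add: coeff)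
    then show "\<psi> \<noteq> 0" by auto
    then show "k \<noteq> 0" "l \<noteq> 0" using \<psi> by auto
  qed
  have deg: "degree \<psi> = r - 1"
  proof (rule antisym)
    show "degree \<psi> \<le> r - 1"
      using r_pos by (intro degree_le) (auto simp: coeff binomial_eq_0)
    show "r - 1 \<le> degree \<psi>" using r_pos by (intro le_degree) (simp add: coeff)
  qed
  have "0 < degree k" using K(1) by (simp add: k_def degree_pcompose)
  \<comment> \<open>\<open>K\<close> is not constant, so the index \<open>i\<close> found below
    stays under \<open>r - 1\<close>, where the coefficient \<open>r choose Suc i\<close> of
    \<open>\<psi>\<close> is divisible by \<open>r\<close>.\<close>
  then have dl: "degree l < r - 1" using deg nz(2,3) unfolding \<psi> by (simp add: degree_mult_eq)
  have "lead_coeff k * lead_coeff l = 1"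
    unfolding lead_coeff_mult[symmetric] \<psi>[symmetric] deg using r_pos by (simp add: coeff)
  then have "lead_coeff l dvd 1" by (metis dvd_triv_right)
  then have top: "\<not> int r dvd lead_coeff l"
    using prime_gt_1_nat[OF prime] dvd_trans[of "int r" "lead_coeff l" 1] by auto
  \<comment> \<open>In the coefficient of index \<open>i\<close> of \<open>k * l\<close>, every term
    except \<open>coeff k 0 * coeff l i\<close> is divisible by \<open>r\<close>; this forces
    \<open>r\<close> to divide \<open>coeff k 0\<close>.\<close>
  define i where "i = (LEAST i. \<not> int r dvd coeff l i)"
  have i: "\<not> int r dvd coeff l i" unfolding i_def using top by (rule LeastI)
  have below: "int r dvd coeff l j" if "j < i" for j
    using not_less_Least[of j "\<lambda>i. \<not> int r dvd coeff l i"] that unfolding i_def by blast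
  have "i \<le> degree l" using i by (intro le_degree) auto
  then have "Suc i < r" using dl by simp
  then have "int r dvd coeff \<psi> i"
    unfolding coeff using prime by (simp add: dvd_choose_prime)
  also have "coeff \<psi> i = (\<Sum>j\<le>i. coeff k j * coeff l (i - j))" unfolding \<psi> by (rule coeff_mult)
  also have "\<dots> = coeff k 0 * coeff l i + (\<Sum>j\<in>{..i} - {0}. coeff k j * coeff l (i - j))"
    by (subst sum.remove[of _ 0]) auto
  finally have "int r dvd coeff k 0 * coeff l i + (\<Sum>j\<in>{..i} - {0}. coeff k j * coeff l (i - j))" .
  moreover have "int r dvd (\<Sum>j\<in>{..i} - {0}. coeff k j * coeff l (i - j))"
    by (intro dvd_sum dvd_mult below) auto
  ultimately have "int r dvd coeff k 0 * coeff l i" by (simp only: dvd_add_left_iff)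
  then have "int r dvd coeff k 0" using i prime prime_dvd_mult_iff[of "int r"] by auto
  also have "coeff k 0 = poly K 1" by (simp add: k_def poly_pcompose flip: poly_0_coeff_0)
  also have "poly K 1 dvd poly G 1" using K(2)[OF assms] by auto
  finally show ?thesis .
qed

text \<open>The only denominators in \<open>R\<close> are those of \<open>Z_localized r\<close>;
  finitely many of them are cleared by one integer not divisible by the prime
  \<open>r\<close>.\<close>

lemma adjoin_clear_denominator:
  assumes "e \<in> R"
  shows "\<exists>m H. \<not> int r dvd m \<and> of_int m * e = int_poly_at \<xi> H"
proof -
  let ?B = "{e. \<exists>m H. \<not> int r dvd m \<and> of_int m * e = int_poly_at \<xi> H}"
  have "unital_subring ?B"
  proof
    have "\<not> int r dvd 1" using prime_gt_1_nat[OF prime] by simp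
    moreover have "of_int 1 * 1 = int_poly_at \<xi> 1" by simp
    ultimately show "1 \<in> ?B" by blast
    fix a b assume "a \<in> ?B" "b \<in> ?B"
    then obtain m H n H' where a: "\<not> int r dvd m" "of_int m * a = int_poly_at \<xi> H"
      and b: "\<not> int r dvd n" "of_int n * b = int_poly_at \<xi> H'" by blast
    have mn: "\<not> int r dvd m * n" using a b prime prime_dvd_mult_iff[of "int r"] by auto
    have "of_int (m * n) * (a - b) = of_int n * (of_int m * a) - of_int m * (of_int n * b)"
      by (simp add: algebra_simps)
    also have "\<dots> = int_poly_at \<xi> (smult n H - smult m H')" by (simp add: a b)
    finally show "a - b \<in> ?B" using mn by blast
    have "of_int (m * n) * (a * b) = (of_int m * a) * (of_int n * b)" by simp
    also have "\<dots> = int_poly_at \<xi> (H * H')" by (simp add: a b)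
    finally show "a * b \<in> ?B" using mn by blast
  qed
  moreover have "of_rat a \<in> ?B" if a: "a \<in> Z_localized r" for a
  proof -
    obtain m n where mn: "a * of_int n = of_int m" "\<not> int r dvd n"
      using a Z_localized_iff[OF prime] by blast
    have "of_int n * (of_rat a :: complex) = of_rat (a * of_int n)" by (simp add: of_rat_mult)
    also have "\<dots> = int_poly_at \<xi> [:m:]" by (simp add: mn)
    finally show ?thesis using mn(2) by blast
  qed
  moreover have "\<xi> \<in> ?B"
  proof -
    have "of_int 1 * \<xi> = int_poly_at \<xi> [:0, 1:]" "\<not> int r dvd 1"
      using prime_gt_1_nat[OF prime] by simp_all
    then show ?thesis by blast
  qed
  ultimately have "R \<subseteq> ?B" unfolding Z_localized_adjoin_def by (intro subring_gen_subset) auto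
  then show ?thesis using assms by blast
qed

text \<open>The non-unit property of \<open>\<xi> - 1\<close> in the form suited to rational
  coefficients: the numerator is too small to be divisible by \<open>r\<close>, while
  \<open>b\<close> may be any nonzero integer.\<close>

lemma rational_not_multiple:
  assumes "a \<noteq> 0" "\<bar>a\<bar> < int r" "b \<noteq> 0" "e \<in> R"
  shows "of_int a / of_int b \<noteq> (\<xi> - 1) * e"
proof
  assume eq: "of_int a / of_int b = (\<xi> - 1) * e"
  obtain m H where m: "\<not> int r dvd m" "of_int m * e = int_poly_at \<xi> H"
    using adjoin_clear_denominator[OF assms(4)] by blast
  \<comment> \<open>It vanishes at \<open>\<xi>\<close> by \<open>eq\<close>, and at 1 its first
    summand disappears, leaving \<open>- (a * m)\<close>.\<close>
  let ?G = "[:- 1, 1:] * smult b H - [:a * m:]"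
  have "of_int a = (\<xi> - 1) * e * of_int b" using eq assms(3) by (simp add: field_simps)
  then have "of_int a * of_int m = (\<xi> - 1) * of_int b * (of_int m * e)" by (simp add: mult_ac)
  then have "int_poly_at \<xi> ?G = 0" unfolding m(2) by (simp add: algebra_simps)
  then have "int r dvd poly ?G 1" by (rule prime_dvd_poly_1)
  then have "int r dvd a * m" by simp
  then have "int r dvd a" using m(1) prime prime_dvd_mult_iff[of "int r"] by auto
  then show False using assms(1,2) zdvd_imp_le[of "int r" "\<bar>a\<bar>"] by auto
qed

end

text \<open>At the first index where the series differ, dividing the two congruences by
  \<open>(\<xi> - 1)^n\<close> makes one fixed nonzero rational a multiple of
  \<open>\<xi> - 1\<close> for all large primes.\<close>

lemma is_Ohtsuki_series_unique:
  assumes S: "is_Ohtsuki_series X \<mu> S" and S': "is_Ohtsuki_series X \<mu> S'"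
  shows "S = S'"
proof (rule fps_ext)
  fix n
  show "fps_nth S n = fps_nth S' n"
  proof (induction n rule: less_induct)
    case (less n)
    show ?case
    proof (rule ccontr)
      assume ne: "fps_nth S n \<noteq> fps_nth S' n"
      have "fps_nth S n - fps_nth S' n \<in> \<rat>"
        using S S' unfolding is_Ohtsuki_series_def by (intro Rats_diff) blast+
      then obtain a b where ab: "b \<noteq> 0" "fps_nth S n - fps_nth S' n = of_int a / of_int b"
        by (metis Rats_cases' less_irrefl)
      then have "a \<noteq> 0" using ne by auto
      obtain R1 where R1: "\<forall>r\<ge>R1. prime r \<longrightarrow> (let \<xi> = cis (2 * pi / real r) in
          cong_in (Z_localized_adjoin r \<xi>) (of_int (Jacobi (H1_order X) r) * tau X \<mu> \<xi>)
            (\<Sum>i\<le>n. fps_nth S i * (\<xi> - 1) ^ i) ((\<xi> - 1) ^ (n + 1)))"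
        using S unfolding is_Ohtsuki_series_def by blast
      obtain R2 where R2: "\<forall>r\<ge>R2. prime r \<longrightarrow> (let \<xi> = cis (2 * pi / real r) in
          cong_in (Z_localized_adjoin r \<xi>) (of_int (Jacobi (H1_order X) r) * tau X \<mu> \<xi>)
            (\<Sum>i\<le>n. fps_nth S' i * (\<xi> - 1) ^ i) ((\<xi> - 1) ^ (n + 1)))"
        using S' unfolding is_Ohtsuki_series_def by blast
      \<comment> \<open>Beyond both thresholds and beyond the numerator, so that
        \<open>rational_not_multiple\<close> applies.\<close>
      obtain r where r: "prime r" "R1 + R2 + nat \<bar>a\<bar> + 2 < r" using bigger_prime by blast
      define \<xi> where "\<xi> = cis (2 * pi / real r)"
      interpret prime_root_of_unity r \<xi>
        by unfold_locales (use r cis_root[of r] in \<open>auto simp: \<xi>_def\<close>)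
      let ?t = "of_int (Jacobi (H1_order X) r) * tau X \<mu> \<xi>"
      have c1: "cong_in R ?t (\<Sum>i\<le>n. fps_nth S i * (\<xi> - 1) ^ i) ((\<xi> - 1) ^ (n + 1))"
        using R1 r unfolding Let_def \<xi>_def by auto
      have c2: "cong_in R ?t (\<Sum>i\<le>n. fps_nth S' i * (\<xi> - 1) ^ i) ((\<xi> - 1) ^ (n + 1))"
        using R2 r unfolding Let_def \<xi>_def by auto
      obtain c where c: "c \<in> R" "?t - (\<Sum>i\<le>n. fps_nth S i * (\<xi> - 1) ^ i) = (\<xi> - 1) ^ (n + 1) * c"
        using c1 unfolding cong_in_def by blast
      obtain c' where c': "c' \<in> R" "?t - (\<Sum>i\<le>n. fps_nth S' i * (\<xi> - 1) ^ i) = (\<xi> - 1) ^ (n + 1) * c'"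
        using c2 unfolding cong_in_def by blast
      have "(\<Sum>i\<le>n. fps_nth S i * (\<xi> - 1) ^ i) - (\<Sum>i\<le>n. fps_nth S' i * (\<xi> - 1) ^ i) =
          (\<xi> - 1) ^ (n + 1) * (c' - c)"
        unfolding right_diff_distrib c(2)[symmetric] c'(2)[symmetric] by simp
      moreover have "(\<Sum>i<n. fps_nth S i * (\<xi> - 1) ^ i) = (\<Sum>i<n. fps_nth S' i * (\<xi> - 1) ^ i)"
        using less.IH by (intro sum.cong) auto
      ultimately have "(\<xi> - 1) ^ n * (fps_nth S n - fps_nth S' n) = (\<xi> - 1) ^ n * ((\<xi> - 1) * (c' - c))"
        by (simp add: lessThan_Suc_atMost[symmetric] algebra_simps)
      then have "of_int a / of_int b = (\<xi> - 1) * (c' - c)"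
        unfolding ab(2)[symmetric] using nontrivial by simp
      moreover have "c' - c \<in> R" using c c' by (intro diff_closed)
      moreover have "\<bar>a\<bar> < int r" using r(2) by linarith
      ultimately show False using rational_not_multiple \<open>a \<noteq> 0\<close> ab(1) by blast
    qed
  qed
qed

text \<open>The last clause asserts \<open>is_Ohtsuki_series\<close> besides the equation, because
  the description \<open>Ohtsuki_series\<close> is meaningful only once such a series is known to
  exist.\<close>

theorem theorem5:
  fixes d :: nat
  assumes "0 < d"
  shows "(\<forall>f\<in>hat_Lambda d. \<forall>n. fps_nth (hat_taylor1 d f) n \<in> Z_inv d) \<and>
    inj_on (hat_taylor1 d) (hat_Lambda d) \<and>
    (\<forall>(X :: 'a topology) \<mu> I.
       rational_homology_3sphere X \<mu> \<and> H1_order X = d \<and> is_unified_invariant X \<mu> I \<longrightarrow>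
       is_Ohtsuki_series X \<mu> (normalized_taylor1 d I) \<and>
       normalized_taylor1 d I = Ohtsuki_series X \<mu>)"
proof (intro conjI ballI allI impI)
  show "fps_nth (hat_taylor1 d f) n \<in> Z_inv d" if "f \<in> hat_Lambda d" for f n
    by (rule hat_taylor1_over_Z_inv[OF assms that])
  show "inj_on (hat_taylor1 d) (hat_Lambda d)"
    by (rule inj_on_hat_taylor1[OF assms])
next
  fix X :: "'a topology" and \<mu> I
  assume "rational_homology_3sphere X \<mu> \<and> H1_order X = d \<and> is_unified_invariant X \<mu> I"
  then show *: "is_Ohtsuki_series X \<mu> (normalized_taylor1 d I)"
    using is_Ohtsuki_series_normalized_taylor1[OF assms] by blast
  show "normalized_taylor1 d I = Ohtsuki_series X \<mu>"
    unfolding Ohtsuki_series_def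
    using * is_Ohtsuki_series_unique by (intro the_equality[symmetric]) blast+
qed

end
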